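(* Consider the tent family $f_t\colon[-1,1]\to[-1,1]$, $1/2<t\le1$, given by $f_t(x)=-2t|x|+2t-1$, and let $\Phi_{f_t}$ be its Ruelle–Perron–Frobenius operator with respect to Lebesgue measure. Then $\exp(h_{top}(f_t))=2t=|f_t'|$, and $$r_{ess}(\Phi_{f_t},\mathcal{B}^s_{p,q})\le(2t)^{-s}<1$$ for all $s,p,q$ satisfying $0<s<1/p$, $p\in[1,\infty)$ and $q\in[1,\infty]$.
   Context: $h_{top}$ is topological entropy and $r_{ess}$ the essential spectral radius. $[-1,1]$ carries Lebesgue measure $m$, $|A|=m(A)$ (normalization immaterial), and the dyadic grid $\mathcal{D}=(\mathcal{D}^k)_k$, $\mathcal{D}^k$ being the partition of $[-1,1]$ into $2^k$ intervals of equal length. Besov space. Put $a_Q=|Q|^{s-1/p}1_Q$. $\mathcal{B}^s_{p,q}=\mathcal{B}^s_{p,q}([-1,1],m,\mathcal{D})$ is the space of $\psi\in L^p(m)$ that can be written $\psi=\sum_k\sum_{Q\in\mathcal{D}^k}c_Qa_Q$ (the series in $k$ converging in $L^p$) with $\big(\sum_k(\sum_{Q\in\mathcal{D}^k}|c_Q|^p)^{q/p}\big)^{1/q}<\infty$ (supremum over $k$ if $q=\infty$); its norm is the infimum of this quantity over all representations. Transfer operator: $(\Phi_{f_t}\psi)(x)=\sum_{y:\,f_t(y)=x}|f_t'(y)|^{-1}\psi(y)$. *)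

theory Defs
  imports "HOL-Analysis.Analysis"
begin

text \<open>Topological entropy of \<open>f\<close> on the compact set \<open>K\<close> (Bowen--Dinaburg). The limit
  as the separation \<open>\<epsilon>\<close> tends to 0 is a supremum by monotonicity, and the logarithm is taken inside
  the supremum over separated sets, so that the value makes sense in the extended reals.\<close>

definition dyn_separated :: "('a::metric_space \<Rightarrow> 'a) \<Rightarrow> nat \<Rightarrow> real \<Rightarrow> 'a set \<Rightarrow> bool" where
  "dyn_separated f n \<epsilon> E \<longleftrightarrow>
     (\<forall>x\<in>E. \<forall>y\<in>E. x \<noteq> y \<longrightarrow> (\<exists>i<n. dist ((f ^^ i) x) ((f ^^ i) y) > \<epsilon>))"

definition topological_entropy :: "'a::metric_space set \<Rightarrow> ('a \<Rightarrow> 'a) \<Rightarrow> ereal" where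
  "topological_entropy K f =
     (SUP \<epsilon>\<in>{0<..}. limsup (\<lambda>n.
        SUP E\<in>{E. E \<subseteq> K \<and> finite E \<and> E \<noteq> {} \<and> dyn_separated f n \<epsilon> E}.
          ereal (ln (real (card E)) / real n)))"

text \<open>Elements of \<open>L\<^sup>p\<close> and of the Besov space are represented by functions, two functions being
  identified when they agree almost everywhere; scalars are complex. All linear-algebraic notions
  below are therefore taken modulo almost everywhere equality.\<close>

definition Lp_space :: "'a measure \<Rightarrow> real \<Rightarrow> ('a \<Rightarrow> complex) set" where
  "Lp_space M p = {\<psi> \<in> borel_measurable M. integrable M (\<lambda>x. cmod (\<psi> x) powr p)}"

definition Lp_norm :: "'a measure \<Rightarrow> real \<Rightarrow> ('a \<Rightarrow> complex) \<Rightarrow> real" where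
  "Lp_norm M p \<psi> = (\<integral>x. cmod (\<psi> x) powr p \<partial>M) powr (1 / p)"

definition besov_atom :: "'a measure \<Rightarrow> real \<Rightarrow> real \<Rightarrow> 'a set \<Rightarrow> 'a \<Rightarrow> complex" where
  "besov_atom M s p Q x = of_real (measure M Q powr (s - 1 / p) * indicator Q x)"

definition besov_represents ::
    "'a measure \<Rightarrow> (nat \<Rightarrow> 'a set set) \<Rightarrow> real \<Rightarrow> real \<Rightarrow> (nat \<Rightarrow> 'a set \<Rightarrow> complex) \<Rightarrow> ('a \<Rightarrow> complex) \<Rightarrow> bool"
  where
  "besov_represents M D s p c \<psi> \<longleftrightarrow>
     (\<lambda>n. Lp_norm M p (\<lambda>x. \<psi> x - (\<Sum>k<n. \<Sum>Q\<in>D k. c k Q * besov_atom M s p Q x))) \<longlonglongrightarrow> 0"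

definition besov_level ::
    "(nat \<Rightarrow> 'a set set) \<Rightarrow> real \<Rightarrow> (nat \<Rightarrow> 'a set \<Rightarrow> complex) \<Rightarrow> nat \<Rightarrow> real" where
  "besov_level D p c k = (\<Sum>Q\<in>D k. cmod (c k Q) powr p) powr (1 / p)"

definition besov_cost_finite ::
    "(nat \<Rightarrow> 'a set set) \<Rightarrow> real \<Rightarrow> ereal \<Rightarrow> (nat \<Rightarrow> 'a set \<Rightarrow> complex) \<Rightarrow> bool" where
  "besov_cost_finite D p q c \<longleftrightarrow>
     (if q = \<infinity> then bdd_above (range (besov_level D p c))
      else summable (\<lambda>k. besov_level D p c k powr real_of_ereal q))"

definition besov_cost ::
    "(nat \<Rightarrow> 'a set set) \<Rightarrow> real \<Rightarrow> ereal \<Rightarrow> (nat \<Rightarrow> 'a set \<Rightarrow> complex) \<Rightarrow> real" where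
  "besov_cost D p q c =
     (if q = \<infinity> then (SUP k. besov_level D p c k)
      else (\<Sum>k. besov_level D p c k powr real_of_ereal q) powr (1 / real_of_ereal q))"

definition besov_space ::
    "'a measure \<Rightarrow> (nat \<Rightarrow> 'a set set) \<Rightarrow> real \<Rightarrow> real \<Rightarrow> ereal \<Rightarrow> ('a \<Rightarrow> complex) set" where
  "besov_space M D s p q =
     {\<psi> \<in> Lp_space M p. \<exists>c. besov_represents M D s p c \<psi> \<and> besov_cost_finite D p q c}"

definition besov_norm ::
    "'a measure \<Rightarrow> (nat \<Rightarrow> 'a set set) \<Rightarrow> real \<Rightarrow> real \<Rightarrow> ereal \<Rightarrow> ('a \<Rightarrow> complex) \<Rightarrow> real" where
  "besov_norm M D s p q \<psi> =
     Inf {besov_cost D p q c | c. besov_represents M D s p c \<psi> \<and> besov_cost_finite D p q c}"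

text \<open>The cells are half-open, except that the rightmost one contains the endpoint 1.\<close>

definition dyadic_cell :: "nat \<Rightarrow> nat \<Rightarrow> real set" where
  "dyadic_cell k j =
     {-1 + 2 * real j / 2 ^ k ..< -1 + 2 * real (Suc j) / 2 ^ k} \<union> (if Suc j = 2 ^ k then {1} else {})"

definition dyadic_grid :: "nat \<Rightarrow> real set set" where
  "dyadic_grid k = dyadic_cell k ` {..<2 ^ k}"

text \<open>In the next definitions \<open>V\<close> is a vector space of functions and \<open>nrm\<close> its norm, both
  understood modulo almost everywhere equality with respect to \<open>M\<close>.\<close>

definition bounded_linear_operator_on ::
    "'a measure \<Rightarrow> ('a \<Rightarrow> complex) set \<Rightarrow> (('a \<Rightarrow> complex) \<Rightarrow> real) \<Rightarrow>
     (('a \<Rightarrow> complex) \<Rightarrow> 'a \<Rightarrow> complex) \<Rightarrow> bool" where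
  "bounded_linear_operator_on M V nrm T \<longleftrightarrow>
     (\<forall>v\<in>V. T v \<in> V) \<and>
     (\<forall>u\<in>V. \<forall>v\<in>V. (AE x in M. u x = v x) \<longrightarrow> (AE x in M. T u x = T v x)) \<and>
     (\<forall>u\<in>V. \<forall>v\<in>V. AE x in M. T (\<lambda>y. u y + v y) x = T u x + T v x) \<and>
     (\<forall>a. \<forall>v\<in>V. AE x in M. T (\<lambda>y. a * v y) x = a * T v x) \<and>
     (\<exists>C. \<forall>v\<in>V. nrm (T v) \<le> C * nrm v)"

text \<open>Finite-dimensional kernel, closed range, range of finite codimension.\<close>

definition fredholm_on ::
    "'a measure \<Rightarrow> ('a \<Rightarrow> complex) set \<Rightarrow> (('a \<Rightarrow> complex) \<Rightarrow> real) \<Rightarrow>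
     (('a \<Rightarrow> complex) \<Rightarrow> 'a \<Rightarrow> complex) \<Rightarrow> bool" where
  "fredholm_on M V nrm S \<longleftrightarrow>
     (\<exists>F. finite F \<and> F \<subseteq> V \<and>
        (\<forall>v\<in>V. (AE x in M. S v x = 0) \<longrightarrow> (\<exists>a. AE x in M. v x = (\<Sum>g\<in>F. a g * g x)))) \<and>
     (\<forall>w\<in>V. (\<forall>e>0. \<exists>v\<in>V. nrm (\<lambda>x. w x - S v x) < e) \<longrightarrow> (\<exists>v\<in>V. AE x in M. w x = S v x)) \<and>
     (\<exists>F. finite F \<and> F \<subseteq> V \<and>
        (\<forall>w\<in>V. \<exists>v\<in>V. \<exists>a. AE x in M. w x = S v x + (\<Sum>g\<in>F. a g * g x)))"

definition essential_spectrum ::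
    "'a measure \<Rightarrow> ('a \<Rightarrow> complex) set \<Rightarrow> (('a \<Rightarrow> complex) \<Rightarrow> real) \<Rightarrow>
     (('a \<Rightarrow> complex) \<Rightarrow> 'a \<Rightarrow> complex) \<Rightarrow> complex set" where
  "essential_spectrum M V nrm T = {z. \<not> fredholm_on M V nrm (\<lambda>v x. z * v x - T v x)}"

definition essential_spectral_radius ::
    "'a measure \<Rightarrow> ('a \<Rightarrow> complex) set \<Rightarrow> (('a \<Rightarrow> complex) \<Rightarrow> real) \<Rightarrow>
     (('a \<Rightarrow> complex) \<Rightarrow> 'a \<Rightarrow> complex) \<Rightarrow> ennreal" where
  "essential_spectral_radius M V nrm T =
     (SUP z\<in>essential_spectrum M V nrm T. ennreal (cmod z))"

definition tent :: "real \<Rightarrow> real \<Rightarrow> real" where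
  "tent t x = - 2 * t * \<bar>x\<bar> + 2 * t - 1"

text \<open>The value at images of points where \<open>f\<close> is not differentiable is irrelevant: for the tent map
  this is one point \<open>x\<close>. The sum is meant for maps with finite fibres.\<close>

definition transfer_operator ::
    "real set \<Rightarrow> (real \<Rightarrow> real) \<Rightarrow> (real \<Rightarrow> complex) \<Rightarrow> real \<Rightarrow> complex" where
  "transfer_operator I f \<psi> x = (\<Sum>y\<in>{y\<in>I. f y = x}. of_real (1 / \<bar>deriv f y\<bar>) * \<psi> y)"

end

theory Submission
  imports Defs
begin

text \<open>Write \<open>\<lambda> = 2t\<close>. On a lap of \<open>f\<^sup>n\<close> distances are stretched by exactly \<open>\<lambda>\<^sup>n\<close>, while a set that stays
  small along the orbit meets at most three laps per block of \<open>N\<close> iterates, so \<open>f\<^sup>k\<^sup>N\<close> has between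
  \<open>\<lambda>\<^sup>k\<^sup>N / 2\<close> and \<open>C 3\<^sup>k \<lambda>\<^sup>k\<^sup>N\<close> laps. With the Lipschitz bound this gives the entropy.

  The Besov norm is equivalent to the \<open>\<ell>\<^sup>q\<close> norm of \<open>2\<^sup>k\<^sup>s e\<^sub>k(u)\<close>, where \<open>e\<^sub>k\<close> is the \<open>L\<^sup>p\<close> distance to the
  conditional expectation on the level-\<open>k\<close> cells. A step function of level \<open>k\<close> is mapped by \<open>\<Phi>\<^sup>n\<close> to a
  sum of steps at scale \<open>\<lambda>\<^sup>n 2\<^sup>-\<^sup>k\<close>; approximating it by step functions on a grid finer by \<open>2\<^sup>-\<^sup>j\<close> gains a factor
  \<open>2\<^sup>-\<^sup>j\<^sup>/\<^sup>p\<close>, which beats the weight \<open>2\<^sup>j\<^sup>s\<close> because \<open>s < 1/p\<close>. Schur's test then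
  bounds \<open>\<Phi>\<^sup>n\<close> on functions without coarse scales by \<open>C 3\<^sup>k \<lambda>\<^sup>-\<^sup>s\<^sup>n\<close> for \<open>n = kN\<close>, and the coarse scales form a finite rank perturbation; since
  \<open>3\<^sup>1\<^sup>/\<^sup>N\<close> is as close to 1 as desired, \<open>z - \<Phi>\<close> is Fredholm whenever \<open>|z| > \<lambda>\<^sup>-\<^sup>s\<close>.\<close>

section \<open>Lebesgue spaces and sequence spaces\<close>

text \<open>The turning point need not have a finite orbit, so no Markov partition is at hand and
  laps are counted only up to a factor \<open>3 ^ k\<close>. The loss is harmless because essential
  spectral radii see only n-th roots: for a given z one first fixes the block length and then the
  number of blocks. A second obstacle is that dyadic cells meet at most three laps of an iterate
  only below a scale that depends on the iterate. Every bound on the fine part must therefore be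
  independent of the cut-off level, which can then be taken as large as needed, since it enters only
  through a finite rank operator. The Besov norm is an infimum over representations. The equivalent
  norm is built from linear projections instead: they supply the finite rank operator, and the
  triangle inequality and completeness reduce to those of function and sequence spaces. Fredholmness
  is read off from kernel, range and codimension directly; closedness of the range comes down to a
  linear subspace of a finite-dimensional coefficient space being closed.\<close>

text \<open>Convexity of the power is used on the open half line, so x = 0 is checked by hand: there
  the tangent has the value (1 - p) a^p, which is at most 0.\<close>

lemma powr_above_tangent:
  fixes p a x :: real
  assumes "p \<ge> 1" "a > 0" "x \<ge> 0"
  shows "a powr p + p * a powr (p - 1) * (x - a) \<le> x powr p"
proof (cases "x = 0")
  case True
  have "a powr p = a powr (p - 1) * a"
    using assms by (metis powr_mult_base mult.commute add.commute diff_add_cancel less_imp_le)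
  then have "a powr p + p * a powr (p - 1) * (x - a) = (1 - p) * (a powr (p - 1) * a)"
    using True by (simp add: algebra_simps)
  also have "\<dots> \<le> 0"
    using assms by (intro mult_nonpos_nonneg) auto
  finally show ?thesis using True by simp
next
  case False
  have "x powr p - a powr p \<ge> (p * a powr (p - 1)) * (x - a)"
  proof (rule convex_on_imp_above_tangent)
    show "convex_on {0<..} (\<lambda>x. x powr p)" by (rule powr_convex) fact
    show "((\<lambda>x. x powr p) has_real_derivative p * a powr (p - 1)) (at a within {0<..})"
      using assms by (auto intro!: derivative_eq_intros)
  qed (use assms False in \<open>auto simp: interior_open\<close>)
  then show ?thesis by simp
qed

text \<open>Sum the tangent inequality at the weighted mean a = X / W; the linear terms cancel. The
  weights are not normalised, which costs the factor W^(p-1).\<close>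

lemma weighted_jensen_powr:
  fixes w x :: "'i \<Rightarrow> real"
  assumes "finite S" "p \<ge> 1" and w: "\<And>i. i \<in> S \<Longrightarrow> w i \<ge> 0" and x: "\<And>i. i \<in> S \<Longrightarrow> x i \<ge> 0"
  shows "(\<Sum>i\<in>S. w i * x i) powr p \<le> (\<Sum>i\<in>S. w i) powr (p - 1) * (\<Sum>i\<in>S. w i * x i powr p)"
proof (cases "(\<Sum>i\<in>S. w i * x i) = 0")
  case True
  have "0 \<le> (\<Sum>i\<in>S. w i * x i powr p)" using w by (intro sum_nonneg) auto
  then show ?thesis using True by simp
next
  case False
  define X where "X = (\<Sum>i\<in>S. w i * x i)"
  define W where "W = (\<Sum>i\<in>S. w i)"
  have X: "X > 0" using False w x by (auto simp: X_def less_le intro!: sum_nonneg)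
  have "W \<noteq> 0"
  proof
    assume "W = 0"
    then have "\<forall>i\<in>S. w i = 0" using w assms(1) by (simp add: W_def sum_nonneg_eq_0_iff)
    then show False using X by (simp add: X_def)
  qed
  moreover have "W \<ge> 0" using w by (auto simp: W_def intro!: sum_nonneg)
  ultimately have W: "W > 0" by simp
  define a where "a = X / W"
  have a: "a > 0" using X W by (simp add: a_def)
  have "W * a powr p = (\<Sum>i\<in>S. w i * (a powr p + p * a powr (p - 1) * (x i - a)))"
  proof -
    have "(\<Sum>i\<in>S. w i * (a powr p + p * a powr (p - 1) * (x i - a)))
       = a powr p * W + p * a powr (p - 1) * (X - a * W)"
      by (simp add: W_def X_def algebra_simps sum.distrib sum_distrib_left sum_distrib_right sum_subtractf)
    moreover have "X - a * W = 0" using W by (simp add: a_def)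
    ultimately show ?thesis by simp
  qed
  also have "\<dots> \<le> (\<Sum>i\<in>S. w i * x i powr p)"
    using assms a by (intro sum_mono mult_left_mono powr_above_tangent) auto
  finally have "W * a powr p \<le> (\<Sum>i\<in>S. w i * x i powr p)" .
  then have "W powr (p - 1) * (W * a powr p) \<le> W powr (p - 1) * (\<Sum>i\<in>S. w i * x i powr p)"
    by (rule mult_left_mono) simp
  moreover have "W powr (p - 1) * (W * a powr p) = X powr p"
  proof -
    have "W powr (p - 1) * W = W powr p"
      using W by (metis powr_mult_base mult.commute add.commute diff_add_cancel less_imp_le)
    then have "W powr (p - 1) * (W * a powr p) = (W * a) powr p"
      using W a by (simp add: powr_mult flip: mult.assoc)
    then show ?thesis using W by (simp add: a_def)
  qed
  ultimately show ?thesis by (simp add: X_def W_def)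
qed

lemma powr_sum_le:
  fixes x :: "'i \<Rightarrow> real"
  assumes "finite S" "p \<ge> 1" and "\<And>i. i \<in> S \<Longrightarrow> x i \<ge> 0"
  shows "(\<Sum>i\<in>S. x i) powr p \<le> real (card S) powr (p - 1) * (\<Sum>i\<in>S. x i powr p)"
  using weighted_jensen_powr[of S p "\<lambda>_. 1" x] assms by simp

text \<open>Jensen for a / \<alpha> and b / \<beta> with weights \<alpha> and \<beta>. With weights
  just above the two norms it integrates to Minkowski's inequality; with weights 1 it shows closure
  under addition.\<close>

lemma powr_add_le_weighted:
  fixes a b :: complex
  assumes "p \<ge> 1" "\<alpha> > 0" "\<beta> > 0"
  shows "cmod (a + b) powr p \<le>
    (\<alpha> + \<beta>) powr (p - 1) * (\<alpha> powr (1 - p) * cmod a powr p + \<beta> powr (1 - p) * cmod b powr p)"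
proof -
  have A: "\<alpha> * (x / \<alpha>) powr p = \<alpha> powr (1 - p) * x powr p" if "\<alpha> > 0" "x \<ge> 0" for \<alpha> x :: real
    using that by (simp add: powr_divide powr_diff)
  have "cmod (a + b) powr p \<le> (cmod a + cmod b) powr p"
    using assms by (intro powr_mono2 norm_triangle_ineq) auto
  also have "\<dots> = (\<Sum>i\<in>{True,False}. (if i then \<alpha> else \<beta>) * (if i then cmod a / \<alpha> else cmod b / \<beta>)) powr p"
    using assms by simp
  also have "\<dots> \<le> (\<Sum>i\<in>{True,False}. (if i then \<alpha> else \<beta>)) powr (p - 1) *
     (\<Sum>i\<in>{True,False}. (if i then \<alpha> else \<beta>) * (if i then cmod a / \<alpha> else cmod b / \<beta>) powr p)"
    using assms by (intro weighted_jensen_powr) auto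
  also have "\<dots> = (\<alpha> + \<beta>) powr (p - 1) * (\<alpha> powr (1 - p) * cmod a powr p + \<beta> powr (1 - p) * cmod b powr p)"
    using assms by (simp add: A)
  finally show ?thesis .
qed

lemma Lp_spaceD:
  assumes "u \<in> Lp_space M p"
  shows "u \<in> borel_measurable M" "integrable M (\<lambda>x. cmod (u x) powr p)"
  using assms by (auto simp: Lp_space_def)

lemma Lp_space_bound:
  assumes "u \<in> borel_measurable M" "integrable M f" "AE x in M. cmod (u x) powr p \<le> f x"
  shows "u \<in> Lp_space M p"
  unfolding Lp_space_def
proof (intro CollectI conjI assms(1) Bochner_Integration.integrable_bound[OF assms(2)])
  show "(\<lambda>x. cmod (u x) powr p) \<in> borel_measurable M" using assms(1) by measurable
  show "AE x in M. norm (cmod (u x) powr p) \<le> norm (f x)" using assms(3) by eventually_elim simp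
qed

lemma Lp_space_zero [simp]: "(\<lambda>x. 0) \<in> Lp_space M p"
  by (simp add: Lp_space_def)

lemma Lp_space_add:
  assumes "p \<ge> 1" "u \<in> Lp_space M p" "v \<in> Lp_space M p"
  shows "(\<lambda>x. u x + v x) \<in> Lp_space M p"
proof (rule Lp_space_bound)
  show "(\<lambda>x. u x + v x) \<in> borel_measurable M"
    using Lp_spaceD(1)[OF assms(2)] Lp_spaceD(1)[OF assms(3)] by simp
  show "integrable M (\<lambda>x. (1 + 1) powr (p - 1) * (1 powr (1 - p) * cmod (u x) powr p + 1 powr (1 - p) * cmod (v x) powr p))"
    using assms by (intro integrable_mult_right Bochner_Integration.integrable_add) (auto simp: Lp_spaceD)
  show "AE x in M. cmod (u x + v x) powr p \<le> (1 + 1) powr (p - 1) * (1 powr (1 - p) * cmod (u x) powr p + 1 powr (1 - p) * cmod (v x) powr p)"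
    using powr_add_le_weighted[OF assms(1), of 1 1] by (intro AE_I2) simp
qed

lemma Lp_space_cmult:
  assumes "u \<in> Lp_space M p"
  shows "(\<lambda>x. a * u x) \<in> Lp_space M p"
  using assms by (auto simp: Lp_space_def norm_mult powr_mult)

lemma Lp_space_diff:
  assumes "p \<ge> 1" "u \<in> Lp_space M p" "v \<in> Lp_space M p"
  shows "(\<lambda>x. u x - v x) \<in> Lp_space M p"
  using Lp_space_add[OF assms(1,2) Lp_space_cmult[OF assms(3), of "-1"]] by simp

lemma Lp_space_sum:
  assumes "p \<ge> 1" "\<And>i. i \<in> S \<Longrightarrow> u i \<in> Lp_space M p"
  shows "(\<lambda>x. \<Sum>i\<in>S. u i x) \<in> Lp_space M p"
  using assms(2)
  by (induction S rule: infinite_finite_induct) (auto intro!: Lp_space_add[OF assms(1)])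

lemma Lp_norm_nonneg [simp]: "0 \<le> Lp_norm M p u"
  by (simp add: Lp_norm_def)

lemma Lp_norm_zero [simp]: "Lp_norm M p (\<lambda>x. 0) = 0"
  by (simp add: Lp_norm_def)

lemma Lp_norm_powr:
  assumes "p \<ge> 1"
  shows "Lp_norm M p u powr p = (\<integral>x. cmod (u x) powr p \<partial>M)"
  using assms by (simp add: Lp_norm_def powr_powr)

lemma Lp_norm_leI:
  assumes "p \<ge> 1" "C \<ge> 0" "(\<integral>x. cmod (u x) powr p \<partial>M) \<le> C powr p"
  shows "Lp_norm M p u \<le> C"
proof -
  have "Lp_norm M p u powr p \<le> C powr p" using assms by (simp add: Lp_norm_powr)
  then show ?thesis
    using assms by (metis Lp_norm_nonneg less_le_not_le not_le powr_less_mono2 dual_order.strict_trans1 zero_less_one)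
qed

lemma Lp_norm_cong_AE:
  assumes "u \<in> borel_measurable M" "v \<in> borel_measurable M" "AE x in M. u x = v x"
  shows "Lp_norm M p u = Lp_norm M p v"
  unfolding Lp_norm_def
  by (rule arg_cong[where f = "\<lambda>z. z powr (1/p)"], rule integral_cong_AE)
     (use assms in \<open>auto elim: eventually_mono\<close>)

lemma Lp_norm_cmult:
  assumes "p \<ge> 1"
  shows "Lp_norm M p (\<lambda>x. a * u x) = cmod a * Lp_norm M p u"
  using assms by (simp add: Lp_norm_def norm_mult powr_mult powr_powr)

lemma Lp_norm_triangle:
  assumes p: "p \<ge> 1" and u: "u \<in> Lp_space M p" and v: "v \<in> Lp_space M p"
  shows "Lp_norm M p (\<lambda>x. u x + v x) \<le> Lp_norm M p u + Lp_norm M p v"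
proof -
  \<comment> \<open>Numbers strictly above the two norms are positive, so a vanishing norm needs no
    case of its own; they decrease to the norms at the end.\<close>
  have *: "Lp_norm M p (\<lambda>x. u x + v x) \<le> \<alpha> + \<beta>"
    if a: "\<alpha> > Lp_norm M p u" and b: "\<beta> > Lp_norm M p v" for \<alpha> \<beta>
  proof (rule Lp_norm_leI[OF p])
    have ab: "\<alpha> > 0" "\<beta> > 0" using a b Lp_norm_nonneg by (meson le_less_trans)+
    then show "\<alpha> + \<beta> \<ge> 0" by simp
    have "(\<integral>x. cmod (u x + v x) powr p \<partial>M) \<le> (\<integral>x. (\<alpha> + \<beta>) powr (p - 1) * (\<alpha> powr (1 - p) * cmod (u x) powr p + \<beta> powr (1 - p) * cmod (v x) powr p) \<partial>M)"
      using u v ab p by (intro integral_mono Lp_spaceD(2)[OF Lp_space_add] powr_add_le_weighted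
        integrable_mult_right Bochner_Integration.integrable_add Lp_spaceD(2))
    also have "\<dots> = (\<alpha> + \<beta>) powr (p - 1) * (\<alpha> powr (1 - p) * Lp_norm M p u powr p + \<beta> powr (1 - p) * Lp_norm M p v powr p)"
      using u v p by (simp add: Lp_norm_powr Lp_spaceD)
    also have "\<dots> \<le> (\<alpha> + \<beta>) powr (p - 1) * (\<alpha> powr (1 - p) * \<alpha> powr p + \<beta> powr (1 - p) * \<beta> powr p)"
      using a b p by (intro mult_left_mono add_mono powr_mono2) auto
    also have "\<dots> = (\<alpha> + \<beta>) powr (p - 1) * (\<alpha> + \<beta>)"
      using ab by (simp flip: powr_add)
    also have "\<dots> = (\<alpha> + \<beta>) powr p"
      using ab by (metis powr_mult_base mult.commute add.commute diff_add_cancel less_imp_le add_nonneg_nonneg)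
    finally show "(\<integral>x. cmod (u x + v x) powr p \<partial>M) \<le> (\<alpha> + \<beta>) powr p" .
  qed
  show ?thesis
  proof (rule field_le_epsilon)
    fix e :: real assume "e > 0"
    then show "Lp_norm M p (\<lambda>x. u x + v x) \<le> Lp_norm M p u + Lp_norm M p v + e"
      using *[of "Lp_norm M p u + e/2" "Lp_norm M p v + e/2"] by simp
  qed
qed

lemma Lp_norm_triangle_diff:
  assumes p: "p \<ge> 1" and u: "u \<in> Lp_space M p" and v: "v \<in> Lp_space M p"
  shows "Lp_norm M p (\<lambda>x. u x - v x) \<le> Lp_norm M p u + Lp_norm M p v"
  using Lp_norm_triangle[OF p u Lp_space_cmult[OF v, of "-1"]] Lp_norm_cmult[OF p, of M "-1" v]
  by (simp add: fun_eq_iff)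

lemma Lp_norm_sum:
  assumes "p \<ge> 1" "\<And>i. i \<in> S \<Longrightarrow> u i \<in> Lp_space M p"
  shows "Lp_norm M p (\<lambda>x. \<Sum>i\<in>S. u i x) \<le> (\<Sum>i\<in>S. Lp_norm M p (u i))"
  using assms(2)
proof (induction S rule: infinite_finite_induct)
  case (insert i S)
  then have "Lp_norm M p (\<lambda>x. u i x + (\<Sum>i\<in>S. u i x)) \<le> Lp_norm M p (u i) + Lp_norm M p (\<lambda>x. \<Sum>i\<in>S. u i x)"
    by (intro Lp_norm_triangle Lp_space_sum assms(1)) auto
  then show ?case using insert by auto
qed auto

lemma Lp_norm_eq_0_AE:
  assumes "p \<ge> 1" "u \<in> Lp_space M p" "Lp_norm M p u = 0"
  shows "AE x in M. u x = 0"
proof -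
  have "(\<integral>x. cmod (u x) powr p \<partial>M) = 0" using Lp_norm_powr[OF assms(1), of M u] assms by simp
  then have "AE x in M. cmod (u x) powr p = 0"
    using assms by (subst (asm) integral_nonneg_eq_0_iff_AE) (auto simp: Lp_spaceD)
  then show ?thesis by eventually_elim (simp add: powr_eq_0_iff)
qed

text \<open>Weighting the \<open>j\<close>-th term by \<open>\<sigma>\<^sup>j\<close> with \<open>\<rho> < \<sigma> < 1\<close> turns Jensen's inequality into an integrable
  majorant of the \<open>p\<close>-th powers of all partial sums at once.\<close>

lemma Lp_complete_geometric:
  assumes p: "p \<ge> 1" and v: "\<And>j. v j \<in> Lp_space M p"
    and \<rho>: "0 < \<rho>" "\<rho> < 1" and le: "\<And>j. Lp_norm M p (v j) \<le> C * \<rho> ^ j"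
  shows "\<exists>w\<in>Lp_space M p. (\<lambda>n. Lp_norm M p (\<lambda>x. w x - (\<Sum>j<n. v j x))) \<longlonglongrightarrow> 0"
proof -
  \<comment> \<open>With \<sigma>^2 = \<rho>, the function \<open>h j\<close> integrates to at most
    C^p \<sigma>^j (\<sigma>^j)^p, which a geometric series dominates.\<close>
  define \<sigma> where "\<sigma> = sqrt \<rho>"
  have \<sigma>: "0 < \<sigma>" "\<sigma> < 1" "\<sigma> * \<sigma> = \<rho>" using \<rho> by (auto simp: \<sigma>_def)
  have C: "C \<ge> 0" using le[of 0] Lp_norm_nonneg[of M p "v 0"] by (simp del: Lp_norm_nonneg)
  define W where "W = 1 / (1 - \<sigma>)"
  have W: "(\<Sum>j\<in>S. \<sigma> ^ j) \<le> W" if "finite S" for S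
    using \<sigma> that sum_le_suminf[of "\<lambda>j. \<sigma> ^ j" S] by (simp add: suminf_geometric W_def)
  define h where "h j x = (\<sigma> ^ j) powr (1 - p) * cmod (v j x) powr p" for j x
  have h0: "h j x \<ge> 0" for j x by (simp add: h_def)
  have hint: "integrable M (h j)" for j 
    unfolding h_def by (intro integrable_mult_right Lp_spaceD(2) v)
  have "summable (\<lambda>j. \<integral>x. norm (h j x) \<partial>M)"
  proof (rule summable_comparison_test')
    show "summable (\<lambda>j. C powr p * \<sigma> ^ j)" using \<sigma> by (intro summable_mult summable_geometric) auto
    fix j :: nat
    have "(\<integral>x. norm (h j x) \<partial>M) = (\<sigma> ^ j) powr (1 - p) * Lp_norm M p (v j) powr p"
      using p by (simp add: h_def Lp_norm_powr abs_mult)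
    also have "\<dots> \<le> (\<sigma> ^ j) powr (1 - p) * (C * \<rho> ^ j) powr p"
      using p by (intro mult_left_mono powr_mono2 le) auto
    also have "\<dots> = (\<sigma> ^ j) powr (1 - p) * (\<sigma> ^ j * \<sigma> ^ j) powr p * C powr p"
      using \<sigma> C by (simp add: powr_mult flip: power_mult_distrib)
    also have "\<dots> = C powr p * (\<sigma> ^ j * (\<sigma> ^ j) powr p)"
      using \<sigma> by (simp add: powr_mult powr_diff)
    also have "\<dots> \<le> C powr p * (\<sigma> ^ j * 1)"
      using \<sigma> p by (intro mult_left_mono powr_le1) (auto simp: power_le_one)
    finally show "norm (\<integral>x. norm (h j x) \<partial>M) \<le> C powr p * \<sigma> ^ j" by simp
  qed
  note hsum = this
  have AEs: "AE x in M. summable (\<lambda>j. h j x)"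
  proof -
    have "(\<integral>\<^sup>+x. (\<Sum>j. ennreal (h j x)) \<partial>M) = (\<Sum>j. \<integral>\<^sup>+x. ennreal (h j x) \<partial>M)"
      using hint by (intro nn_integral_suminf) auto
    also have "\<dots> = (\<Sum>j. ennreal (\<integral>x. norm (h j x) \<partial>M))"
      using hint h0 by (intro suminf_cong) (simp add: nn_integral_eq_integral)
    also have "\<dots> < \<infinity>"
      using hsum by (simp add: ennreal_suminf_neq_top less_top[symmetric] integral_nonneg_AE)
    finally have "AE x in M. (\<Sum>j. ennreal (h j x)) \<noteq> \<infinity>"
      using hint by (intro nn_integral_PInf_AE) auto
    then show ?thesis
      by eventually_elim (use h0 in \<open>auto intro: summable_suminf_not_top\<close>)
  qed
  define G where "G x = (\<Sum>j. h j x)" for x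
  have Gint: "integrable M G" unfolding G_def
    by (rule integrable_suminf) (use hint hsum AEs h0 in auto)
  have tail: "cmod (\<Sum>j\<in>S. v j x) powr p \<le> W powr (p - 1) * G x \<and> (\<Sum>j\<in>S. cmod (v j x)) powr p \<le> W powr (p - 1) * G x"
    if "summable (\<lambda>j. h j x)" "finite S" for S x
  proof -
    have "(\<Sum>j\<in>S. cmod (v j x)) powr p = (\<Sum>j\<in>S. \<sigma> ^ j * (cmod (v j x) / \<sigma> ^ j)) powr p"
      using \<sigma> by simp
    also have "\<dots> \<le> (\<Sum>j\<in>S. \<sigma> ^ j) powr (p - 1) * (\<Sum>j\<in>S. \<sigma> ^ j * (cmod (v j x) / \<sigma> ^ j) powr p)"
      using \<sigma> p that by (intro weighted_jensen_powr) auto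
    also have "(\<Sum>j\<in>S. \<sigma> ^ j * (cmod (v j x) / \<sigma> ^ j) powr p) = (\<Sum>j\<in>S. h j x)"
      using \<sigma> by (intro sum.cong) (auto simp: h_def powr_divide powr_diff)
    also have "(\<Sum>j\<in>S. \<sigma> ^ j) powr (p - 1) * (\<Sum>j\<in>S. h j x) \<le> W powr (p - 1) * G x"
      using \<sigma> p that W unfolding G_def
      by (intro mult_mono powr_mono2 sum_le_suminf sum_nonneg) (auto simp: h0)
    finally have 1: "(\<Sum>j\<in>S. cmod (v j x)) powr p \<le> W powr (p - 1) * G x" .
    have "cmod (\<Sum>j\<in>S. v j x) powr p \<le> (\<Sum>j\<in>S. cmod (v j x)) powr p"
      using p by (intro powr_mono2 norm_sum) auto
    then show ?thesis using 1 by simp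
  qed
  have summ: "summable (\<lambda>j. cmod (v j x))" if "summable (\<lambda>j. h j x)" for x
  proof (rule bounded_imp_summable[where B = "(W powr (p - 1) * G x) powr (1/p)"])
    fix n
    have "(\<Sum>j\<le>n. cmod (v j x)) = ((\<Sum>j\<le>n. cmod (v j x)) powr p) powr (1/p)"
      using p by (simp add: powr_powr sum_nonneg)
    also have "\<dots> \<le> (W powr (p - 1) * G x) powr (1/p)"
      using p tail[OF that, of "{..n}"] by (intro powr_mono2) auto
    finally show "(\<Sum>j\<le>n. cmod (v j x)) \<le> (W powr (p - 1) * G x) powr (1/p)" .
  qed auto
  define w where "w x = (\<Sum>j. v j x)" for x
  have wm: "w \<in> borel_measurable M" unfolding w_def by (rule borel_measurable_suminf) (rule Lp_spaceD(1)[OF v])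
  have lim: "(\<lambda>n. \<Sum>j<n. v j x) \<longlonglongrightarrow> w x" if "summable (\<lambda>j. h j x)" for x
    unfolding w_def by (rule summable_LIMSEQ[OF summable_norm_cancel[OF summ[OF that]]])
  have wle: "cmod (w x - (\<Sum>j<n. v j x)) powr p \<le> W powr (p - 1) * G x" if s: "summable (\<lambda>j. h j x)" for x n
  proof (rule LIMSEQ_le_const2)
    show "(\<lambda>m. cmod ((\<Sum>j<m. v j x) - (\<Sum>j<n. v j x)) powr p) \<longlonglongrightarrow> cmod (w x - (\<Sum>j<n. v j x)) powr p"
      using p by (intro tendsto_powr2 tendsto_intros lim s) auto
    show "\<exists>N. \<forall>m\<ge>N. cmod ((\<Sum>j<m. v j x) - (\<Sum>j<n. v j x)) powr p \<le> W powr (p - 1) * G x"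
    proof (intro exI[of _ n] allI impI)
      fix m assume "n \<le> m"
      then have "(\<Sum>j<m. v j x) - (\<Sum>j<n. v j x) = (\<Sum>j\<in>{n..<m}. v j x)"
        by (simp add: sum_diff_nat_ivl lessThan_atLeast0)
      then show "cmod ((\<Sum>j<m. v j x) - (\<Sum>j<n. v j x)) powr p \<le> W powr (p - 1) * G x"
        using tail[OF s, of "{n..<m}"] by simp
    qed
  qed
  have WG: "integrable M (\<lambda>x. W powr (p - 1) * G x)" using Gint by simp
  show ?thesis
  proof (intro bexI)
    show "w \<in> Lp_space M p"
      using wle[where n = 0] AEs by (intro Lp_space_bound[OF wm WG]) (auto elim!: eventually_mono)
    have "(\<lambda>n. \<integral>x. cmod (w x - (\<Sum>j<n. v j x)) powr p \<partial>M) \<longlonglongrightarrow> (\<integral>x. 0 \<partial>M)"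
    proof (rule integral_dominated_convergence[OF _ _ WG])
      show "AE x in M. (\<lambda>n. cmod (w x - (\<Sum>j<n. v j x)) powr p) \<longlonglongrightarrow> 0"
        using AEs
      proof eventually_elim
        case (elim x)
        have "(\<lambda>n. cmod (w x - (\<Sum>j<n. v j x)) powr p) \<longlonglongrightarrow> cmod (w x - w x) powr p"
          using p by (intro tendsto_powr2 tendsto_intros lim elim) auto
        then show ?case using p by simp
      qed
      show "\<And>n. AE x in M. norm (cmod (w x - (\<Sum>j<n. v j x)) powr p) \<le> W powr (p - 1) * G x"
        using AEs by (auto elim!: eventually_mono simp: wle)
      have [measurable]: "v j \<in> borel_measurable M" for j by (rule Lp_spaceD(1)[OF v])
      note wm[measurable]
      show "(\<lambda>x. cmod (w x - (\<Sum>j<n. v j x)) powr p) \<in> borel_measurable M" for n by measurable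
    qed simp
    then have "(\<lambda>n. (\<integral>x. cmod (w x - (\<Sum>j<n. v j x)) powr p \<partial>M) powr (1/p)) \<longlonglongrightarrow> 0 powr (1/p)"
      using p by (intro tendsto_powr2) auto
    then show "(\<lambda>n. Lp_norm M p (\<lambda>x. w x - (\<Sum>j<n. v j x))) \<longlonglongrightarrow> 0"
      using p by (simp add: Lp_norm_def)
  qed
qed


section \<open>The sequence spaces l^q for q between 1 and infinity\<close>

definition lq_fin :: "ereal \<Rightarrow> (nat \<Rightarrow> real) \<Rightarrow> bool" where
  "lq_fin q x \<longleftrightarrow> (if q = \<infinity> then bdd_above (range x) else summable (\<lambda>k. x k powr real_of_ereal q))"

text \<open>The case split follows \<open>besov_cost\<close>, so the two agree by unfolding when x
  is a \<open>besov_level\<close> sequence.\<close>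

definition lq_norm :: "ereal \<Rightarrow> (nat \<Rightarrow> real) \<Rightarrow> real" where
  "lq_norm q x = (if q = \<infinity> then (SUP k. x k)
     else (\<Sum>k. x k powr real_of_ereal q) powr (1 / real_of_ereal q))"

lemma lq_norm_nonneg:
  assumes "\<And>k. x k \<ge> 0" "lq_fin q x"
  shows "lq_norm q x \<ge> 0"
  using assms by (auto simp: lq_norm_def lq_fin_def intro: cSUP_upper2)

lemma ereal_ge_1_cases:
  assumes "(1::ereal) \<le> q"
  obtains "q = \<infinity>" | r where "q = ereal r" "r \<ge> 1"
  using assms by (cases q) auto

lemma lq_bound_infinity:
  assumes "\<And>k. x k \<le> A"
  shows "lq_fin \<infinity> x \<and> lq_norm \<infinity> x \<le> A"
  using assms by (auto simp: lq_fin_def lq_norm_def intro!: cSUP_least bdd_aboveI2)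

lemma lq_bound_real:
  assumes "r \<ge> 1" "\<And>k. x k \<ge> 0" "A \<ge> 0" "\<And>n. (\<Sum>k<n. x k powr r) \<le> A powr r"
  shows "lq_fin (ereal r) x \<and> lq_norm (ereal r) x \<le> A"
proof -
  have s: "summable (\<lambda>k. x k powr r)"
    by (rule summableI_nonneg_bounded[where x = "A powr r"]) (use assms in auto)
  then have "(\<Sum>k. x k powr r) \<le> A powr r" by (rule suminf_le_const) (use assms in auto)
  then have "(\<Sum>k. x k powr r) powr (1/r) \<le> (A powr r) powr (1/r)"
    using assms s by (intro powr_mono2 suminf_nonneg) auto
  also have "\<dots> = A" using assms by (simp add: powr_powr)
  finally show ?thesis using s by (simp add: lq_fin_def lq_norm_def)
qed

lemma lq_partial:
  assumes "r \<ge> 1" "\<And>k. x k \<ge> 0" "lq_fin (ereal r) x"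
  shows "(\<Sum>k<n. x k powr r) \<le> lq_norm (ereal r) x powr r"
proof -
  have s: "summable (\<lambda>k. x k powr r)" using assms by (simp add: lq_fin_def)
  have "(\<Sum>k<n. x k powr r) \<le> (\<Sum>k. x k powr r)" by (rule sum_le_suminf[OF s]) auto
  also have "\<dots> = lq_norm (ereal r) x powr r"
    using assms by (simp add: lq_norm_def powr_powr suminf_nonneg[OF s])
  finally show ?thesis .
qed

lemma lq_coord:
  assumes "1 \<le> q" "\<And>k. x k \<ge> 0" "lq_fin q x"
  shows "x k \<le> lq_norm q x"
  using assms(1)
proof (cases rule: ereal_ge_1_cases)
  case 1
  then show ?thesis using assms by (auto simp: lq_fin_def lq_norm_def intro: cSUP_upper)
next
  case (2 r)
  have "x k powr r \<le> (\<Sum>k<Suc k. x k powr r)" by (rule member_le_sum) auto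
  also have "\<dots> \<le> lq_norm q x powr r" using lq_partial[of r x "Suc k"] assms 2 by simp
  finally have le: "x k powr r \<le> lq_norm q x powr r" .
  have "(x k powr r) powr (1/r) \<le> (lq_norm q x powr r) powr (1/r)"
    using 2 by (intro powr_mono2[OF _ _ le]) auto
  then show ?thesis using 2 assms(2)[of k] lq_norm_nonneg[OF assms(2,3)] by (simp add: powr_powr)
qed

text \<open>Single entries (q infinite) or finite partial sums (q finite) pass to the limit, and a
  bound on all of them bounds the norm. The completeness proof uses this to carry bounds from finite
  blocks of a series to its tails.\<close>

lemma lq_Fatou:
  assumes q: "1 \<le> q" and x: "\<And>n k. x n k \<ge> 0" and lim: "\<And>k. (\<lambda>n. x n k) \<longlonglongrightarrow> y k"
    and fin: "\<And>n. lq_fin q (x n)" and le: "\<And>n. lq_norm q (x n) \<le> A"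
  shows "lq_fin q y \<and> lq_norm q y \<le> A"
  using q
proof (cases rule: ereal_ge_1_cases)
  case 1
  have "y k \<le> A" for k
    by (rule LIMSEQ_le_const2[OF lim]) (use lq_coord[OF q x fin] le in \<open>blast intro: order_trans\<close>)
  then show ?thesis using lq_bound_infinity 1 by blast
next
  case (2 r)
  have A: "A \<ge> 0" using lq_norm_nonneg[OF x fin] le order_trans by blast
  have y: "y k \<ge> 0" for k by (rule LIMSEQ_le_const[OF lim]) (use x in auto)
  have "(\<Sum>k<m. y k powr r) \<le> A powr r" for m
  proof (rule LIMSEQ_le_const2)
    show "(\<lambda>n. \<Sum>k<m. x n k powr r) \<longlonglongrightarrow> (\<Sum>k<m. y k powr r)"
      using 2 x by (intro tendsto_sum tendsto_powr2 lim tendsto_const) auto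
    have "(\<Sum>k<m. x n k powr r) \<le> A powr r" for n
    proof -
      have "(\<Sum>k<m. x n k powr r) \<le> lq_norm q (x n) powr r" using lq_partial[of r "x n" m] 2 x fin by simp
      also have "\<dots> \<le> A powr r" using 2 le lq_norm_nonneg[OF x fin] by (intro powr_mono2) auto
      finally show ?thesis .
    qed
    then show "\<exists>N. \<forall>n\<ge>N. (\<Sum>k<m. x n k powr r) \<le> A powr r" by blast
  qed
  then show ?thesis using lq_bound_real[of r y A] 2 y A by simp
qed

text \<open>For finite q this is Minkowski's inequality over the counting measure on the
  naturals.\<close>

lemma lq_triangle:
  assumes q: "1 \<le> q" and x: "\<And>k. x k \<ge> 0" "lq_fin q x" and y: "\<And>k. y k \<ge> 0" "lq_fin q y"
  shows "lq_fin q (\<lambda>k. x k + y k) \<and> lq_norm q (\<lambda>k. x k + y k) \<le> lq_norm q x + lq_norm q y"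
  using q
proof (cases rule: ereal_ge_1_cases)
  case 1
  then show ?thesis
    using lq_coord[OF q x] lq_coord[OF q y] by (auto intro!: lq_bound_infinity add_mono)
next
  case (2 r)
  let ?C = "count_space (UNIV :: nat set)"
  have Lp: "(\<lambda>k. complex_of_real (x k)) \<in> Lp_space ?C r \<longleftrightarrow> lq_fin q x" if "\<And>k. x k \<ge> 0" for x
    using 2 that by (simp add: Lp_space_def lq_fin_def integrable_count_space_nat_iff)
  have norm: "Lp_norm ?C r (\<lambda>k. complex_of_real (x k)) = lq_norm q x" if "\<And>k. x k \<ge> 0" "lq_fin q x" for x
    using 2 that by (simp add: Lp_norm_def lq_norm_def lq_fin_def integral_count_space_nat integrable_count_space_nat_iff)
  have xy: "\<And>k. x k + y k \<ge> 0" using x y by simp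
  have "lq_fin q (\<lambda>k. x k + y k)"
    using Lp_space_add[of r "\<lambda>k. complex_of_real (x k)" ?C "\<lambda>k. complex_of_real (y k)"] 2 Lp[OF x(1)] Lp[OF y(1)] Lp[OF xy] x y by simp
  moreover have "lq_norm q (\<lambda>k. x k + y k) \<le> lq_norm q x + lq_norm q y"
    using Lp_norm_triangle[of r "\<lambda>k. complex_of_real (x k)" ?C "\<lambda>k. complex_of_real (y k)"]
      2 Lp[OF x(1)] Lp[OF y(1)] x y norm[OF x] norm[OF y] norm[OF xy calculation] by simp
  ultimately show ?thesis by blast
qed

text \<open>Schur's test: Jensen along each row uses the row sums, exchanging the summations uses
  the column sums. Hypothesis \<open>le\<close> asks for finite sums up to any error e, with a
  length depending on i and e; this suits applications in which \<open>y i\<close> comes from an L^p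
  limit, and no infinite matrix sum has to be formed.\<close>

lemma lq_schur:
  assumes q: "1 \<le> q" and w: "\<And>i k. w i k \<ge> 0" and A: "A \<ge> 0"
    and row: "\<And>i n. (\<Sum>k<n. w i k) \<le> A" and col: "\<And>k n. (\<Sum>i<n. w i k) \<le> A"
    and x: "\<And>k. x k \<ge> 0" "lq_fin q x" and y: "\<And>i. y i \<ge> 0"
    and le: "\<And>i e. e > 0 \<Longrightarrow> \<exists>n. y i \<le> (\<Sum>k<n. w i k * x k) + e"
  shows "lq_fin q y \<and> lq_norm q y \<le> A * lq_norm q x"
proof -
  let ?X = "lq_norm q x"
  have X: "?X \<ge> 0" using lq_norm_nonneg x by blast
  show ?thesis using q
  proof (cases rule: ereal_ge_1_cases)
    case 1
    have "y i \<le> A * ?X" for i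
    proof (rule field_le_epsilon)
      fix e :: real assume "e > 0"
      then obtain n where "y i \<le> (\<Sum>k<n. w i k * x k) + e" using le by blast
      also have "(\<Sum>k<n. w i k * x k) \<le> (\<Sum>k<n. w i k * ?X)"
        using lq_coord[OF q x] w by (intro sum_mono mult_left_mono) auto
      also have "\<dots> \<le> A * ?X" using row X by (simp flip: sum_distrib_right add: mult_right_mono)
      finally show "y i \<le> A * ?X + e" by simp
    qed
    then show ?thesis using lq_bound_infinity 1 by blast
  next
    case (2 r)
    have part: "(\<Sum>i<N. (\<Sum>k<n i. w i k * x k) powr r) \<le> (A * ?X) powr r" for N n
    proof -
      \<comment> \<open>A common length for the finitely many rows in play.\<close>
      define n' where "n' = Max (n ` {..<N} \<union> {0})"
      have n': "n i \<le> n'" if "i < N" for i unfolding n'_def using that by (intro Max_ge) auto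
      have "(\<Sum>i<N. (\<Sum>k<n i. w i k * x k) powr r) \<le> (\<Sum>i<N. (\<Sum>k<n'. w i k * x k) powr r)"
        using 2 w x n' by (intro sum_mono powr_mono2 sum_mono2 sum_nonneg) auto
      also have "\<dots> \<le> (\<Sum>i<N. A powr (r - 1) * (\<Sum>k<n'. w i k * x k powr r))"
      proof (rule sum_mono)
        fix i
        have "(\<Sum>k<n'. w i k * x k) powr r \<le> (\<Sum>k<n'. w i k) powr (r - 1) * (\<Sum>k<n'. w i k * x k powr r)"
          using 2 w x by (intro weighted_jensen_powr) auto
        also have "\<dots> \<le> A powr (r - 1) * (\<Sum>k<n'. w i k * x k powr r)"
          using 2 w x row by (intro mult_right_mono powr_mono2 sum_nonneg) auto
        finally show "(\<Sum>k<n'. w i k * x k) powr r \<le> A powr (r - 1) * (\<Sum>k<n'. w i k * x k powr r)" .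
      qed
      also have "\<dots> = A powr (r - 1) * (\<Sum>k<n'. (\<Sum>i<N. w i k) * x k powr r)"
        by (simp add: sum_distrib_left sum_distrib_right) (rule sum.swap)
      also have "\<dots> \<le> A powr (r - 1) * (\<Sum>k<n'. A * x k powr r)"
        using col by (intro mult_left_mono sum_mono mult_right_mono) auto
      also have "\<dots> = A powr r * (\<Sum>k<n'. x k powr r)"
        using A powr_mult_base[OF A, of "r - 1"] by (simp add: sum_distrib_left mult.assoc[symmetric] mult.commute)
      also have "\<dots> \<le> A powr r * ?X powr r"
        using lq_partial[of r x] x 2 by (intro mult_left_mono) auto
      also have "\<dots> = (A * ?X) powr r" using A X by (simp add: powr_mult)
      finally show ?thesis .
    qed
    have "(\<Sum>i<N. y i powr r) \<le> (A * ?X) powr r" for N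
    proof (rule LIMSEQ_le_const2)
      \<comment> \<open>The error 1 / (m+1) is subtracted and the result cut off at 0, so that r-th
        powers stay monotone; then m tends to infinity.\<close>
      show "(\<lambda>m. \<Sum>i<N. (max 0 (y i - 1 / real (Suc m))) powr r) \<longlonglongrightarrow> (\<Sum>i<N. y i powr r)"
      proof (intro tendsto_sum)
        fix i
        have "(\<lambda>m. max 0 (y i - 1 / real (Suc m)) powr r) \<longlonglongrightarrow> max 0 (y i - 0) powr r"
          using 2 by (intro tendsto_powr2 tendsto_max tendsto_diff tendsto_const LIMSEQ_Suc[OF lim_1_over_n]) auto
        then show "(\<lambda>m. max 0 (y i - 1 / real (Suc m)) powr r) \<longlonglongrightarrow> y i powr r" using y by (simp add: max_def)
      qed
      have "(\<Sum>i<N. (max 0 (y i - 1 / real (Suc m))) powr r) \<le> (A * ?X) powr r" for m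
      proof -
        obtain n where n: "\<And>i. y i \<le> (\<Sum>k<n i. w i k * x k) + 1 / real (Suc m)"
          using le[of "1 / real (Suc m)"] by (metis of_nat_0_less_iff zero_less_Suc zero_less_divide_1_iff)
        have "(\<Sum>i<N. (max 0 (y i - 1 / real (Suc m))) powr r) \<le> (\<Sum>i<N. (\<Sum>k<n i. w i k * x k) powr r)"
        proof (intro sum_mono powr_mono2)
          fix i
          have "(\<Sum>k<n i. w i k * x k) \<ge> 0" using w x by (intro sum_nonneg) auto
          then show "max 0 (y i - 1 / real (Suc m)) \<le> (\<Sum>k<n i. w i k * x k)" using n[of i] by linarith
        qed (use 2 in auto)
        then show ?thesis using part[where n = n and N = N] by linarith
      qed
      then show "\<exists>M. \<forall>m\<ge>M. (\<Sum>i<N. (max 0 (y i - 1 / real (Suc m))) powr r) \<le> (A * ?X) powr r" by blast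
    qed
    then show ?thesis using lq_bound_real[of r y "A * ?X"] 2 y A X by simp
  qed
qed

lemma lq_mono:
  assumes q: "1 \<le> q" and x: "\<And>k. x k \<ge> 0" "lq_fin q x" and y: "\<And>k. y k \<ge> 0" "\<And>k. y k \<le> a * x k" and a: "a \<ge> 0"
  shows "lq_fin q y \<and> lq_norm q y \<le> a * lq_norm q x"
proof (rule lq_schur[OF q _ a _ _ x y(1)])
  fix i k n :: nat and e :: real
  \<comment> \<open>Schur's test for the diagonal matrix with entry a.\<close>
  let ?w = "\<lambda>i k :: nat. if i = k then a else 0"
  show "?w i k \<ge> 0" "(\<Sum>k<n. ?w i k) \<le> a" "(\<Sum>i<n. ?w i k) \<le> a" using a by auto
  assume "e > 0"
  moreover have "(\<Sum>k<Suc i. ?w i k * x k) = a * x i"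
  proof -
    have "(\<Sum>k<Suc i. ?w i k * x k) = (\<Sum>k<Suc i. if i = k then a * x k else 0)"
      by (intro sum.cong) auto
    then show ?thesis by simp
  qed
  ultimately have "y i \<le> (\<Sum>k<Suc i. ?w i k * x k) + e"
    using y(2)[of i] by linarith
  then show "\<exists>n. y i \<le> (\<Sum>k<n. ?w i k * x k) + e" by blast
qed

lemma lq_cmult:
  assumes q: "1 \<le> q" and x: "\<And>k. x k \<ge> 0" "lq_fin q x" and a: "a \<ge> 0"
  shows "lq_fin q (\<lambda>k. a * x k) \<and> lq_norm q (\<lambda>k. a * x k) = a * lq_norm q x"
proof (cases "a = 0")
  case True
  have "lq_norm q (\<lambda>k. 0 * x k) \<ge> 0 \<and> lq_fin q (\<lambda>k. 0 * x k) \<and> lq_norm q (\<lambda>k. 0 * x k) \<le> 0 * lq_norm q x"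
    using lq_mono[OF q x, of "\<lambda>k. 0 * x k" 0] lq_norm_nonneg[of "\<lambda>k. 0 * x k" q] by simp
  then show ?thesis using True by simp
next
  case False
  have ax: "\<And>k. a * x k \<ge> 0" using a x by simp
  have 1: "lq_fin q (\<lambda>k. a * x k) \<and> lq_norm q (\<lambda>k. a * x k) \<le> a * lq_norm q x"
    by (rule lq_mono[OF q x ax order_refl a])
  have "lq_fin q x \<and> lq_norm q x \<le> (1 / a) * lq_norm q (\<lambda>k. a * x k)"
    by (rule lq_mono[OF q ax conjunct1[OF 1] x(1)]) (use False a in auto)
  then show ?thesis using 1 False a by (simp add: field_simps antisym)
qed

text \<open>On each side of c the distance to c is injective, so each side is dominated by one full
  geometric series. The bound depends neither on n nor on c, which may be negative.\<close>

lemma sum_geometric_abs_le: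
  fixes \<rho> :: real
  assumes "0 < \<rho>" "\<rho> < 1"
  shows "(\<Sum>k<n. \<rho> ^ nat \<bar>int k - c\<bar>) \<le> 2 / (1 - \<rho>)"
proof -
  have g: "(\<Sum>k\<in>S. \<rho> ^ k) \<le> 1 / (1 - \<rho>)" if "finite S" for S
    using assms that sum_le_suminf[of "\<lambda>j. \<rho> ^ j" S] by (simp add: suminf_geometric)
  have *: "(\<Sum>k\<in>S. \<rho> ^ nat \<bar>int k - c\<bar>) \<le> 1 / (1 - \<rho>)"
    if "finite S" "inj_on (\<lambda>k. nat \<bar>int k - c\<bar>) S" for S
    using g[of "(\<lambda>k. nat \<bar>int k - c\<bar>) ` S"] that by (simp add: sum.reindex)
  let ?P = "{k. k < n \<and> int k \<ge> c}" and ?N = "{k. k < n \<and> int k < c}"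
  have "(\<Sum>k<n. \<rho> ^ nat \<bar>int k - c\<bar>) = (\<Sum>k\<in>?P \<union> ?N. \<rho> ^ nat \<bar>int k - c\<bar>)"
    by (rule sum.cong) auto
  also have "\<dots> = (\<Sum>k\<in>?P. \<rho> ^ nat \<bar>int k - c\<bar>) + (\<Sum>k\<in>?N. \<rho> ^ nat \<bar>int k - c\<bar>)"
    by (rule sum.union_disjoint) auto
  also have "\<dots> \<le> 1 / (1 - \<rho>) + 1 / (1 - \<rho>)"
  proof (intro add_mono *)
    show "inj_on (\<lambda>k. nat \<bar>int k - c\<bar>) ?P" "inj_on (\<lambda>k. nat \<bar>int k - c\<bar>) ?N"
      unfolding inj_on_def by (clarify; linarith)+
  qed simp_all
  finally show ?thesis by simp
qed

section \<open>A Fredholm criterion\<close>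

text \<open>Linear subspaces of C^D are closed; the fourth assumption says that \<open>Y\<close>
  ignores coordinates outside D. In the induction step either some s in \<open>Y\<close> has s d =
  1, and subtracting multiples of s makes the coordinate d vanish, or all of \<open>Y\<close>
  vanishes at d and so does the limit.\<close>

lemma finite_dim_subspace_closed:
  fixes Y :: "('d \<Rightarrow> complex) \<Rightarrow> bool"
  assumes "finite D"
    and "\<And>a b. Y a \<Longrightarrow> Y b \<Longrightarrow> Y (\<lambda>j. a j + b j)"
    and "\<And>c a. Y a \<Longrightarrow> Y (\<lambda>j. c * a j)"
    and "\<And>a b. Y a \<Longrightarrow> (\<And>j. j \<in> D \<Longrightarrow> a j = b j) \<Longrightarrow> Y b"
    and "\<And>l::nat. Y (a l)" and "\<And>j. j \<in> D \<Longrightarrow> (\<lambda>l. a l j) \<longlonglongrightarrow> b j"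
  shows "Y b"
  using assms
proof (induction D arbitrary: Y a b rule: finite_induct)
  case empty
  then show ?case by blast
next
  case (insert d D Y a b)
  note add = insert.prems(1) and cm = insert.prems(2) and cong = insert.prems(3)
    and ya = insert.prems(4) and lim = insert.prems(5)
  \<comment> \<open>The slice of \<open>Y\<close> vanishing at d, regarded as a subspace over the
    smaller index set.\<close>
  define Y1 where "Y1 c = Y (c(d := 0))" for c
  have IH: "Y1 b'" if "\<And>l. Y1 (a' l)" "\<And>j. j \<in> D \<Longrightarrow> (\<lambda>l. a' l j) \<longlonglongrightarrow> b' j" for a' b'
  proof (rule insert.IH[where Y = Y1 and a = a' and b = b'])
    show "Y1 (\<lambda>j. u j + v j)" if "Y1 u" "Y1 v" for u v
      unfolding Y1_def by (rule cong[OF add[OF that[unfolded Y1_def]]]) auto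
    show "Y1 (\<lambda>j. c * u j)" if "Y1 u" for u c
      unfolding Y1_def by (rule cong[OF cm[OF that[unfolded Y1_def]]]) auto
    show "Y1 v" if "Y1 u" "\<And>j. j \<in> D \<Longrightarrow> u j = v j" for u v
      unfolding Y1_def by (rule cong[OF that(1)[unfolded Y1_def]]) (use that in auto)
  qed (use that in auto)
  show ?case
  proof (cases "\<exists>s. Y s \<and> s d \<noteq> 0")
    case True
    then obtain s0 where "Y s0" "s0 d \<noteq> 0" by blast
    define s where "s j = inverse (s0 d) * s0 j" for j
    have s: "Y s" "s d = 1" using \<open>Y s0\<close> \<open>s0 d \<noteq> 0\<close> cm[of s0 "inverse (s0 d)"] by (auto simp: s_def[abs_def])
    have "Y1 (\<lambda>j. b j + (- b d) * s j)"
    proof (rule IH)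
      fix l
      show "Y1 (\<lambda>j. a l j + (- a l d) * s j)" unfolding Y1_def
        by (rule cong[OF add[OF ya[of l] cm[OF s(1), of "- a l d"]]]) (use s in auto)
    next
      fix j assume "j \<in> D"
      then show "(\<lambda>l. a l j + (- a l d) * s j) \<longlonglongrightarrow> b j + (- b d) * s j"
        by (intro tendsto_intros lim) auto
    qed
    then have "Y ((\<lambda>j. b j + (- b d) * s j)(d := 0))" unfolding Y1_def .
    then show ?thesis by (rule cong[OF add[OF _ cm[OF s(1), of "b d"]]]) (use s in auto)
  next
    case False
    then have "a l d = 0" for l using ya by blast
    then have "b d = 0" using lim[of d] by (simp add: LIMSEQ_const_iff)
    have "Y1 b"
    proof (rule IH[of a])
      show "Y1 (a l)" for l unfolding Y1_def
        by (rule cong[OF ya]) (use \<open>\<And>l. a l d = 0\<close> in auto)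
    qed (use lim in auto)
    then show ?thesis unfolding Y1_def by (rule cong) (use \<open>b d = 0\<close> in auto)
  qed
qed

text \<open>Completeness is asked only for series with geometrically decreasing norms, the form in
  which Neumann series need it. Vectors are functions, so \<open>N\<close> is a seminorm whose null
  vectors are the functions vanishing almost everywhere.\<close>

locale complete_function_space =
  fixes M :: "'a measure" and V :: "('a \<Rightarrow> complex) set" and N :: "('a \<Rightarrow> complex) \<Rightarrow> real"
  assumes V_zero: "(\<lambda>x. 0) \<in> V"
    and V_add: "\<And>u v. u \<in> V \<Longrightarrow> v \<in> V \<Longrightarrow> (\<lambda>x. u x + v x) \<in> V"
    and V_cmult: "\<And>a v. v \<in> V \<Longrightarrow> (\<lambda>x. a * v x) \<in> V"
    and N_nonneg: "\<And>v. v \<in> V \<Longrightarrow> N v \<ge> 0"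
    and N_add: "\<And>u v. u \<in> V \<Longrightarrow> v \<in> V \<Longrightarrow> N (\<lambda>x. u x + v x) \<le> N u + N v"
    and N_cmult: "\<And>a v. v \<in> V \<Longrightarrow> N (\<lambda>x. a * v x) = cmod a * N v"
    and N_eq_0_iff: "\<And>v. v \<in> V \<Longrightarrow> N v = 0 \<longleftrightarrow> (AE x in M. v x = 0)"
    and N_complete: "\<And>u C \<rho>. \<lbrakk>\<And>j. u j \<in> V; \<And>j::nat. N (u j) \<le> C * \<rho> ^ j; 0 < \<rho>; \<rho> < 1\<rbrakk> \<Longrightarrow>
      \<exists>v\<in>V. (\<lambda>n. N (\<lambda>x. v x - (\<Sum>j<n. u j x))) \<longlonglongrightarrow> 0"
begin

lemma V_diff: "u \<in> V \<Longrightarrow> v \<in> V \<Longrightarrow> (\<lambda>x. u x - v x) \<in> V"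
  using V_add[OF _ V_cmult[of v "-1"], of u] by simp

lemma N_diff: "u \<in> V \<Longrightarrow> v \<in> V \<Longrightarrow> N (\<lambda>x. u x - v x) \<le> N u + N v"
  using N_add[OF _ V_cmult[of v "-1"], of u] N_cmult[of v "-1"] by simp

lemma V_sum: "(\<And>i. i \<in> S \<Longrightarrow> u i \<in> V) \<Longrightarrow> (\<lambda>x. \<Sum>i\<in>S. u i x) \<in> V"
  by (induction S rule: infinite_finite_induct) (auto intro!: V_add V_zero)

lemma N_le_AE:
  assumes "u \<in> V" "v \<in> V" "AE x in M. u x = v x"
  shows "N u \<le> N v"
proof -
  have "N (\<lambda>x. u x - v x) = 0"
    by (subst N_eq_0_iff) (use assms V_diff in auto)
  moreover have "N (\<lambda>x. (u x - v x) + v x) \<le> N (\<lambda>x. u x - v x) + N v"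
    by (intro N_add V_diff assms)
  ultimately show ?thesis by simp
qed

lemma N_cong_AE:
  assumes "u \<in> V" "v \<in> V" "AE x in M. u x = v x"
  shows "N u = N v"
proof (rule antisym)
  show "N u \<le> N v" by (rule N_le_AE[OF assms])
  have "AE x in M. v x = u x" using assms(3) by eventually_elim simp
  then show "N v \<le> N u" by (intro N_le_AE assms)
qed

text \<open>Take norms in c v = R v + w. With w = 0 it gives injectivity of c - R, in general the
  continuity of its inverse.\<close>

lemma resolvent_bound:
  assumes R: "\<And>v. v \<in> V \<Longrightarrow> R v \<in> V" "\<And>v. v \<in> V \<Longrightarrow> N (R v) \<le> \<rho> * N v" and \<rho>: "\<rho> < cmod c"
    and v: "v \<in> V" and w: "w \<in> V" and eq: "AE x in M. c * v x - R v x = w x"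
  shows "N v \<le> N w / (cmod c - \<rho>)"
proof -
  have "cmod c * N v = N (\<lambda>x. c * v x)" by (simp add: N_cmult v)
  also have "\<dots> = N (\<lambda>x. R v x + w x)"
    by (intro N_cong_AE V_add V_cmult R v w) (use eq in \<open>eventually_elim, auto simp: algebra_simps\<close>)
  also have "\<dots> \<le> \<rho> * N v + N w"
    using N_add[OF R(1)[OF v] w] R(2)[OF v] by linarith
  finally have "N v * (cmod c - \<rho>) \<le> N w" by (simp add: algebra_simps)
  then show ?thesis using \<rho> by (simp add: pos_le_divide_eq)
qed

lemma resolvent_solve:
  assumes RV: "\<And>v. v \<in> V \<Longrightarrow> R v \<in> V"
    and Radd: "\<And>u v. u \<in> V \<Longrightarrow> v \<in> V \<Longrightarrow> R (\<lambda>x. u x + v x) = (\<lambda>x. R u x + R v x)"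
    and Rcm: "\<And>a v. v \<in> V \<Longrightarrow> R (\<lambda>x. a * v x) = (\<lambda>x. a * R v x)"
    and RN: "\<And>v. v \<in> V \<Longrightarrow> N (R v) \<le> \<rho> * N v" and \<rho>: "0 \<le> \<rho>" "\<rho> < cmod c"
    and w: "w \<in> V"
  shows "\<exists>v\<in>V. AE x in M. c * v x - R v x = w x"
proof -
  have c: "c \<noteq> 0" "cmod c > 0" using \<rho> by auto
  \<comment> \<open>The terms c^(-j-1) R^j w of the Neumann series.\<close>
  define u where "u j = ((\<lambda>v x. inverse c * R v x) ^^ j) (\<lambda>x. inverse c * w x)" for j :: nat
  have u0: "u 0 = (\<lambda>x. inverse c * w x)" and uS: "u (Suc j) = (\<lambda>x. inverse c * R (u j) x)" for j
    by (simp_all add: u_def)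
  have uV: "u j \<in> V" for j by (induction j) (auto simp: u0 uS intro!: V_cmult RV w)
  \<comment> \<open>The midpoint of \<rho> / |c| and 1: still below 1, and positive even for \<rho>
    = 0, as \<open>N_complete\<close> requires.\<close>
  define r where "r = (1 + \<rho> / cmod c) / 2"
  have r: "0 < r" "r < 1" "\<rho> / cmod c \<le> r" using \<rho> c by (auto simp: r_def field_simps)
  have uN: "N (u j) \<le> N (u 0) * r ^ j" for j
  proof (induction j)
    case (Suc j)
    have "N (u (Suc j)) = N (R (u j)) / cmod c"
      by (simp add: uS N_cmult RV uV norm_inverse divide_inverse mult.commute)
    also have "\<dots> \<le> \<rho> * N (u j) / cmod c" using RN[OF uV] c by (simp add: divide_right_mono)
    also have "\<dots> = (\<rho> / cmod c) * N (u j)" by simp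
    also have "\<dots> \<le> r * (N (u 0) * r ^ j)"
      using r Suc N_nonneg[OF uV] by (intro mult_mono) auto
    finally show ?case by (simp add: algebra_simps)
  qed auto
  obtain v where v: "v \<in> V" and lim: "(\<lambda>n. N (\<lambda>x. v x - (\<Sum>j<n. u j x))) \<longlonglongrightarrow> 0"
    using N_complete[OF uV uN r(1,2)] by blast
  define S where "S n = (\<lambda>x. \<Sum>j<n. u j x)" for n
  have SV: "S n \<in> V" for n unfolding S_def by (intro V_sum uV)
  have tel: "c * S n x - R (S n) x = w x - c * u n x" for n x
  proof (induction n)
    case 0
    have "R (\<lambda>x. 0 * w x) = (\<lambda>x. 0 * R w x)" by (rule Rcm[OF w])
    then show ?case using c by (simp add: S_def u0)
  next
    case (Suc n)
    have "S (Suc n) = (\<lambda>x. S n x + u n x)" by (simp add: S_def)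
    then have "R (S (Suc n)) x = R (S n) x + R (u n) x" by (simp add: Radd SV uV)
    moreover have "R (u n) x = c * u (Suc n) x" using c by (simp add: uS)
    ultimately show ?case using Suc by (simp add: S_def algebra_simps)
  qed
  \<comment> \<open>The defect of the candidate solution. By \<open>tel\<close> it consists of
    images of v - S n and of the single term c u n, both of which tend to 0 in norm.\<close>
  define d where "d = (\<lambda>x. (c * v x - R v x) - w x)"
  have dV: "d \<in> V" unfolding d_def by (intro V_diff V_cmult RV v w)
  have dle: "N d \<le> (cmod c + \<rho>) * N (\<lambda>x. v x - S n x) + cmod c * (N (u 0) * r ^ n)" for n
  proof -
    have e: "(\<lambda>x. v x - S n x) \<in> V" by (intro V_diff v SV)
    have "R v = (\<lambda>x. R (\<lambda>x. v x - S n x) x + R (S n) x)"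
      using Radd[OF e SV[of n]] by simp
    then have "R v x = R (\<lambda>x. v x - S n x) x + R (S n) x" for x by metis
    then have deq: "d = (\<lambda>x. (c * (v x - S n x) - R (\<lambda>x. v x - S n x) x) - c * u n x)"
      using tel[of n] by (auto simp: d_def fun_eq_iff algebra_simps)
    have "N d \<le> N (\<lambda>x. c * (v x - S n x) - R (\<lambda>x. v x - S n x) x) + N (\<lambda>x. c * u n x)" unfolding deq
      by (intro N_diff V_diff V_cmult RV e uV v SV)
    also have "\<dots> \<le> (N (\<lambda>x. c * (v x - S n x)) + N (R (\<lambda>x. v x - S n x))) + N (\<lambda>x. c * u n x)"
      using N_diff[OF V_cmult[OF e, of c] RV[OF e]] by simp
    also have "\<dots> \<le> (cmod c * N (\<lambda>x. v x - S n x) + \<rho> * N (\<lambda>x. v x - S n x)) + cmod c * (N (u 0) * r ^ n)"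
      using RN[OF e] uN[of n] N_cmult[OF e, of c] N_cmult[OF uV, of c n] by (intro add_mono) (auto intro: mult_left_mono)
    finally show ?thesis by (simp add: algebra_simps)
  qed
  have "(\<lambda>n. (cmod c + \<rho>) * N (\<lambda>x. v x - S n x) + cmod c * (N (u 0) * r ^ n)) \<longlonglongrightarrow> (cmod c + \<rho>) * 0 + cmod c * (N (u 0) * 0)"
    using r by (intro tendsto_intros lim[folded S_def[abs_def]] LIMSEQ_realpow_zero lim[unfolded S_def[symmetric]]) (auto simp: S_def lim)
  then have "N d \<le> (cmod c + \<rho>) * 0 + cmod c * (N (u 0) * 0)"
    by (rule LIMSEQ_le_const) (use dle in auto)
  then have "N d = 0" using N_nonneg[OF dV] by simp
  then have "AE x in M. d x = 0" using N_eq_0_iff[OF dV] by simp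
  then have "AE x in M. c * v x - R v x = w x" by eventually_elim (simp add: d_def)
  then show ?thesis using v by blast
qed

text \<open>With \<open>R = T\<^sup>n(1 - E)\<close>, where \<open>E\<close> has finite rank, one has
  \<open>z\<^sup>n - T\<^sup>n = (z\<^sup>n - R) - T\<^sup>n E\<close> with \<open>z\<^sup>n - R\<close> invertible, and \<open>z - T\<close> divides \<open>z\<^sup>n - T\<^sup>n\<close>.\<close>

lemma fredholm_on_if_iterate_contracts:
  fixes T :: "('a \<Rightarrow> complex) \<Rightarrow> 'a \<Rightarrow> complex" and e :: "'d \<Rightarrow> ('a \<Rightarrow> complex) \<Rightarrow> complex"
  assumes TV: "\<And>v. v \<in> V \<Longrightarrow> T v \<in> V"
    and Tadd: "\<And>u v. T (\<lambda>x. u x + v x) = (\<lambda>x. T u x + T v x)"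
    and Tcm: "\<And>a v. T (\<lambda>x. a * v x) = (\<lambda>x. a * T v x)"
    and TN: "\<And>v. v \<in> V \<Longrightarrow> N (T v) \<le> C * N v"
    and D: "finite D" and \<phi>: "\<And>j. j \<in> D \<Longrightarrow> \<phi> j \<in> V"
    and eadd: "\<And>j u v. u \<in> V \<Longrightarrow> v \<in> V \<Longrightarrow> e j (\<lambda>x. u x + v x) = e j u + e j v"
    and ecm: "\<And>j a v. v \<in> V \<Longrightarrow> e j (\<lambda>x. a * v x) = a * e j v"
    and ebd: "\<And>j v. v \<in> V \<Longrightarrow> cmod (e j v) \<le> K * N v"
    and contr: "\<And>v. v \<in> V \<Longrightarrow> N ((T ^^ n) (\<lambda>x. v x - (\<Sum>j\<in>D. e j v * \<phi> j x))) \<le> \<rho> * N v"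
    and \<rho>: "0 \<le> \<rho>" "\<rho> < cmod z ^ n"
    and nrm: "\<And>v. v \<in> V \<Longrightarrow> N v \<le> c * nrm v" and c: "c \<ge> 0"
  shows "fredholm_on M V nrm (\<lambda>v x. z * v x - T v x)"
proof -
  have TnV: "(T ^^ k) v \<in> V" if "v \<in> V" for k v using that by (induction k) (auto intro: TV)
  have Tnadd: "(T ^^ k) (\<lambda>x. u x + v x) = (\<lambda>x. (T ^^ k) u x + (T ^^ k) v x)" for k u v
    by (induction k) (auto simp: Tadd)
  have Tncm: "(T ^^ k) (\<lambda>x. a * v x) = (\<lambda>x. a * (T ^^ k) v x)" for k a v
    by (induction k) (auto simp: Tcm)
  have Tn0: "(T ^^ k) (\<lambda>x. 0) = (\<lambda>x. 0)" for k
    using Tncm[of k 0 "\<lambda>x. 0"] by simp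
  have Tnsum: "(T ^^ k) (\<lambda>x. \<Sum>j\<in>S. a j * f j x) = (\<lambda>x. \<Sum>j\<in>S. a j * (T ^^ k) (f j) x)"
    if "finite S" for S k and a :: "'d \<Rightarrow> complex" and f
    using that by induction (auto simp: Tnadd Tncm Tn0)
  define E where "E v = (\<lambda>x. \<Sum>j\<in>D. e j v * \<phi> j x)" for v
  define R where "R v = (T ^^ n) (\<lambda>x. v x - E v x)" for v
  define \<psi> where "\<psi> j = (T ^^ n) (\<phi> j)" for j
  have EV: "E v \<in> V" for v unfolding E_def by (intro V_sum V_cmult \<phi>)
  have \<psi>V: "\<psi> j \<in> V" if "j \<in> D" for j unfolding \<psi>_def using that by (intro TnV \<phi>)
  have RV: "R v \<in> V" if "v \<in> V" for v unfolding R_def using that by (intro TnV V_diff EV)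
  have Radd: "R (\<lambda>x. u x + v x) = (\<lambda>x. R u x + R v x)" if "u \<in> V" "v \<in> V" for u v
  proof -
    have "(\<lambda>x. (u x + v x) - E (\<lambda>x. u x + v x) x) = (\<lambda>x. (u x - E u x) + (v x - E v x))"
      using that by (simp add: E_def eadd fun_eq_iff algebra_simps sum.distrib)
    then show ?thesis by (simp add: R_def Tnadd)
  qed
  have Rcm: "R (\<lambda>x. a * v x) = (\<lambda>x. a * R v x)" if "v \<in> V" for a v
  proof -
    have "(\<lambda>x. a * v x - E (\<lambda>x. a * v x) x) = (\<lambda>x. a * (v x - E v x))"
      using that by (simp add: E_def ecm fun_eq_iff algebra_simps sum_distrib_left)
    then show ?thesis by (simp add: R_def Tncm)
  qed
  have RN: "N (R v) \<le> \<rho> * N v" if "v \<in> V" for v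
    using contr[OF that] by (simp add: R_def E_def)
  have \<rho>': "\<rho> < cmod (z ^ n)" using \<rho> by (simp add: norm_power)
  note solve = resolvent_solve[OF RV Radd Rcm RN \<rho>(1) \<rho>']
  have bound: "N v \<le> N w / (cmod (z ^ n) - \<rho>)"
    if "v \<in> V" "w \<in> V" "AE x in M. z ^ n * v x - R v x = w x" for v w
    by (rule resolvent_bound[where R = R, OF _ _ \<rho>' that]) (auto intro: RV RN)
  have split: "(T ^^ n) v x = R v x + (\<Sum>j\<in>D. e j v * \<psi> j x)" for v x
  proof -
    have "(T ^^ n) v = (T ^^ n) (\<lambda>x. (v x - E v x) + E v x)" by simp
    also have "\<dots> = (\<lambda>x. R v x + (T ^^ n) (E v) x)" unfolding R_def by (rule Tnadd)
    also have "(T ^^ n) (E v) = (\<lambda>x. \<Sum>j\<in>D. e j v * \<psi> j x)" unfolding E_def \<psi>_def by (rule Tnsum[OF D])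
    finally show ?thesis by metis
  qed
  \<comment> \<open>The range of z - T modulo almost everywhere equality; it is closed under linear
    combinations.\<close>
  define Ran where "Ran w \<longleftrightarrow> (\<exists>u\<in>V. AE x in M. w x = z * u x - T u x)" for w
  have Ran_cong: "Ran w'" if r: "Ran w" and ae: "AE x in M. w' x = w x" for w w'
  proof -
    obtain u where u: "u \<in> V" "AE x in M. w x = z * u x - T u x" using r unfolding Ran_def by blast
    have "AE x in M. w' x = z * u x - T u x" using u(2) ae by eventually_elim simp
    then show ?thesis using u by (auto simp: Ran_def)
  qed
  have Ran_add: "Ran (\<lambda>x. w x + w' x)" if r: "Ran w" "Ran w'" for w w'
  proof -
    obtain u u' where u: "u \<in> V" "AE x in M. w x = z * u x - T u x" "u' \<in> V" "AE x in M. w' x = z * u' x - T u' x"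
      using r unfolding Ran_def by blast
    have "AE x in M. w x + w' x = z * (u x + u' x) - T (\<lambda>x. u x + u' x) x"
      using u(2,4) by eventually_elim (simp add: Tadd algebra_simps)
    then show ?thesis unfolding Ran_def by (intro bexI[OF _ V_add[OF u(1,3)]])
  qed
  have Ran_cm: "Ran (\<lambda>x. a * w x)" if r: "Ran w" for a w
  proof -
    obtain u where u: "u \<in> V" "AE x in M. w x = z * u x - T u x" using r unfolding Ran_def by blast
    have "AE x in M. a * w x = z * (a * u x) - T (\<lambda>x. a * u x) x"
      using u(2) by eventually_elim (simp add: Tcm right_diff_distrib mult.left_commute)
    then show ?thesis unfolding Ran_def by (intro bexI[OF _ V_cmult[OF u(1)]])
  qed
  have Ran_diff: "Ran (\<lambda>x. w x - w' x)" if "Ran w" "Ran w'" for w w'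
    using Ran_add[OF that(1) Ran_cm[OF that(2), of "-1"]] by simp
  have Ran_S: "Ran (\<lambda>x. z * v x - T v x)" if "v \<in> V" for v using that by (auto simp: Ran_def)
  \<comment> \<open>Divisibility of z^k - T^k by z - T: if u is the quotient applied to v for k,
    then z^k v + T u is the one for k + 1.\<close>
  have Ran_pow: "\<exists>u\<in>V. \<forall>x. z ^ k * v x - (T ^^ k) v x = z * u x - T u x" if "v \<in> V" for v k
  proof (induction k)
    case 0
    then show ?case using V_zero Tn0[of 1] by (intro bexI[of _ "\<lambda>x. 0"]) auto
  next
    case (Suc k)
    then obtain u where u: "u \<in> V" "\<And>x. z ^ k * v x - (T ^^ k) v x = z * u x - T u x" by blast
    have "T (\<lambda>x. z ^ k * v x + (-1) * (T ^^ k) v x) = T (\<lambda>x. z * u x + (-1) * T u x)"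
      using u(2) by simp
    then have eq: "z ^ k * T v x - T ((T ^^ k) v) x = z * T u x - T (T u) x" for x
      unfolding Tadd Tcm by (simp add: fun_eq_iff)
    have "\<forall>x. z ^ Suc k * v x - (T ^^ Suc k) v x = z * (z ^ k * v x + T u x) - T (\<lambda>x. z ^ k * v x + T u x) x"
      unfolding Tadd Tcm using eq by (simp add: algebra_simps)
    then show ?case by (rule bexI[where x = "\<lambda>x. z ^ k * v x + T u x"]) (intro V_add V_cmult TV that u)
  qed
  \<comment> \<open>Solving (z^n - R) v = w puts w into the range of z - T modulo the span of the
    \<open>\<psi> j\<close>.\<close>
  have key: "Ran (\<lambda>x. w x - (\<Sum>j\<in>D. e j v * \<psi> j x))" if r: "v \<in> V" and ae: "AE x in M. z ^ n * v x - R v x = w x" for v w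
  proof -
    obtain u where "u \<in> V" "\<And>x. z ^ n * v x - (T ^^ n) v x = z * u x - T u x" using Ran_pow[OF r] by blast
    then have "Ran (\<lambda>x. z ^ n * v x - (T ^^ n) v x)" by (auto simp: Ran_def)
    then show ?thesis
      by (rule Ran_cong) (use ae in \<open>eventually_elim, simp add: split algebra_simps\<close>)
  qed
  show ?thesis unfolding fredholm_on_def
  proof (intro conjI)
    \<comment> \<open>If T v = z v, then (z^n - R) v is the sum of the e j v times
      \<open>\<psi> j\<close>. With g j = (z^n - R)^(-1) \<open>\<psi> j\<close>, the vector v is
      therefore the sum of the e j v times g j, and the kernel lies in the span of the g j.\<close>
    have "\<forall>j\<in>D. \<exists>g\<in>V. AE x in M. z ^ n * g x - R g x = \<psi> j x" using solve \<psi>V by blast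
    then obtain g where g: "\<And>j. j \<in> D \<Longrightarrow> g j \<in> V" "\<And>j. j \<in> D \<Longrightarrow> AE x in M. z ^ n * g j x - R (g j) x = \<psi> j x"
      by metis
    have "\<exists>a. AE x in M. v x = (\<Sum>h\<in>g ` D. a h * h x)" if v: "v \<in> V" and ker: "AE x in M. z * v x - T v x = 0" for v
    proof -
      have ker_n: "AE x in M. (T ^^ k) v x = z ^ k * v x" for k
      proof (induction k)
        case (Suc k)
        \<comment> \<open>That T respects almost everywhere equality is drawn from
          \<open>TN\<close>: a null function has norm 0, and hence so has its image.\<close>
        have "N (\<lambda>x. (T ^^ k) v x - z ^ k * v x) = 0"
          using Suc by (subst N_eq_0_iff) (auto intro!: V_diff TnV V_cmult v)
        then have "N (T (\<lambda>x. (T ^^ k) v x - z ^ k * v x)) \<le> 0"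
          using TN[of "\<lambda>x. (T ^^ k) v x - z ^ k * v x"] by (simp add: V_diff TnV V_cmult v)
        moreover have V: "T (\<lambda>x. (T ^^ k) v x - z ^ k * v x) \<in> V" by (intro TV V_diff TnV V_cmult v)
        ultimately have "N (T (\<lambda>x. (T ^^ k) v x - z ^ k * v x)) = 0" using N_nonneg[OF V] by simp
        then have "AE x in M. T (\<lambda>x. (T ^^ k) v x - z ^ k * v x) x = 0"
          using N_eq_0_iff[OF V] by simp
        moreover have "T (\<lambda>x. (T ^^ k) v x - z ^ k * v x) = (\<lambda>x. T ((T ^^ k) v) x - z ^ k * T v x)"
          using Tadd[of "(T ^^ k) v" "\<lambda>x. - (z ^ k) * v x"] Tcm[of "- (z ^ k)" v] by simp
        ultimately have "AE x in M. T ((T ^^ k) v) x - z ^ k * T v x = 0" by simp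
        then show ?case using ker
          by eventually_elim (simp add: algebra_simps)
      qed auto
      define v' where "v' = (\<lambda>x. v x - (\<Sum>j\<in>D. e j v * g j x))"
      have sV: "(\<lambda>x. \<Sum>j\<in>D. e j v * g j x) \<in> V" using g by (intro V_sum V_cmult) auto
      have v'V: "v' \<in> V" unfolding v'_def by (intro V_diff v sV)
      have Rsum: "R (\<lambda>x. \<Sum>j\<in>S. e j v * g j x) = (\<lambda>x. \<Sum>j\<in>S. e j v * R (g j) x)" if "S \<subseteq> D" for S
      proof -
        have "finite S" using D that finite_subset by blast
        then show ?thesis using that
        proof induction
          case empty
          show ?case using Rcm[OF V_zero, of 0] by simp
        next
          case (insert j S)
          then show ?case using g by (simp add: Radd Rcm V_cmult V_sum subset_eq)
        qed
      qed
      have Rdiff: "R (\<lambda>x. v x - s x) = (\<lambda>x. R v x - R s x)" if s: "s \<in> V" for s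
        using Radd[OF v V_cmult[OF s, of "-1"]] Rcm[OF s, of "-1"] by simp
      have Rv': "R v' x = R v x - (\<Sum>j\<in>D. e j v * R (g j) x)" for x
        unfolding v'_def Rdiff[OF sV] Rsum[OF order_refl] ..
      have "AE x in M. \<forall>j\<in>D. z ^ n * g j x - R (g j) x = \<psi> j x"
        using g(2) D by (intro AE_finite_allI) auto
      then have "AE x in M. z ^ n * v' x - R v' x = 0"
        using ker_n[of n]
      proof eventually_elim
        case (elim x)
        have "z ^ n * v' x - R v' x = (z ^ n * v x - R v x) - (\<Sum>j\<in>D. e j v * (z ^ n * g j x - R (g j) x))"
          unfolding Rv' unfolding v'_def by (simp add: algebra_simps sum_subtractf sum_distrib_left)
        also have "\<dots> = 0" using elim split[of v x] by (simp add: diff_eq_eq add.commute)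
        finally show ?case .
      qed
      then have "N v' \<le> N (\<lambda>x. 0) / (cmod (z ^ n) - \<rho>)" by (intro bound v'V V_zero)
      also have "N (\<lambda>x. 0) = 0" using N_eq_0_iff[OF V_zero] by simp
      finally have "N v' = 0" using N_nonneg[OF v'V] by simp
      then have "AE x in M. v' x = 0" using N_eq_0_iff[OF v'V] by simp
      \<comment> \<open>Different indices may share the same g j, so the coefficients are collected
        over each value.\<close>
      moreover have "(\<Sum>j\<in>D. e j v * g j x) = (\<Sum>h\<in>g ` D. (\<Sum>j\<in>{j\<in>D. g j = h}. e j v) * h x)" for x
        using sum.image_gen[OF D, of "\<lambda>j. e j v * g j x" g] by (simp add: sum_distrib_right)
      ultimately have "AE x in M. v x = (\<Sum>h\<in>g ` D. (\<Sum>j\<in>{j\<in>D. g j = h}. e j v) * h x)"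
        by (auto simp: v'_def)
      then show ?thesis by (rule exI[where x = "\<lambda>h. \<Sum>j\<in>{j\<in>D. g j = h}. e j v"])
    qed
    then show "\<exists>F. finite F \<and> F \<subseteq> V \<and> (\<forall>v\<in>V. (AE x in M. z * v x - T v x = 0) \<longrightarrow>
        (\<exists>a. AE x in M. v x = (\<Sum>g\<in>F. a g * g x)))"
      using D g by (intro exI[of _ "g ` D"]) auto
  next
    have "\<exists>v\<in>V. \<exists>a. AE x in M. w x = z * v x - T v x + (\<Sum>h\<in>\<psi> ` D. a h * h x)" if w: "w \<in> V" for w
    proof -
      obtain v where v: "v \<in> V" "AE x in M. z ^ n * v x - R v x = w x" using solve w by blast
      obtain u where u: "u \<in> V" "AE x in M. w x - (\<Sum>j\<in>D. e j v * \<psi> j x) = z * u x - T u x"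
        using key[OF v] by (auto simp: Ran_def)
      have "(\<Sum>j\<in>D. e j v * \<psi> j x) = (\<Sum>h\<in>\<psi> ` D. (\<Sum>j\<in>{j\<in>D. \<psi> j = h}. e j v) * h x)" for x
        using sum.image_gen[OF D, of "\<lambda>j. e j v * \<psi> j x" \<psi>] by (simp only: sum_distrib_right) simp
      then have "AE x in M. w x = z * u x - T u x + (\<Sum>h\<in>\<psi> ` D. (\<Sum>j\<in>{j\<in>D. \<psi> j = h}. e j v) * h x)"
        using u(2) by (auto simp: diff_eq_eq)
      then show ?thesis
        by (intro bexI[of _ u] exI[where x = "\<lambda>h. \<Sum>j\<in>{j\<in>D. \<psi> j = h}. e j v"] u)
    qed
    then show "\<exists>F. finite F \<and> F \<subseteq> V \<and> (\<forall>w\<in>V. \<exists>v\<in>V. \<exists>a. AE x in M. w x = z * v x - T v x + (\<Sum>g\<in>F. a g * g x))"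
      using D \<psi>V by (intro exI[of _ "\<psi> ` D"]) auto
  next
    show "\<forall>w\<in>V. (\<forall>e>0. \<exists>v\<in>V. nrm (\<lambda>x. w x - (z * v x - T v x)) < e) \<longrightarrow> (\<exists>v\<in>V. AE x in M. w x = z * v x - T v x)"
    proof (intro ballI impI)
      fix w assume w: "w \<in> V" and cl: "\<forall>e>0. \<exists>v\<in>V. nrm (\<lambda>x. w x - (z * v x - T v x)) < e"
      have "\<forall>l. \<exists>v\<in>V. nrm (\<lambda>x. w x - (z * v x - T v x)) < 1 / real (Suc l)"
        using cl by (metis of_nat_0_less_iff zero_less_Suc zero_less_divide_1_iff)
      then obtain y where y: "\<And>l. y l \<in> V" "\<And>l. nrm (\<lambda>x. w x - (z * y l x - T (y l) x)) < 1 / real (Suc l)"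
        by metis
      define \<delta> where "\<delta> l = (\<lambda>x. w x - (z * y l x - T (y l) x))" for l
      have \<delta>V: "\<delta> l \<in> V" for l unfolding \<delta>_def by (intro V_diff V_cmult TV w y)
      have \<delta>N: "N (\<delta> l) \<le> c * (1 / real (Suc l))" for l
        using nrm[OF \<delta>V[of l]] mult_left_mono[OF less_imp_le[OF y(2)[of l]] c] by (simp add: \<delta>_def)
      have "\<forall>l. \<exists>v\<in>V. AE x in M. z ^ n * v x - R v x = \<delta> l x" using solve \<delta>V by blast
      then obtain d where d: "\<And>l. d l \<in> V" "\<And>l. AE x in M. z ^ n * d l x - R (d l) x = \<delta> l x" by metis
      obtain v0 where v0: "v0 \<in> V" "AE x in M. z ^ n * v0 x - R v0 x = w x" using solve w by blast
      \<comment> \<open>Closed range: if w is a limit of (z - T) y l, the remainders \<delta> l and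
        their preimages d l under z^n - R tend to 0. By \<open>key\<close>, w is in the range as
        soon as the coefficient vector of v0 lies in the subspace \<open>Y\<close>. The vectors e j
        v0 - e j (d l) lie in \<open>Y\<close> and converge to it.\<close>
      define Y where "Y a = Ran (\<lambda>x. \<Sum>j\<in>D. a j * \<psi> j x)" for a
      have "Y (\<lambda>j. e j v0)"
      proof (rule finite_dim_subspace_closed[OF D, where Y = Y and a = "\<lambda>l j. e j v0 - e j (d l)"])
        show "Y (\<lambda>j. a j + b j)" if "Y a" "Y b" for a b
          using Ran_add[OF that[unfolded Y_def]] by (simp add: Y_def algebra_simps sum.distrib)
        show "Y (\<lambda>j. k * a j)" if "Y a" for k a
          using Ran_cm[OF that[unfolded Y_def], of k] by (simp add: Y_def sum_distrib_left mult.assoc)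
        show "Y b" if "Y a" "\<And>j. j \<in> D \<Longrightarrow> a j = b j" for a b
          using that by (simp add: Y_def)
        show "Y (\<lambda>j. e j v0 - e j (d l))" for l
        proof -
          have "Ran (\<lambda>x. (\<delta> l x - (\<Sum>j\<in>D. e j (d l) * \<psi> j x)) - (w x - (\<Sum>j\<in>D. e j v0 * \<psi> j x)))"
            by (intro Ran_diff key d v0)
          then have "Ran (\<lambda>x. ((\<delta> l x - (\<Sum>j\<in>D. e j (d l) * \<psi> j x)) - (w x - (\<Sum>j\<in>D. e j v0 * \<psi> j x)))
              + (z * y l x - T (y l) x))"
            by (intro Ran_add Ran_S y)
          moreover have "(((\<delta> l x - (\<Sum>j\<in>D. e j (d l) * \<psi> j x)) - (w x - (\<Sum>j\<in>D. e j v0 * \<psi> j x)))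
              + (z * y l x - T (y l) x)) = (\<Sum>j\<in>D. (e j v0 - e j (d l)) * \<psi> j x)" for x
            by (simp add: \<delta>_def left_diff_distrib sum_subtractf)
          ultimately show ?thesis unfolding Y_def by (simp only:)
        qed
        show "(\<lambda>l. e j v0 - e j (d l)) \<longlonglongrightarrow> e j v0" for j
        proof -
          have "(\<lambda>l. e j (d l)) \<longlonglongrightarrow> 0"
          proof (rule Lim_null_comparison)
            show "(\<lambda>l. \<bar>K\<bar> * (c * (1 / real (Suc l)) / (cmod (z ^ n) - \<rho>))) \<longlonglongrightarrow> 0"
            proof -
              have "(\<lambda>l. (\<bar>K\<bar> * c / (cmod (z ^ n) - \<rho>)) * (1 / real (Suc l))) \<longlonglongrightarrow> (\<bar>K\<bar> * c / (cmod (z ^ n) - \<rho>)) * 0"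
                by (intro tendsto_mult tendsto_const LIMSEQ_Suc[OF lim_1_over_n])
              then show ?thesis by (simp add: mult.commute)
            qed
            have "cmod (e j (d l)) \<le> \<bar>K\<bar> * (c * (1 / real (Suc l)) / (cmod (z ^ n) - \<rho>))" for l
            proof -
              have "N (d l) \<le> N (\<delta> l) / (cmod (z ^ n) - \<rho>)" by (rule bound[OF d(1) \<delta>V d(2)])
              also have "\<dots> \<le> c * (1 / real (Suc l)) / (cmod (z ^ n) - \<rho>)"
                using \<rho>' by (intro divide_right_mono \<delta>N) auto
              finally have 1: "N (d l) \<le> c * (1 / real (Suc l)) / (cmod (z ^ n) - \<rho>)" .
              have "cmod (e j (d l)) \<le> K * N (d l)" by (rule ebd[OF d(1)])
              also have "\<dots> \<le> \<bar>K\<bar> * N (d l)" using N_nonneg[OF d(1)] by (intro mult_right_mono) auto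
              also have "\<dots> \<le> \<bar>K\<bar> * (c * (1 / real (Suc l)) / (cmod (z ^ n) - \<rho>))"
                using 1 by (intro mult_left_mono) auto
              finally show ?thesis .
            qed
            then show "\<forall>\<^sub>F l in sequentially. norm (e j (d l)) \<le> \<bar>K\<bar> * (c * (1 / real (Suc l)) / (cmod (z ^ n) - \<rho>))"
              by simp
          qed
          then have "(\<lambda>l. e j v0 - e j (d l)) \<longlonglongrightarrow> e j v0 - 0" by (intro tendsto_intros)
          then show ?thesis by simp
        qed
      qed
      then have "Ran (\<lambda>x. (w x - (\<Sum>j\<in>D. e j v0 * \<psi> j x)) + (\<Sum>j\<in>D. e j v0 * \<psi> j x))"
        unfolding Y_def by (intro Ran_add key v0)
      then show "\<exists>v\<in>V. AE x in M. w x = z * v x - T v x"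
        by (simp add: Ran_def)
    qed
  qed
qed

end

section \<open>Dyadic conditional expectations\<close>

abbreviation LI :: "real measure" where
  "LI \<equiv> lebesgue_on {-1..1}"

text \<open>Index of the dyadic cell containing x; the minimum puts the endpoint 1 into the last
  cell. With an index function, step functions are compositions with \<open>didx k\<close> and
  nestedness of the grids is division by 2.\<close>

definition didx :: "nat \<Rightarrow> real \<Rightarrow> nat" where
  "didx k x = min (2 ^ k - 1) (nat \<lfloor>(x + 1) * 2 ^ k / 2\<rfloor>)"

lemma didx_less [simp]: "didx k x < 2 ^ k"
  by (simp add: didx_def min_less_iff_disj)

lemma didx_mono: "x \<le> y \<Longrightarrow> didx k x \<le> didx k y"
  unfolding didx_def by (intro min.mono order_refl nat_mono floor_mono) (auto intro!: divide_right_mono mult_right_mono)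

lemma didx_eq_iff:
  assumes "j < 2 ^ k" "x \<in> {-1..1}"
  shows "didx k x = j \<longleftrightarrow> x \<in> dyadic_cell k j"
proof -
  let ?a = "(x + 1) * 2 ^ k / 2"
  have a0: "?a \<ge> 0" using assms by simp
  have a1: "?a \<le> 2 ^ k"
  proof -
    have "(x + 1) * 2 ^ k \<le> 2 * 2 ^ k" using assms by (intro mult_right_mono) auto
    then show ?thesis by simp
  qed
  have cell: "x \<in> {-1 + 2 * real j / 2 ^ k ..< -1 + 2 * real (Suc j) / 2 ^ k} \<longleftrightarrow> real j \<le> ?a \<and> ?a < real j + 1"
    by (auto simp: field_simps)
  have fl: "nat \<lfloor>?a\<rfloor> = j \<longleftrightarrow> real j \<le> ?a \<and> ?a < real j + 1"
  proof -
    have "\<lfloor>?a\<rfloor> \<ge> 0" using a0 by simp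
    then have "nat \<lfloor>?a\<rfloor> = j \<longleftrightarrow> \<lfloor>?a\<rfloor> = int j" by linarith
    also have "\<dots> \<longleftrightarrow> real j \<le> ?a \<and> ?a < real j + 1" by (simp add: floor_eq_iff)
    finally show ?thesis .
  qed
  show ?thesis
  proof (cases "x = 1")
    case True
    then have "didx k x = 2 ^ k - 1" by (simp add: didx_def nat_power_eq)
    moreover have "x \<in> dyadic_cell k j \<longleftrightarrow> Suc j = 2 ^ k"
    proof -
      have "real (Suc j) \<le> 2 ^ k" using assms(1) by (metis Suc_leI of_nat_le_iff of_nat_numeral of_nat_power)
      then have "\<not> 1 < -1 + 2 * real (Suc j) / 2 ^ k" by (simp add: field_simps)
      then show ?thesis using True by (auto simp: dyadic_cell_def)
    qed
    ultimately show ?thesis using assms(1) by auto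
  next
    case False
    then have "x < 1" using assms by simp
    then have "(x + 1) * 2 ^ k < 2 * 2 ^ k" by (intro mult_strict_right_mono) auto
    then have "?a < 2 ^ k" by simp
    then have "\<lfloor>?a\<rfloor> < 2 ^ k" by (simp add: floor_less_iff)
    then have "nat \<lfloor>?a\<rfloor> < 2 ^ k" using a0 by (simp add: nat_less_iff)
    then have "didx k x = nat \<lfloor>?a\<rfloor>" unfolding didx_def by (intro min_absorb2) linarith
    moreover have "x \<in> dyadic_cell k j \<longleftrightarrow> x \<in> {-1 + 2 * real j / 2 ^ k ..< -1 + 2 * real (Suc j) / 2 ^ k}"
      using False by (auto simp: dyadic_cell_def)
    ultimately show ?thesis using cell fl by simp
  qed
qed

lemma dyadic_cell_eq:
  assumes "j < 2 ^ k"
  shows "dyadic_cell k j = {x\<in>{-1..1}. didx k x = j}"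
proof -
  have "dyadic_cell k j \<subseteq> {-1..1}"
  proof -
    have "real (Suc j) \<le> 2 ^ k" using assms by (metis Suc_leI of_nat_le_iff of_nat_numeral of_nat_power)
    then have "-1 + 2 * real (Suc j) / 2 ^ k \<le> 1" by (simp add: field_simps)
    moreover have "-1 \<le> -1 + 2 * real j / 2 ^ k" by simp
    ultimately have "{-1 + 2 * real j / 2 ^ k ..< -1 + 2 * real (Suc j) / 2 ^ k} \<subseteq> {-1..1}"
      by (meson atLeastLessThan_subseteq_atLeastAtMost_iff)
    then show ?thesis unfolding dyadic_cell_def by auto
  qed
  then show ?thesis using didx_eq_iff[OF assms] by auto
qed

lemma didx_Suc: "didx k x = didx (Suc k) x div 2"
proof -
  define b where "b = (x + 1) * 2 ^ k / 2"
  have "nat \<lfloor>b\<rfloor> = nat \<lfloor>2 * b\<rfloor> div 2"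
  proof -
    have "\<lfloor>b\<rfloor> = \<lfloor>2 * b\<rfloor> div 2"
      using floor_divide_real_eq_div[of 2 "2 * b"] by simp
    then show ?thesis by (simp add: nat_div_distrib)
  qed
  moreover have "(2 ^ k - 1 :: nat) = (2 ^ Suc k - 1) div 2" by simp
  moreover have "min m n div 2 = min (m div 2) (n div 2)" for m n :: nat
    by (simp add: min_def div_le_mono antisym)
  moreover have "(x + 1) * 2 ^ Suc k / 2 = 2 * b" by (simp add: b_def)
  ultimately show ?thesis by (simp only: didx_def b_def[symmetric])
qed

lemma didx_measurable [measurable]: "didx k \<in> measurable borel (count_space UNIV)"
  unfolding didx_def by measurable

lemma didx_measurable_LI [measurable]: "didx k \<in> measurable LI (count_space UNIV)"
  by (intro measurable_restrict_space1 measurable_completion) (simp add: didx_measurable)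

lemma cell_sets [measurable, simp]: "{x\<in>{-1..1}. didx k x = j} \<in> sets LI"
proof -
  have "{x\<in>{-1..1}. didx k x = j} = didx k -` {j} \<inter> space LI" by auto
  then show ?thesis using measurable_sets[OF didx_measurable_LI, of "{j}" k] by simp
qed

lemma finite_measure_LI: "finite_measure LI"
  by (rule finite_measure_lebesgue_on) simp

lemma integrable_LI_const [simp]: "integrable LI (\<lambda>x. c :: 'b :: {banach, second_countable_topology})"
  using finite_measure.integrable_const[OF finite_measure_LI] .

lemma measure_cell:
  assumes "j < 2 ^ k"
  shows "measure LI {x\<in>{-1..1}. didx k x = j} = 2 / 2 ^ k"
proof -
  have "measure LI {x\<in>{-1..1}. didx k x = j} = measure lebesgue (dyadic_cell k j)"
    using assms by (subst measure_restrict_space) (auto simp: dyadic_cell_eq)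
  also have "\<dots> = measure lebesgue {-1 + 2 * real j / 2 ^ k ..< -1 + 2 * real (Suc j) / 2 ^ k}"
  proof (rule measure_negligible_symdiff)
    show "{-1 + 2 * real j / 2 ^ k ..< -1 + 2 * real (Suc j) / 2 ^ k} \<in> lmeasurable"
      by (intro measurable_convex) (auto intro: bounded_subset[OF bounded_closed_interval])
    show "negligible (sym_diff {-1 + 2 * real j / 2 ^ k ..< -1 + 2 * real (Suc j) / 2 ^ k} (dyadic_cell k j))"
      by (rule negligible_subset[of "{1}"]) (auto simp: dyadic_cell_def split: if_splits)
  qed
  also have "\<dots> = 2 / 2 ^ k" by (simp add: field_simps)
  finally show ?thesis .
qed

lemma step_integral:
  fixes F :: "nat \<Rightarrow> real"
  shows "integrable LI (\<lambda>x. F (didx k x))" "(\<integral>x. F (didx k x) \<partial>LI) = 2 / 2 ^ k * (\<Sum>j<2 ^ k. F j)"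
proof -
  have *: "F (didx k x) = (\<Sum>j<2 ^ k. F j * indicator {x\<in>{-1..1}. didx k x = j} x)" if "x \<in> space LI" for x
  proof -
    have "(\<Sum>j<2 ^ k. F j * indicator {x\<in>{-1..1}. didx k x = j} x) = (\<Sum>j<2 ^ k. if j = didx k x then F j else 0)"
      using that by (intro sum.cong) auto
    then show ?thesis by simp
  qed
  have sets: "{x\<in>{-1..1}. didx k x = j} \<in> sets LI" for j by (rule cell_sets)
  have int: "integrable LI (\<lambda>x. F j * indicator {x\<in>{-1..1}. didx k x = j} x)" for j
    using finite_measure.emeasure_finite[OF finite_measure_LI] sets[of j]
    by (intro integrable_mult_right integrable_real_indicator) (auto simp: less_top)
  show "integrable LI (\<lambda>x. F (didx k x))"
    by (subst Bochner_Integration.integrable_cong[OF refl *], assumption, intro Bochner_Integration.integrable_sum int)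
  have "(\<integral>x. F (didx k x) \<partial>LI) = (\<Sum>j<2 ^ k. \<integral>x. F j * indicator {x\<in>{-1..1}. didx k x = j} x \<partial>LI)"
    by (subst Bochner_Integration.integral_cong[OF refl *], assumption, intro Bochner_Integration.integral_sum int)
  also have "\<dots> = (\<Sum>j<2 ^ k. F j * (2 / 2 ^ k))"
  proof (rule sum.cong[OF refl])
    fix j assume "j \<in> {..<2 ^ k :: nat}"
    moreover have "{x\<in>{-1..1}. didx k x = j} \<inter> {-1..1} = {x\<in>{-1..1}. didx k x = j}" by auto
    ultimately show "(\<integral>x. F j * indicator {x\<in>{-1..1}. didx k x = j} x \<partial>LI) = F j * (2 / 2 ^ k)"
      using measure_cell[of j k] by simp
  qed
  finally show "(\<integral>x. F (didx k x) \<partial>LI) = 2 / 2 ^ k * (\<Sum>j<2 ^ k. F j)"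
    by (subst mult.commute) (simp only: sum_distrib_right)
qed

lemma Lp_space_LI_integrable:
  assumes "p \<ge> 1" "u \<in> Lp_space LI p"
  shows "integrable LI u"
proof (rule Bochner_Integration.integrable_bound)
  show "integrable LI (\<lambda>x. 1 + cmod (u x) powr p)"
    by (intro Bochner_Integration.integrable_add integrable_LI_const Lp_spaceD(2)[OF assms(2)])
  show "u \<in> borel_measurable LI" by (rule Lp_spaceD(1)[OF assms(2)])
  have "cmod (u x) \<le> 1 + cmod (u x) powr p" for x
  proof (cases "cmod (u x) \<le> 1")
    case True
    then show ?thesis by (simp add: add_increasing2)
  next
    case False
    then have "cmod (u x) powr 1 \<le> cmod (u x) powr p" using assms by (intro powr_mono) auto
    then show ?thesis using False by simp
  qed
  then show "AE x in LI. norm (u x) \<le> norm (1 + cmod (u x) powr p)" by simp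
qed

lemma integrable_on_cell:
  fixes u :: "real \<Rightarrow> 'b :: {banach, second_countable_topology}"
  assumes "integrable LI u"
  shows "integrable LI (\<lambda>x. if didx k x = j then u x else 0)"
proof (rule Bochner_Integration.integrable_bound[OF assms])
  have [measurable]: "u \<in> borel_measurable LI" using assms by simp
  show "(\<lambda>x. if didx k x = j then u x else 0) \<in> borel_measurable LI" by measurable
qed auto

definition davg :: "nat \<Rightarrow> nat \<Rightarrow> (real \<Rightarrow> complex) \<Rightarrow> complex" where
  "davg k j u = 2 ^ k / 2 * (\<integral>x. (if didx k x = j then u x else 0) \<partial>LI)"

text \<open>Conditional expectation with the level shifted by one: level 0 is the zero operator, so that
  the plain \<open>L\<^sup>p\<close> norm is the approximation error of level 0 and needs no separate treatment.\<close>

primrec cexp :: "nat \<Rightarrow> (real \<Rightarrow> complex) \<Rightarrow> real \<Rightarrow> complex" where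
  "cexp 0 u x = 0"
| "cexp (Suc k) u x = davg k (didx k x) u"

text \<open>The functions fixed by \<open>cexp\<close> of the same shifted level. Values outside
  [-1,1] are left free since \<open>LI\<close> does not see them.\<close>

primrec dstep :: "nat \<Rightarrow> (real \<Rightarrow> complex) \<Rightarrow> bool" where
  "dstep 0 g \<longleftrightarrow> (\<forall>x\<in>{-1..1}. g x = 0)"
| "dstep (Suc k) g \<longleftrightarrow> (\<exists>a. \<forall>x\<in>{-1..1}. g x = a (didx k x))"

lemma davg_add:
  assumes "integrable LI u" "integrable LI v"
  shows "davg k j (\<lambda>x. u x + v x) = davg k j u + davg k j v"
proof -
  have "(\<integral>x. (if didx k x = j then u x + v x else 0) \<partial>LI)
      = (\<integral>x. (if didx k x = j then u x else 0) + (if didx k x = j then v x else 0) \<partial>LI)"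
    by (intro Bochner_Integration.integral_cong) auto
  also have "\<dots> = (\<integral>x. (if didx k x = j then u x else 0) \<partial>LI) + (\<integral>x. (if didx k x = j then v x else 0) \<partial>LI)"
    by (intro Bochner_Integration.integral_add integrable_on_cell assms)
  finally show ?thesis by (simp add: davg_def algebra_simps)
qed

lemma davg_cmult: "davg k j (\<lambda>x. a * u x) = a * davg k j u"
proof -
  have "(\<integral>x. (if didx k x = j then a * u x else 0) \<partial>LI) = (\<integral>x. a * (if didx k x = j then u x else 0) \<partial>LI)"
    by (intro Bochner_Integration.integral_cong) auto
  then show ?thesis by (simp add: davg_def)
qed

text \<open>Integrate the tangent inequality at the cell average a of |u|. The tangent needs a > 0;
  otherwise the average of u itself vanishes.\<close>

lemma davg_jensen:
  assumes p: "p \<ge> 1" and u: "u \<in> Lp_space LI p" and j: "j < 2 ^ k"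
  shows "2 / 2 ^ k * cmod (davg k j u) powr p \<le> (\<integral>x. (if didx k x = j then cmod (u x) powr p else 0) \<partial>LI)"
proof -
  define a where "a = 2 ^ k / 2 * (\<integral>x. (if didx k x = j then cmod (u x) else 0) \<partial>LI)"
  have iu: "integrable LI (\<lambda>x. cmod (u x))" using Lp_space_LI_integrable[OF p u] by simp
  have ip: "integrable LI (\<lambda>x. cmod (u x) powr p)" by (rule Lp_spaceD(2)[OF u])
  have "cmod (davg k j u) = 2 ^ k / 2 * cmod (\<integral>x. (if didx k x = j then u x else 0) \<partial>LI)"
    by (simp add: davg_def norm_mult norm_divide norm_power)
  also have "\<dots> \<le> 2 ^ k / 2 * (\<integral>x. cmod (if didx k x = j then u x else 0) \<partial>LI)"
    by (intro mult_left_mono integral_norm_bound) auto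
  also have "(\<integral>x. cmod (if didx k x = j then u x else 0) \<partial>LI) = (\<integral>x. (if didx k x = j then cmod (u x) else 0) \<partial>LI)"
    by (intro Bochner_Integration.integral_cong) auto
  finally have le: "cmod (davg k j u) \<le> a" by (simp add: a_def)
  have int1: "(\<integral>x. (if didx k x = j then c else 0) \<partial>LI) = 2 / 2 ^ k * c" for c :: real
  proof -
    have "(\<Sum>i<2 ^ k. if i = j then c else 0) = c" using j by simp
    then show ?thesis using step_integral(2)[of "\<lambda>i. if i = j then c else 0" k] by simp
  qed
  show ?thesis
  proof (cases "a > 0")
    case True
    have "2 / 2 ^ k * cmod (davg k j u) powr p \<le> 2 / 2 ^ k * a powr p"
      using le p by (intro mult_left_mono powr_mono2) auto
    also have "\<dots> = 2 / 2 ^ k * (a powr p - p * a powr (p - 1) * a) + p * a powr (p - 1) * (2 / 2 ^ k * a)"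
      by (simp add: algebra_simps)
    also have "\<dots> = (\<integral>x. (if didx k x = j then a powr p - p * a powr (p - 1) * a else 0) \<partial>LI)
        + p * a powr (p - 1) * (\<integral>x. (if didx k x = j then cmod (u x) else 0) \<partial>LI)"
      unfolding int1 by (simp add: a_def)
    also have "\<dots> = (\<integral>x. (if didx k x = j then a powr p - p * a powr (p - 1) * a else 0)
        + p * a powr (p - 1) * (if didx k x = j then cmod (u x) else 0) \<partial>LI)"
      by (subst Bochner_Integration.integral_add) (auto intro!: integrable_on_cell iu integrable_mult_right)
    also have "\<dots> \<le> (\<integral>x. (if didx k x = j then cmod (u x) powr p else 0) \<partial>LI)"
    proof (rule integral_mono)
      fix x
      show "(if didx k x = j then a powr p - p * a powr (p - 1) * a else 0) + p * a powr (p - 1) * (if didx k x = j then cmod (u x) else 0)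
          \<le> (if didx k x = j then cmod (u x) powr p else 0)"
        using powr_above_tangent[OF p True, of "cmod (u x)"] by (simp add: algebra_simps)
    qed (auto intro!: integrable_on_cell iu ip integrable_mult_right Bochner_Integration.integrable_add)
    finally show ?thesis .
  next
    case False
    then have "davg k j u = 0" using le by (metis norm_le_zero_iff not_less order_trans)
    then show ?thesis by (simp add: integral_nonneg)
  qed
qed

lemma Lp_norm_LI_cong:
  assumes "\<And>x. x \<in> {-1..1} \<Longrightarrow> u x = v x"
  shows "Lp_norm LI p u = Lp_norm LI p v"
  unfolding Lp_norm_def
  by (rule arg_cong[where f = "\<lambda>z. z powr (1/p)"], rule Bochner_Integration.integral_cong) (use assms in auto)

lemma Lp_space_LI_cong:
  assumes "\<And>x. x \<in> {-1..1} \<Longrightarrow> u x = v x"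
  shows "u \<in> Lp_space LI p \<longleftrightarrow> v \<in> Lp_space LI p"
proof -
  have "u \<in> borel_measurable LI \<longleftrightarrow> v \<in> borel_measurable LI"
    by (rule measurable_cong) (use assms in simp)
  moreover have "integrable LI (\<lambda>x. cmod (u x) powr p) \<longleftrightarrow> integrable LI (\<lambda>x. cmod (v x) powr p)"
    by (rule Bochner_Integration.integrable_cong) (use assms in simp_all)
  ultimately show ?thesis by (simp add: Lp_space_def)
qed

lemma step_Lp:
  assumes p: "p \<ge> 1"
  shows "(\<lambda>x. a (didx k x)) \<in> Lp_space LI p"
    and "Lp_norm LI p (\<lambda>x. a (didx k x)) powr p = 2 / 2 ^ k * (\<Sum>j<2 ^ k. cmod (a j) powr p)"
proof -
  show "(\<lambda>x. a (didx k x)) \<in> Lp_space LI p"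
    unfolding Lp_space_def using step_integral(1)[of "\<lambda>j. cmod (a j) powr p" k] by simp
  show "Lp_norm LI p (\<lambda>x. a (didx k x)) powr p = 2 / 2 ^ k * (\<Sum>j<2 ^ k. cmod (a j) powr p)"
    using step_integral(2)[of "\<lambda>j. cmod (a j) powr p" k] by (simp add: Lp_norm_powr[OF p])
qed

lemma dstep_Lp:
  assumes p: "p \<ge> 1" and g: "dstep i g"
  shows "g \<in> Lp_space LI p"
proof (cases i)
  case 0
  then show ?thesis using g Lp_space_LI_cong[of g "\<lambda>x. 0" p] by simp
next
  case (Suc k)
  then obtain a where "\<And>x. x \<in> {-1..1} \<Longrightarrow> g x = a (didx k x)" using g by auto
  then have "g \<in> Lp_space LI p \<longleftrightarrow> (\<lambda>x. a (didx k x)) \<in> Lp_space LI p" by (rule Lp_space_LI_cong)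
  then show ?thesis using step_Lp(1)[OF p] by simp
qed

lemma dstep_cexp [simp]: "dstep i (cexp i u)"
  by (cases i) auto

lemma cexp_Lp:
  assumes "p \<ge> 1"
  shows "cexp i u \<in> Lp_space LI p"
  by (rule dstep_Lp[OF assms dstep_cexp])

lemma cexp_dstep:
  assumes g: "dstep i g" and x: "x \<in> {-1..1}"
  shows "cexp i g x = g x"
proof (cases i)
  case (Suc k)
  then obtain a where a: "\<And>x. x \<in> {-1..1} \<Longrightarrow> g x = a (didx k x)" using g by auto
  have "(\<integral>y. (if didx k y = didx k x then g y else 0) \<partial>LI) = (\<integral>y. a (didx k x) * of_real (if didx k y = didx k x then 1 else 0) \<partial>LI)"
    by (intro Bochner_Integration.integral_cong) (auto simp: a)
  also have "\<dots> = a (didx k x) * of_real (2 / 2 ^ k)"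
  proof -
    have "(\<Sum>i<2 ^ k. if i = didx k x then 1 else 0 :: real) = 1" by simp
    then have "(\<integral>y. (if didx k y = didx k x then 1 else 0 :: real) \<partial>LI) = 2 / 2 ^ k"
      using step_integral(2)[of "\<lambda>i. if i = didx k x then 1 else 0" k] by simp
    then show ?thesis by (subst integral_mult_right_zero, subst integral_complex_of_real) simp
  qed
  finally show ?thesis using Suc a[OF x] by (simp add: davg_def)
qed (use assms in auto)

lemma cexp_add:
  assumes "integrable LI u" "integrable LI v"
  shows "cexp i (\<lambda>x. u x + v x) = (\<lambda>x. cexp i u x + cexp i v x)"
  by (cases i) (auto simp: fun_eq_iff davg_add[OF assms])

lemma cexp_cmult: "cexp i (\<lambda>x. a * u x) = (\<lambda>x. a * cexp i u x)"
  by (cases i) (auto simp: fun_eq_iff davg_cmult)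

lemma cexp_diff:
  assumes "integrable LI u" "integrable LI v"
  shows "cexp i (\<lambda>x. u x - v x) = (\<lambda>x. cexp i u x - cexp i v x)"
  using cexp_add[OF assms(1) integrable_mult_right[OF assms(2), of "-1"], of i] cexp_cmult[of i "-1" v] by simp

lemma cexp_contract:
  assumes p: "p \<ge> 1" and u: "u \<in> Lp_space LI p"
  shows "Lp_norm LI p (cexp i u) \<le> Lp_norm LI p u"
proof (cases i)
  case 0
  then have "Lp_norm LI p (cexp i u) = Lp_norm LI p (\<lambda>x. 0)" by (intro Lp_norm_LI_cong) simp
  then show ?thesis by simp
next
  case (Suc k)
  have ip: "integrable LI (\<lambda>x. cmod (u x) powr p)" by (rule Lp_spaceD(2)[OF u])
  have "cexp i u = (\<lambda>x. davg k (didx k x) u)" using Suc by (simp add: fun_eq_iff)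
  then have "(\<integral>x. cmod (cexp i u x) powr p \<partial>LI) = 2 / 2 ^ k * (\<Sum>j<2 ^ k. cmod (davg k j u) powr p)"
    using step_Lp(2)[OF p, of "\<lambda>j. davg k j u" k] by (simp add: Lp_norm_powr[OF p])
  also have "\<dots> \<le> (\<Sum>j<2 ^ k. (\<integral>x. (if didx k x = j then cmod (u x) powr p else 0) \<partial>LI))"
    unfolding sum_distrib_left by (intro sum_mono davg_jensen p u) auto
  also have "\<dots> = (\<integral>x. (\<Sum>j<2 ^ k. (if didx k x = j then cmod (u x) powr p else 0)) \<partial>LI)"
    by (rule Bochner_Integration.integral_sum[symmetric]) (intro integrable_on_cell ip)
  also have "\<dots> = Lp_norm LI p u powr p" by (simp add: Lp_norm_powr[OF p])
  finally show ?thesis by (intro Lp_norm_leI[OF p]) auto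
qed

lemma dstep_Suc: "dstep i g \<Longrightarrow> dstep (Suc i) g"
proof (cases i)
  case 0
  then show "dstep i g \<Longrightarrow> dstep (Suc i) g" by (auto intro!: exI[of _ "\<lambda>_. 0"])
next
  case (Suc k)
  assume "dstep i g"
  then obtain a where "\<And>x. x \<in> {-1..1} \<Longrightarrow> g x = a (didx k x)" using Suc by auto
  then show "dstep (Suc i) g" using Suc by (auto intro!: exI[of _ "\<lambda>j. a (j div 2)"] simp flip: didx_Suc)
qed

lemma dstep_mono: "i \<le> i' \<Longrightarrow> dstep i g \<Longrightarrow> dstep i' g"
  by (induction i' rule: dec_induct) (auto intro: dstep_Suc simp del: dstep.simps)

lemma dstep_zero: "dstep i (\<lambda>x. 0)"
  by (cases i) auto

lemma dstep_add: "dstep i g \<Longrightarrow> dstep i h \<Longrightarrow> dstep i (\<lambda>x. g x + h x)"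
proof (cases i)
  case (Suc k)
  assume "dstep i g" "dstep i h"
  then obtain a b where "\<forall>x\<in>{-1..1}. g x = a (didx k x)" "\<forall>x\<in>{-1..1}. h x = b (didx k x)" using Suc by auto
  then show "dstep i (\<lambda>x. g x + h x)" using Suc by (auto intro!: exI[of _ "\<lambda>j. a j + b j"])
qed auto

lemma dstep_cmult: "dstep i g \<Longrightarrow> dstep i (\<lambda>x. c * g x)"
proof (cases i)
  case (Suc k)
  assume "dstep i g"
  then obtain a where "\<forall>x\<in>{-1..1}. g x = a (didx k x)" using Suc by auto
  then show "dstep i (\<lambda>x. c * g x)" using Suc by (auto intro!: exI[of _ "\<lambda>j. c * a j"])
qed auto

lemma dstep_diff: "dstep i g \<Longrightarrow> dstep i h \<Longrightarrow> dstep i (\<lambda>x. g x - h x)"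
  using dstep_add[OF _ dstep_cmult[of i h "-1"], of g] by simp

lemma dstep_sum: "(\<And>j. j \<in> S \<Longrightarrow> dstep i (g j)) \<Longrightarrow> dstep i (\<lambda>x. \<Sum>j\<in>S. g j x)"
  by (induction S rule: infinite_finite_induct) (auto intro: dstep_add dstep_zero)

section \<open>Errors of approximation by step functions\<close>

definition aerr :: "real \<Rightarrow> nat \<Rightarrow> (real \<Rightarrow> complex) \<Rightarrow> real" where
  "aerr p i u = Lp_norm LI p (\<lambda>x. u x - cexp i u x)"

lemma aerr_nonneg [simp]: "aerr p i u \<ge> 0"
  by (simp add: aerr_def)

lemma aerr_0 [simp]: "aerr p 0 u = Lp_norm LI p u"
  by (simp add: aerr_def)

text \<open>The projection fixes v, so u and u - v have the same error, and the projection is a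
  contraction. Hence any step function, not only the conditional expectation, may serve to bound the
  error.\<close>

lemma aerr_le:
  assumes p: "p \<ge> 1" and u: "u \<in> Lp_space LI p" and v: "dstep i v"
  shows "aerr p i u \<le> 2 * Lp_norm LI p (\<lambda>x. u x - v x)"
proof -
  have vL: "v \<in> Lp_space LI p" by (rule dstep_Lp[OF p v])
  let ?d = "\<lambda>x. u x - v x"
  have d: "?d \<in> Lp_space LI p" by (rule Lp_space_diff[OF p u vL])
  have "cexp i ?d x = cexp i u x - v x" if "x \<in> {-1..1}" for x
    using cexp_diff[OF Lp_space_LI_integrable[OF p u] Lp_space_LI_integrable[OF p vL], of i] cexp_dstep[OF v that] by simp
  then have "aerr p i u = Lp_norm LI p (\<lambda>x. ?d x - cexp i ?d x)"
    unfolding aerr_def by (intro Lp_norm_LI_cong) simp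
  also have "\<dots> \<le> Lp_norm LI p ?d + Lp_norm LI p (cexp i ?d)"
    by (intro Lp_norm_triangle_diff p d cexp_Lp)
  also have "\<dots> \<le> 2 * Lp_norm LI p ?d" using cexp_contract[OF p d, of i] by simp
  finally show ?thesis .
qed

lemma aerr_le_norm:
  assumes "p \<ge> 1" "u \<in> Lp_space LI p"
  shows "aerr p i u \<le> 2 * Lp_norm LI p u"
  using aerr_le[OF assms dstep_zero] by simp

lemma aerr_add:
  assumes p: "p \<ge> 1" and u: "u \<in> Lp_space LI p" and v: "v \<in> Lp_space LI p"
  shows "aerr p i (\<lambda>x. u x + v x) \<le> aerr p i u + aerr p i v"
proof -
  have "aerr p i (\<lambda>x. u x + v x) = Lp_norm LI p (\<lambda>x. (u x - cexp i u x) + (v x - cexp i v x))"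
    unfolding aerr_def cexp_add[OF Lp_space_LI_integrable[OF p u] Lp_space_LI_integrable[OF p v]]
    by (simp add: algebra_simps)
  also have "\<dots> \<le> aerr p i u + aerr p i v" unfolding aerr_def
    by (intro Lp_norm_triangle Lp_space_diff p u v cexp_Lp)
  finally show ?thesis .
qed

lemma aerr_cmult:
  assumes p: "p \<ge> 1"
  shows "aerr p i (\<lambda>x. a * u x) = cmod a * aerr p i u"
proof -
  have "aerr p i (\<lambda>x. a * u x) = Lp_norm LI p (\<lambda>x. a * (u x - cexp i u x))"
    unfolding aerr_def cexp_cmult by (simp add: algebra_simps)
  then show ?thesis by (simp add: Lp_norm_cmult[OF p] aerr_def)
qed

lemma cexp_jump_le:
  assumes p: "p \<ge> 1" and u: "u \<in> Lp_space LI p"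
  shows "Lp_norm LI p (\<lambda>x. cexp (Suc k) u x - cexp k u x) \<le> aerr p k u + aerr p (Suc k) u"
proof -
  have "(\<lambda>x. cexp (Suc k) u x - cexp k u x) = (\<lambda>x. (u x - cexp k u x) - (u x - cexp (Suc k) u x))"
    by (auto simp del: cexp.simps)
  then show ?thesis unfolding aerr_def
    by (simp only:) (intro Lp_norm_triangle_diff Lp_space_diff p u cexp_Lp)
qed

section \<open>The Besov norm via approximation errors\<close>

text \<open>The matrix is constant along diagonals. The shift m records by how many dyadic levels an
  operator moves scales; it does not enter the bound.\<close>

lemma lq_schur_geometric:
  assumes q: "1 \<le> q" and \<rho>: "0 < \<rho>" "\<rho> < 1" and c: "c \<ge> 0"
    and x: "\<And>k. x k \<ge> 0" "lq_fin q x" and y: "\<And>i. y i \<ge> 0"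
    and le: "\<And>i e. e > 0 \<Longrightarrow> \<exists>n. y i \<le> (\<Sum>k<n. c * \<rho> ^ nat \<bar>int k - (int i + m)\<bar> * x k) + e"
  shows "lq_fin q y \<and> lq_norm q y \<le> c * (2 / (1 - \<rho>)) * lq_norm q x"
proof (rule lq_schur[OF q _ _ _ _ x y le])
  show "(\<Sum>k<n. c * \<rho> ^ nat \<bar>int k - (int i + m)\<bar>) \<le> c * (2 / (1 - \<rho>))" for i n
    unfolding sum_distrib_left[symmetric] by (intro mult_left_mono sum_geometric_abs_le \<rho> c)
  show "(\<Sum>i<n. c * \<rho> ^ nat \<bar>int k - (int i + m)\<bar>) \<le> c * (2 / (1 - \<rho>))" for k n
  proof -
    have "\<bar>int k - (int i + m)\<bar> = \<bar>int i - (int k - m)\<bar>" for i by linarith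
    then show ?thesis
      unfolding sum_distrib_left[symmetric] by (simp only:) (intro mult_left_mono sum_geometric_abs_le \<rho> c)
  qed
qed (use \<rho> c in auto)

text \<open>Cells have positive measure, hence are nonempty, and a common point determines the
  index. This turns sums over the set of cells into sums over indices.\<close>

lemma inj_on_dyadic_cell: "inj_on (dyadic_cell k) {..<2 ^ k}"
proof (rule inj_onI)
  fix i j assume ij: "i \<in> {..<2 ^ k :: nat}" "j \<in> {..<2 ^ k}" "dyadic_cell k i = dyadic_cell k j"
  have "measure LI {x\<in>{-1..1}. didx k x = i} \<noteq> 0" using measure_cell[of i k] ij by simp
  then have "{x\<in>{-1..1}. didx k x = i} \<noteq> {}" by (metis measure_empty)
  then obtain x where "x \<in> dyadic_cell k i" using ij(1) by (auto simp: dyadic_cell_eq)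
  then have "x \<in> dyadic_cell k i" "x \<in> dyadic_cell k j" using ij(3) by auto
  then show "i = j" using ij by (auto simp: dyadic_cell_eq)
qed

lemma sum_dyadic_grid: "(\<Sum>Q\<in>dyadic_grid k. F Q) = (\<Sum>j<2 ^ k. F (dyadic_cell k j))"
  by (simp add: dyadic_grid_def sum.reindex[OF inj_on_dyadic_cell])

lemma measure_dyadic_cell:
  assumes "j < 2 ^ k"
  shows "measure LI (dyadic_cell k j) = 2 / 2 ^ k"
  using measure_cell[OF assms] by (simp add: dyadic_cell_eq[OF assms])

definition besov_layer :: "real \<Rightarrow> real \<Rightarrow> (nat \<Rightarrow> real set \<Rightarrow> complex) \<Rightarrow> nat \<Rightarrow> real \<Rightarrow> complex" where
  "besov_layer s p c k x = (\<Sum>Q\<in>dyadic_grid k. c k Q * besov_atom LI s p Q x)"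

lemma besov_layer_eq:
  assumes "x \<in> {-1..1}"
  shows "besov_layer s p c k x = c k (dyadic_cell k (didx k x)) * of_real ((2 / 2 ^ k) powr (s - 1 / p))"
proof -
  have "besov_layer s p c k x = (\<Sum>j<2 ^ k. if j = didx k x then c k (dyadic_cell k (didx k x)) * of_real ((2 / 2 ^ k) powr (s - 1 / p)) else 0)"
    unfolding besov_layer_def sum_dyadic_grid besov_atom_def
    by (intro sum.cong) (auto simp: measure_dyadic_cell indicator_def didx_eq_iff[OF _ assms, symmetric])
  then show ?thesis by simp
qed

lemma besov_layer_dstep: "dstep (Suc k) (besov_layer s p c k)"
  using besov_layer_eq by (auto intro!: exI[of _ "\<lambda>j. c k (dyadic_cell k j) * of_real ((2 / 2 ^ k) powr (s - 1 / p))"])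

text \<open>A cell Q contributes |Q| |Q|^(sp-1) |c|^p to the p-th power, and all cells of one level
  have the same length: this is what the normalisation of the atoms achieves.\<close>

lemma besov_layer_norm:
  assumes p: "p \<ge> 1"
  shows "Lp_norm LI p (besov_layer s p c k) = (2 / 2 ^ k) powr s * besov_level dyadic_grid p c k"
proof -
  let ?q = "2 / 2 ^ k :: real"
  have q0: "?q > 0" by simp
  define S where "S = (\<Sum>j<2 ^ k. cmod (c k (dyadic_cell k j)) powr p)"
  have S: "S \<ge> 0" unfolding S_def by (intro sum_nonneg) auto
  have "Lp_norm LI p (besov_layer s p c k) = Lp_norm LI p (\<lambda>x. c k (dyadic_cell k (didx k x)) * of_real (?q powr (s - 1 / p)))"
    by (rule Lp_norm_LI_cong) (rule besov_layer_eq)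
  then have "Lp_norm LI p (besov_layer s p c k) powr p = ?q * (\<Sum>j<2 ^ k. cmod (c k (dyadic_cell k j) * of_real (?q powr (s - 1 / p))) powr p)"
    using step_Lp(2)[OF p, of "\<lambda>j. c k (dyadic_cell k j) * of_real (?q powr (s - 1 / p))" k] by simp
  also have "\<dots> = ?q * ((?q powr (s - 1 / p)) powr p * S)"
  proof -
    have "cmod (z * of_real (?q powr (s - 1 / p))) powr p = (?q powr (s - 1 / p)) powr p * cmod z powr p" for z
      by (simp add: norm_mult powr_mult mult.commute)
    then show ?thesis unfolding S_def sum_distrib_left by simp
  qed
  also have "\<dots> = (?q powr s) powr p * S"
  proof -
    have "(?q powr s) powr p = ?q powr (1 + (s - 1 / p) * p)"
      using p by (simp add: powr_powr algebra_simps)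
    also have "\<dots> = ?q * (?q powr (s - 1 / p)) powr p"
      using q0 by (simp only: powr_add powr_powr powr_one[OF less_imp_le])
    finally show ?thesis by simp
  qed
  finally have eq: "Lp_norm LI p (besov_layer s p c k) powr p = (?q powr s) powr p * S" .
  have "Lp_norm LI p (besov_layer s p c k) = (Lp_norm LI p (besov_layer s p c k) powr p) powr (1 / p)"
    using p by (simp add: powr_powr)
  also have "\<dots> = ?q powr s * S powr (1 / p)"
    unfolding eq using p S by (subst powr_mult) (auto simp: powr_powr)
  finally show ?thesis by (simp add: S_def besov_level_def sum_dyadic_grid)
qed

locale besov_params =
  fixes s p :: real and q :: ereal
  assumes s: "0 < s" "s < 1 / p" and p: "1 \<le> p" and q: "1 \<le> q"
begin

text \<open>Entry 0 is the L^p norm, so one weighted sequence carries both the size and the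
  smoothness of u.\<close>

definition bseq :: "(real \<Rightarrow> complex) \<Rightarrow> nat \<Rightarrow> real" where
  "bseq u k = 2 powr (real k * s) * aerr p k u"

definition BV :: "(real \<Rightarrow> complex) set" where
  "BV = {u \<in> Lp_space LI p. lq_fin q (bseq u)}"

definition BN :: "(real \<Rightarrow> complex) \<Rightarrow> real" where
  "BN u = lq_norm q (bseq u)"

lemma bseq_nonneg [simp]: "bseq u k \<ge> 0"
  by (simp add: bseq_def)

lemma bseq_0 [simp]: "bseq u 0 = Lp_norm LI p u"
  by (simp add: bseq_def)

lemma BVD: "u \<in> BV \<Longrightarrow> u \<in> Lp_space LI p" "u \<in> BV \<Longrightarrow> lq_fin q (bseq u)"
  by (auto simp: BV_def)

lemma bseq_le_BN: "u \<in> BV \<Longrightarrow> bseq u k \<le> BN u"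
  unfolding BN_def by (rule lq_coord[OF q]) (auto simp: BVD)

lemma Lp_norm_le_BN: "u \<in> BV \<Longrightarrow> Lp_norm LI p u \<le> BN u"
  using bseq_le_BN[of u 0] by simp

lemma bseq_add:
  "u \<in> Lp_space LI p \<Longrightarrow> v \<in> Lp_space LI p \<Longrightarrow> bseq (\<lambda>x. u x + v x) k \<le> bseq u k + bseq v k"
  using aerr_add[OF p, of u v k] by (simp add: bseq_def flip: distrib_left)

lemma bseq_cmult: "bseq (\<lambda>x. a * u x) k = cmod a * bseq u k"
  by (simp add: bseq_def aerr_cmult[OF p])

lemma bseq_le_norm: "u \<in> Lp_space LI p \<Longrightarrow> bseq u k \<le> 2 powr (real k * s) * (2 * Lp_norm LI p u)"
  unfolding bseq_def by (intro mult_left_mono aerr_le_norm p) auto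

lemma BN_nonneg: "u \<in> BV \<Longrightarrow> BN u \<ge> 0"
  unfolding BN_def by (rule lq_norm_nonneg) (auto simp: BVD)

lemma BV_BN_add:
  assumes "u \<in> BV" "v \<in> BV"
  shows "(\<lambda>x. u x + v x) \<in> BV \<and> BN (\<lambda>x. u x + v x) \<le> BN u + BN v"
proof -
  have t: "lq_fin q (\<lambda>k. bseq u k + bseq v k) \<and> lq_norm q (\<lambda>k. bseq u k + bseq v k) \<le> BN u + BN v"
    unfolding BN_def by (rule lq_triangle[OF q]) (auto simp: BVD assms)
  have "lq_fin q (bseq (\<lambda>x. u x + v x)) \<and> BN (\<lambda>x. u x + v x) \<le> 1 * lq_norm q (\<lambda>k. bseq u k + bseq v k)"
    unfolding BN_def by (rule lq_mono[OF q]) (use t bseq_add BVD(1) assms in auto)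
  then show ?thesis
    using t Lp_space_add[OF p BVD(1)[OF assms(1)] BVD(1)[OF assms(2)]] by (simp add: BV_def)
qed

lemma BV_BN_cmult:
  assumes "u \<in> BV"
  shows "(\<lambda>x. a * u x) \<in> BV \<and> BN (\<lambda>x. a * u x) = cmod a * BN u"
proof -
  have "bseq (\<lambda>x. a * u x) = (\<lambda>k. cmod a * bseq u k)" by (simp add: fun_eq_iff bseq_cmult)
  then show ?thesis
    using lq_cmult[OF q, of "bseq u" "cmod a"] assms
    by (simp add: BV_def BN_def Lp_space_cmult)
qed

lemma BV_zero: "(\<lambda>x. 0) \<in> BV"
proof -
  have "bseq (\<lambda>x. 0) k \<le> 0" for k using bseq_le_norm[of "\<lambda>x. 0" k] by simp
  then have "bseq (\<lambda>x. 0) = (\<lambda>k. 0)" by (simp add: fun_eq_iff antisym)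
  then show ?thesis by (simp add: BV_def lq_fin_def)
qed

lemma BN_eq_0_iff:
  assumes u: "u \<in> BV"
  shows "BN u = 0 \<longleftrightarrow> (AE x in LI. u x = 0)"
proof
  assume "BN u = 0"
  then have "Lp_norm LI p u = 0" using Lp_norm_le_BN[OF u] by (simp add: antisym)
  then show "AE x in LI. u x = 0" by (intro Lp_norm_eq_0_AE[OF p] BVD(1) u)
next
  assume "AE x in LI. u x = 0"
  then have "Lp_norm LI p u = Lp_norm LI p (\<lambda>x. 0)"
    by (intro Lp_norm_cong_AE) (auto intro: Lp_spaceD(1)[OF BVD(1)[OF u]])
  then have "bseq u k \<le> 0" for k using bseq_le_norm[OF BVD(1)[OF u], of k] by simp
  then have "bseq u = (\<lambda>k. 0)" by (simp add: fun_eq_iff antisym)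
  then show "BN u = 0" by (simp add: BN_def lq_norm_def)
qed

text \<open>The limit w exists in L^p. Blocks of the series obey geometric bounds in
  \<open>BN\<close>, each entry of \<open>bseq\<close> is continuous in L^p, and
  \<open>lq_Fatou\<close> transfers the bounds to the tails w - S J.\<close>

lemma BV_complete:
  assumes uV: "\<And>j. u j \<in> BV" and le: "\<And>j::nat. BN (u j) \<le> C * \<rho> ^ j" and \<rho>: "0 < \<rho>" "\<rho> < 1"
  shows "\<exists>w\<in>BV. (\<lambda>n. BN (\<lambda>x. w x - (\<Sum>j<n. u j x))) \<longlonglongrightarrow> 0"
proof -
  have uL: "u j \<in> Lp_space LI p" for j by (rule BVD(1)[OF uV])
  have C: "C \<ge> 0" using le[of 0] BN_nonneg[OF uV, of 0] by simp
  obtain w where w: "w \<in> Lp_space LI p" and lim: "(\<lambda>n. Lp_norm LI p (\<lambda>x. w x - (\<Sum>j<n. u j x))) \<longlonglongrightarrow> 0"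
    using Lp_complete_geometric[where v = u and \<rho> = \<rho> and C = C and M = LI and p = p, OF p uL \<rho>]
      order_trans[OF Lp_norm_le_BN[OF uV] le] by blast
  define S where "S n = (\<lambda>x. \<Sum>j<n. u j x)" for n
  have SL: "S n \<in> Lp_space LI p" for n unfolding S_def by (intro Lp_space_sum p uL)
  have rest: "(\<lambda>x. \<Sum>j\<in>{J..<J+n}. u j x) \<in> BV \<and> BN (\<lambda>x. \<Sum>j\<in>{J..<J+n}. u j x) \<le> C * \<rho> ^ J / (1 - \<rho>)" for J n
  proof -
    have "(\<lambda>x. \<Sum>j\<in>{J..<J+n}. u j x) \<in> BV \<and> BN (\<lambda>x. \<Sum>j\<in>{J..<J+n}. u j x) \<le> (\<Sum>j\<in>{J..<J+n}. C * \<rho> ^ j)"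
    proof (induction n)
      case 0
      then show ?case using BV_zero BN_eq_0_iff[OF BV_zero] by simp
    next
      case (Suc n)
      then have "(\<lambda>x. (\<Sum>j\<in>{J..<J+n}. u j x) + u (J + n) x) \<in> BV \<and>
         BN (\<lambda>x. (\<Sum>j\<in>{J..<J+n}. u j x) + u (J + n) x) \<le> (\<Sum>j\<in>{J..<J+n}. C * \<rho> ^ j) + C * \<rho> ^ (J + n)"
        using BV_BN_add[of "\<lambda>x. \<Sum>j\<in>{J..<J+n}. u j x" "u (J + n)"] uV le[of "J + n"] by force
      then show ?case by simp
    qed
    moreover have "(\<Sum>j\<in>{J..<J+n}. C * \<rho> ^ j) \<le> C * \<rho> ^ J / (1 - \<rho>)"
    proof -
      have "(\<Sum>j\<in>{J..<J+n}. C * \<rho> ^ j) = (\<Sum>j<n. C * \<rho> ^ (J + j))"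
        using sum.shift_bounds_nat_ivl[of "\<lambda>j. C * \<rho> ^ j" 0 J n] by (simp add: lessThan_atLeast0 add.commute)
      also have "\<dots> = C * \<rho> ^ J * (\<Sum>j<n. \<rho> ^ j)" by (simp add: power_add sum_distrib_left mult.assoc)
      also have "\<dots> \<le> C * \<rho> ^ J * (1 / (1 - \<rho>))"
        using C \<rho> sum_le_suminf[of "\<lambda>j. \<rho> ^ j" "{..<n}"] by (intro mult_left_mono) (auto simp: suminf_geometric)
      finally show ?thesis by simp
    qed
    ultimately show ?thesis by linarith
  qed
  have tail: "(\<lambda>x. w x - S J x) \<in> BV \<and> BN (\<lambda>x. w x - S J x) \<le> C * \<rho> ^ J / (1 - \<rho>)" for J
  proof -
    \<comment> \<open>For growing n these blocks converge to w - S J in L^p, the difference being w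
      - S (J + n).\<close>
    define r where "r n = (\<lambda>x. \<Sum>j\<in>{J..<J+n}. u j x)" for n
    have rS: "r n = (\<lambda>x. (w x - S J x) - (w x - S (J + n) x))" for n
      by (simp add: r_def S_def fun_eq_iff sum_diff_nat_ivl[of 0] lessThan_atLeast0)
    have wS: "(\<lambda>x. w x - S J x) \<in> Lp_space LI p" for J by (intro Lp_space_diff p w SL)
    have rL: "r n \<in> Lp_space LI p" for n unfolding r_def by (intro Lp_space_sum p uL)
    have "lq_fin q (bseq (\<lambda>x. w x - S J x)) \<and> lq_norm q (bseq (\<lambda>x. w x - S J x)) \<le> C * \<rho> ^ J / (1 - \<rho>)"
    proof (rule lq_Fatou[OF q, where x = "\<lambda>n. bseq (r n)"])
      fix k
      have "(\<lambda>n. bseq (r n) k - bseq (\<lambda>x. w x - S J x) k) \<longlonglongrightarrow> 0"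
      proof (rule Lim_null_comparison)
        have "(\<lambda>n. 2 powr (real k * s) * (2 * Lp_norm LI p (\<lambda>x. w x - S (n + J) x))) \<longlonglongrightarrow> 2 powr (real k * s) * (2 * 0)"
          by (intro tendsto_mult tendsto_const LIMSEQ_ignore_initial_segment lim[folded S_def]) (use lim in \<open>simp add: S_def\<close>)
        then show "(\<lambda>n. 2 powr (real k * s) * (2 * Lp_norm LI p (\<lambda>x. w x - S (J + n) x))) \<longlonglongrightarrow> 0"
          by (simp add: add.commute)
        have "norm (bseq (r n) k - bseq (\<lambda>x. w x - S J x) k) \<le> 2 powr (real k * s) * (2 * Lp_norm LI p (\<lambda>x. w x - S (J + n) x))" for n
        proof -
          let ?d = "\<lambda>x. w x - S (J + n) x"
          have "(\<lambda>x. w x - S J x) = (\<lambda>x. r n x + ?d x)" by (simp add: rS)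
          then have 1: "bseq (\<lambda>x. w x - S J x) k \<le> bseq (r n) k + bseq ?d k"
            using bseq_add[OF rL wS[of "J + n"], of n k] by simp
          have "r n = (\<lambda>x. (w x - S J x) + (-1) * ?d x)" by (simp add: rS)
          then have 2: "bseq (r n) k \<le> bseq (\<lambda>x. w x - S J x) k + bseq ?d k"
            using bseq_add[OF wS[of J] Lp_space_cmult[OF wS[of "J + n"], of "-1"], of k] bseq_cmult[of "-1" ?d k] by simp
          show ?thesis using 1 2 bseq_le_norm[OF wS[of "J + n"], of k] by (simp add: abs_le_iff)
        qed
        then show "\<forall>\<^sub>F n in sequentially. norm (bseq (r n) k - bseq (\<lambda>x. w x - S J x) k) \<le> 2 powr (real k * s) * (2 * Lp_norm LI p (\<lambda>x. w x - S (J + n) x))"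
          by simp
      qed
      then show "(\<lambda>n. bseq (r n) k) \<longlonglongrightarrow> bseq (\<lambda>x. w x - S J x) k" by (rule LIM_zero_cancel)
    qed (use rest[of J] in \<open>auto simp: r_def BV_def BN_def\<close>)
    then show ?thesis using wS[of J] by (auto simp: BV_def BN_def)
  qed
  have "w \<in> BV" using tail[of 0] by (simp add: S_def)
  moreover have "(\<lambda>n. BN (\<lambda>x. w x - S n x)) \<longlonglongrightarrow> 0"
  proof (rule Lim_null_comparison)
    have "(\<lambda>n. (C / (1 - \<rho>)) * \<rho> ^ n) \<longlonglongrightarrow> (C / (1 - \<rho>)) * 0"
      using \<rho> by (intro tendsto_mult tendsto_const LIMSEQ_realpow_zero) auto
    then show "(\<lambda>n. C * \<rho> ^ n / (1 - \<rho>)) \<longlonglongrightarrow> 0" by simp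
    show "\<forall>\<^sub>F n in sequentially. norm (BN (\<lambda>x. w x - S n x)) \<le> C * \<rho> ^ n / (1 - \<rho>)"
      using tail BN_nonneg by (intro always_eventually allI) (metis real_norm_def abs_of_nonneg)
  qed
  ultimately show ?thesis by (auto simp: S_def)
qed

sublocale complete_function_space LI BV BN
proof
  show "\<And>u C \<rho>. \<lbrakk>\<And>j. u j \<in> BV; \<And>j::nat. BN (u j) \<le> C * \<rho> ^ j; 0 < \<rho>; \<rho> < 1\<rbrakk> \<Longrightarrow>
      \<exists>v\<in>BV. (\<lambda>n. BN (\<lambda>x. v x - (\<Sum>j<n. u j x))) \<longlonglongrightarrow> 0"
    by (rule BV_complete)
qed (auto simp: BV_zero BV_BN_add BV_BN_cmult BN_nonneg BN_eq_0_iff)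

definition \<rho> :: real where "\<rho> = 2 powr (- s)"

lemma \<rho>: "0 < \<rho>" "\<rho> < 1"
  using s by (auto simp: \<rho>_def powr_less_one)

text \<open>The first i layers form a step function of shifted level i, so the error at level i is
  at most twice the norm of the remaining layers, whose sizes \<open>besov_layer_norm\<close> gives.
  The ratio of the weights at levels i and k produces the geometric kernel.\<close>

lemma BN_le_besov_cost:
  assumes u: "u \<in> Lp_space LI p" and rep: "besov_represents LI dyadic_grid s p c u"
    and fin: "besov_cost_finite dyadic_grid p q c"
  shows "u \<in> BV \<and> BN u \<le> 2 * 2 powr s * (2 / (1 - \<rho>)) * besov_cost dyadic_grid p q c"
proof -
  let ?g = "besov_layer s p c" and ?l = "besov_level dyadic_grid p c"
  have lim: "(\<lambda>n. Lp_norm LI p (\<lambda>x. u x - (\<Sum>k<n. ?g k x))) \<longlonglongrightarrow> 0"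
    using rep by (simp add: besov_represents_def besov_layer_def)
  have l0: "?l k \<ge> 0" for k by (simp add: besov_level_def)
  have lf: "lq_fin q ?l" using fin by (simp add: lq_fin_def besov_cost_finite_def)
  have cost: "besov_cost dyadic_grid p q c = lq_norm q ?l" by (simp add: lq_norm_def besov_cost_def)
  have gL: "?g k \<in> Lp_space LI p" for k by (rule dstep_Lp[OF p besov_layer_dstep])
  have "lq_fin q (bseq u) \<and> lq_norm q (bseq u) \<le> 2 * 2 powr s * (2 / (1 - \<rho>)) * lq_norm q ?l"
  proof (rule lq_schur_geometric[where m = 0, OF q \<rho> _ l0 lf])
    fix i :: nat and e :: real assume "e > 0"
    \<comment> \<open>Chosen so that the factor 2 of \<open>aerr_le\<close> and the weight of level
      i turn it into exactly e.\<close>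
    define \<epsilon> where "\<epsilon> = e / (2 * 2 powr (real i * s))"
    have "\<epsilon> > 0" using \<open>e > 0\<close> by (simp add: \<epsilon>_def)
    then have "eventually (\<lambda>n. Lp_norm LI p (\<lambda>x. u x - (\<Sum>k<n. ?g k x)) < \<epsilon>) sequentially"
      using lim by (auto dest!: order_tendstoD(2))
    then obtain n0 where n0: "\<And>n. n \<ge> n0 \<Longrightarrow> Lp_norm LI p (\<lambda>x. u x - (\<Sum>k<n. ?g k x)) < \<epsilon>"
      unfolding eventually_sequentially by blast
    define n where "n = max i n0"
    have n: "n \<ge> i" "Lp_norm LI p (\<lambda>x. u x - (\<Sum>k<n. ?g k x)) < \<epsilon>"
      using n0[of n] by (auto simp: n_def)
    have sL: "(\<lambda>x. \<Sum>k\<in>S. ?g k x) \<in> Lp_space LI p" for S by (intro Lp_space_sum p gL)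
    have "aerr p i u \<le> 2 * Lp_norm LI p (\<lambda>x. u x - (\<Sum>k<i. ?g k x))"
      by (intro aerr_le p u dstep_sum dstep_mono[OF _ besov_layer_dstep]) auto
    also have "(\<lambda>x. u x - (\<Sum>k<i. ?g k x)) = (\<lambda>x. (u x - (\<Sum>k<n. ?g k x)) + (\<Sum>k\<in>{i..<n}. ?g k x))"
      using n(1) by (simp add: fun_eq_iff lessThan_atLeast0 flip: sum.atLeastLessThan_concat[of 0 i n])
    also have "Lp_norm LI p \<dots> \<le> Lp_norm LI p (\<lambda>x. u x - (\<Sum>k<n. ?g k x)) + Lp_norm LI p (\<lambda>x. \<Sum>k\<in>{i..<n}. ?g k x)"
      by (intro Lp_norm_triangle Lp_space_diff p u sL)
    also have "\<dots> \<le> \<epsilon> + (\<Sum>k\<in>{i..<n}. Lp_norm LI p (?g k))"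
      using n(2) by (intro add_mono Lp_norm_sum p gL) auto
    finally have "bseq u i \<le> 2 powr (real i * s) * (2 * (\<epsilon> + (\<Sum>k\<in>{i..<n}. Lp_norm LI p (?g k))))"
      unfolding bseq_def by (intro mult_left_mono) auto
    also have "\<dots> = e + (\<Sum>k\<in>{i..<n}. 2 * 2 powr (real i * s) * Lp_norm LI p (?g k))"
      by (simp add: \<epsilon>_def distrib_left sum_distrib_left mult.assoc mult.left_commute)
    also have "(\<Sum>k\<in>{i..<n}. 2 * 2 powr (real i * s) * Lp_norm LI p (?g k))
        = (\<Sum>k\<in>{i..<n}. 2 * 2 powr s * \<rho> ^ nat \<bar>int k - (int i + 0)\<bar> * ?l k)"
    proof (rule sum.cong[OF refl])
      fix k assume k: "k \<in> {i..<n}"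
      have "\<rho> ^ nat \<bar>int k - (int i + 0)\<bar> = 2 powr (- s * (real k - real i))"
        using k by (simp add: \<rho>_def powr_powr flip: powr_realpow add: of_nat_diff nat_diff_distrib)
      moreover have "(2 / 2 ^ k) powr s = 2 powr ((1 - real k) * s)"
        by (simp add: powr_powr[symmetric] powr_diff powr_realpow)
      ultimately show "2 * 2 powr (real i * s) * Lp_norm LI p (?g k) = 2 * 2 powr s * \<rho> ^ nat \<bar>int k - (int i + 0)\<bar> * ?l k"
        unfolding besov_layer_norm[OF p] by (simp add: algebra_simps flip: powr_add)
    qed
    also have "\<dots> \<le> (\<Sum>k<n. 2 * 2 powr s * \<rho> ^ nat \<bar>int k - (int i + 0)\<bar> * ?l k)"
      using l0 \<rho> by (intro sum_mono2) auto
    finally show "\<exists>n. bseq u i \<le> (\<Sum>k<n. 2 * 2 powr s * \<rho> ^ nat \<bar>int k - (int i + 0)\<bar> * ?l k) + e"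
      by (intro exI[of _ n]) linarith
  qed auto
  then show ?thesis using u by (simp add: BV_def BN_def cost)
qed

text \<open>Use the jumps between consecutive conditional expectations as layers. They telescope to
  \<open>cexp n u\<close>, whose error decays like \<rho>^n.\<close>

lemma besov_representation_exists:
  assumes u: "u \<in> BV"
  shows "\<exists>c. besov_represents LI dyadic_grid s p c u \<and> besov_cost_finite dyadic_grid p q c \<and>
    besov_cost dyadic_grid p q c \<le> 1 / \<rho> * (2 / (1 - \<rho>)) * BN u"
proof -
  have uL: "u \<in> Lp_space LI p" by (rule BVD(1)[OF u])
  define h where "h k = (\<lambda>x. cexp (Suc k) u x - cexp k u x)" for k
  have hd: "dstep (Suc k) (h k)" for k
    unfolding h_def by (intro dstep_diff dstep_Suc dstep_cexp)
  \<comment> \<open>The jump is constant on Q, so any point of Q gives its value; the power cancels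
    the normalisation of the atom.\<close>
  define c where "c k Q = h k (SOME x. x \<in> Q) * of_real ((2 / 2 ^ k) powr (1 / p - s))" for k Q
  have layer: "besov_layer s p c k x = h k x" if x: "x \<in> {-1..1}" for k x
  proof -
    define y where "y = (SOME y. y \<in> dyadic_cell k (didx k x))"
    have "x \<in> dyadic_cell k (didx k x)" using x by (simp add: dyadic_cell_eq)
    then have "y \<in> dyadic_cell k (didx k x)" unfolding y_def by (rule someI)
    then have y: "y \<in> {-1..1}" "didx k y = didx k x" by (auto simp: dyadic_cell_eq)
    obtain a where "\<forall>x\<in>{-1..1}. h k x = a (didx k x)" using hd[of k] by auto
    then have "h k y = h k x" using x y by simp
    moreover have "((2 / 2 ^ k) powr (1 / p - s)) * ((2 / 2 ^ k) powr (s - 1 / p)) = (1 :: real)"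
      by (simp flip: powr_add)
    ultimately show ?thesis
      unfolding besov_layer_eq[OF x] c_def y_def[symmetric] mult.assoc of_real_mult[symmetric] by simp
  qed
  have tel: "(\<Sum>k<n. besov_layer s p c k x) = cexp n u x" if "x \<in> {-1..1}" for n x
    using that by (induction n) (auto simp: layer h_def simp del: cexp.simps(2))
  have "(\<lambda>n. aerr p n u) \<longlonglongrightarrow> 0"
  proof (rule Lim_null_comparison)
    have "(\<lambda>n. \<rho> ^ n * BN u) \<longlonglongrightarrow> 0 * BN u"
      using \<rho> by (intro tendsto_mult tendsto_const LIMSEQ_realpow_zero) auto
    then show "(\<lambda>n. \<rho> ^ n * BN u) \<longlonglongrightarrow> 0" by simp
    have "aerr p n u = \<rho> ^ n * bseq u n" for n
    proof -
      have "\<rho> ^ n * 2 powr (real n * s) = 1"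
        by (simp add: \<rho>_def powr_powr mult.commute flip: powr_realpow powr_add)
      then show ?thesis by (simp add: bseq_def flip: mult.assoc)
    qed
    then show "\<forall>\<^sub>F n in sequentially. norm (aerr p n u) \<le> \<rho> ^ n * BN u"
      using bseq_le_BN[OF u] \<rho> by (intro always_eventually allI) (simp add: mult_left_mono)
  qed
  moreover have "aerr p n u = Lp_norm LI p (\<lambda>x. u x - (\<Sum>k<n. besov_layer s p c k x))" for n
    unfolding aerr_def by (rule Lp_norm_LI_cong) (simp add: tel)
  ultimately have rep: "besov_represents LI dyadic_grid s p c u"
    by (simp add: besov_represents_def besov_layer_def)
  let ?l = "besov_level dyadic_grid p c"
  have "lq_fin q ?l \<and> lq_norm q ?l \<le> 1 / \<rho> * (2 / (1 - \<rho>)) * lq_norm q (bseq u)"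
  proof (rule lq_schur_geometric[where m = 0, OF q \<rho> _ bseq_nonneg BVD(2)[OF u]])
    show "?l i \<ge> 0" for i by (simp add: besov_level_def)
    fix i :: nat and e :: real assume "e > 0"
    have "(2 / 2 ^ i) powr s * ?l i = Lp_norm LI p (h i)"
      unfolding besov_layer_norm[OF p, symmetric] by (rule Lp_norm_LI_cong) (rule layer)
    also have "\<dots> \<le> aerr p i u + aerr p (Suc i) u"
      unfolding h_def by (rule cexp_jump_le[OF p uL])
    finally have "2 powr (real i * s) * ((2 / 2 ^ i) powr s * ?l i) \<le> 2 powr (real i * s) * (aerr p i u + aerr p (Suc i) u)"
      by (rule mult_left_mono) simp
    also have "\<dots> = bseq u i + \<rho> * bseq u (Suc i)"
      by (simp add: bseq_def \<rho>_def algebra_simps flip: powr_add mult.assoc)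
    also have "2 powr (real i * s) * ((2 / 2 ^ i) powr s * ?l i) = 2 powr s * ?l i"
    proof -
      have "(2 / 2 ^ i) powr s = 2 powr ((1 - real i) * s)"
        by (simp add: powr_powr[symmetric] powr_diff powr_realpow)
      then show ?thesis by (simp add: algebra_simps flip: powr_add mult.assoc)
    qed
    finally have "1 * ?l i \<le> bseq u i + \<rho> * bseq u (Suc i)"
      using s by (intro order_trans[OF mult_right_mono[of 1 "2 powr s"]]) (auto simp: besov_level_def ge_one_powr_ge_zero)
    \<comment> \<open>The kernel (1/\<rho>) \<rho>^|k-i| equals 1/\<rho> at k = i and 1 at k = i +
      1, so it dominates both coefficients.\<close>
    also have "\<dots> \<le> 1 / \<rho> * bseq u i + bseq u (Suc i)"
    proof (rule add_mono)
      have "1 * bseq u i \<le> 1 / \<rho> * bseq u i" using \<rho> by (intro mult_right_mono) auto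
      then show "bseq u i \<le> 1 / \<rho> * bseq u i" by simp
      show "\<rho> * bseq u (Suc i) \<le> bseq u (Suc i)" using \<rho> by (intro mult_left_le_one_le) auto
    qed
    also have "\<dots> = (\<Sum>k\<in>{i, Suc i}. 1 / \<rho> * \<rho> ^ nat \<bar>int k - (int i + 0)\<bar> * bseq u k)"
      using \<rho> by simp
    also have "\<dots> \<le> (\<Sum>k<Suc (Suc i). 1 / \<rho> * \<rho> ^ nat \<bar>int k - (int i + 0)\<bar> * bseq u k)"
      using \<rho> by (intro sum_mono2) auto
    finally show "\<exists>n. ?l i \<le> (\<Sum>k<n. 1 / \<rho> * \<rho> ^ nat \<bar>int k - (int i + 0)\<bar> * bseq u k) + e"
      using \<open>e > 0\<close> by (intro exI[of _ "Suc (Suc i)"]) linarith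
  qed (use \<rho> in auto)
  then show ?thesis using rep
    by (intro exI[of _ c]) (simp add: lq_fin_def lq_norm_def besov_cost_finite_def besov_cost_def BN_def)
qed

lemma besov_space_eq_BV: "besov_space LI dyadic_grid s p q = BV"
  using BN_le_besov_cost besov_representation_exists BVD(1) by (fastforce simp: besov_space_def)

lemma besov_norm_le:
  assumes u: "u \<in> BV"
  shows "besov_norm LI dyadic_grid s p q u \<le> 1 / \<rho> * (2 / (1 - \<rho>)) * BN u"
proof -
  obtain c where c: "besov_represents LI dyadic_grid s p c u" "besov_cost_finite dyadic_grid p q c"
    "besov_cost dyadic_grid p q c \<le> 1 / \<rho> * (2 / (1 - \<rho>)) * BN u"
    using besov_representation_exists[OF u] by blast
  have "besov_norm LI dyadic_grid s p q u \<le> besov_cost dyadic_grid p q c"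
    unfolding besov_norm_def
  proof (rule cInf_lower)
    show "bdd_below {besov_cost dyadic_grid p q c |c. besov_represents LI dyadic_grid s p c u \<and> besov_cost_finite dyadic_grid p q c}"
    proof (rule bdd_belowI[of _ 0], clarify)
      fix c assume "besov_cost_finite dyadic_grid p q c"
      then show "0 \<le> besov_cost dyadic_grid p q c"
        using lq_norm_nonneg[of "besov_level dyadic_grid p c" q]
        by (simp add: lq_fin_def lq_norm_def besov_cost_finite_def besov_cost_def besov_level_def)
    qed
  qed (use c in blast)
  then show ?thesis using c(3) by linarith
qed

lemma BN_le_besov_norm:
  assumes u: "u \<in> BV"
  shows "BN u \<le> 2 * 2 powr s * (2 / (1 - \<rho>)) * besov_norm LI dyadic_grid s p q u"
proof -
  have K: "2 * 2 powr s * (2 / (1 - \<rho>)) > 0" using \<rho> by simp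
  have "BN u / (2 * 2 powr s * (2 / (1 - \<rho>))) \<le> besov_norm LI dyadic_grid s p q u"
    unfolding besov_norm_def
  proof (rule cInf_greatest)
    show "{besov_cost dyadic_grid p q c |c. besov_represents LI dyadic_grid s p c u \<and> besov_cost_finite dyadic_grid p q c} \<noteq> {}"
      using besov_representation_exists[OF u] by blast
    fix a assume "a \<in> {besov_cost dyadic_grid p q c |c. besov_represents LI dyadic_grid s p c u \<and> besov_cost_finite dyadic_grid p q c}"
    then obtain c where c: "a = besov_cost dyadic_grid p q c" "besov_represents LI dyadic_grid s p c u" "besov_cost_finite dyadic_grid p q c"
      by blast
    have "BN u \<le> 2 * 2 powr s * (2 / (1 - \<rho>)) * a"
      using BN_le_besov_cost[OF BVD(1)[OF u] c(2,3)] c(1) by simp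
    then show "BN u / (2 * 2 powr s * (2 / (1 - \<rho>))) \<le> a"
      by (subst pos_divide_le_eq[OF K]) (simp only: mult.commute)
  qed
  then show ?thesis using K by (subst (asm) pos_divide_le_eq[OF K]) (simp only: mult.commute)
qed

end

section \<open>Itineraries and entropy of the tent map\<close>

lemma abs_diff_le_2: "a \<in> {-1..1} \<Longrightarrow> b \<in> {-1..1} \<Longrightarrow> \<bar>a - b\<bar> \<le> (2 :: real)"
  unfolding atLeastAtMost_iff by linarith

locale tent_map =
  fixes t :: real
  assumes t: "1 / 2 < t" "t \<le> 1"
begin

definition lam :: real where "lam = 2 * t"

abbreviation f :: "real \<Rightarrow> real" where "f \<equiv> tent t"

lemma lam: "1 < lam" "lam \<le> 2" "0 < lam" using t by (auto simp: lam_def)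

lemma lam_power_pos [simp]: "lam ^ n > 0" using lam by simp

lemma lam_power_ge_1: "lam ^ n \<ge> 1" using lam by (intro one_le_power) auto

lemma tent_eq: "f x = lam * (1 - \<bar>x\<bar>) - 1"
  by (simp add: tent_def lam_def algebra_simps)

lemma tent_mem: "x \<in> {-1..1} \<Longrightarrow> f x \<in> {-1..1}"
proof -
  assume "x \<in> {-1..1}"
  then have "0 \<le> 1 - \<bar>x\<bar>" "1 - \<bar>x\<bar> \<le> 1" by auto
  then have "0 \<le> lam * (1 - \<bar>x\<bar>)" "lam * (1 - \<bar>x\<bar>) \<le> lam * 1"
    using lam by (blast intro: mult_nonneg_nonneg mult_left_mono less_imp_le)+
  then show ?thesis unfolding tent_eq atLeastAtMost_iff using lam by linarith
qed

lemma iter_mem: "x \<in> {-1..1} \<Longrightarrow> (f ^^ n) x \<in> {-1..1}"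
  by (induction n) (auto intro!: tent_mem simp del: atLeastAtMost_iff)

lemma tent_lipschitz: "\<bar>f x - f y\<bar> \<le> lam * \<bar>x - y\<bar>"
proof -
  have "f x - f y = lam * (\<bar>y\<bar> - \<bar>x\<bar>)" by (simp add: tent_eq algebra_simps)
  then have "\<bar>f x - f y\<bar> = lam * \<bar>\<bar>y\<bar> - \<bar>x\<bar>\<bar>" using lam by (simp add: abs_mult)
  also have "\<dots> \<le> lam * \<bar>x - y\<bar>" using lam by (intro mult_left_mono) auto
  finally show ?thesis .
qed

lemma iter_lipschitz: "\<bar>(f ^^ n) x - (f ^^ n) y\<bar> \<le> lam ^ n * \<bar>x - y\<bar>"
proof (induction n)
  case (Suc n)
  have "\<bar>(f ^^ Suc n) x - (f ^^ Suc n) y\<bar> \<le> lam * \<bar>(f ^^ n) x - (f ^^ n) y\<bar>" by (simp add: tent_lipschitz)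
  also have "\<dots> \<le> lam * (lam ^ n * \<bar>x - y\<bar>)" using Suc lam by (intro mult_left_mono) auto
  finally show ?case by (simp add: mult.assoc)
qed auto

lemma continuous_iter: "continuous_on S (f ^^ n)"
proof -
  have "continuous_on UNIV (f ^^ n)"
  proof (induction n)
    case (Suc n)
    have "continuous_on UNIV (\<lambda>x. lam * (1 - \<bar>(f ^^ n) x\<bar>) - 1)"
      using Suc by (intro continuous_intros) auto
    moreover have "(f ^^ Suc n) = (\<lambda>x. lam * (1 - \<bar>(f ^^ n) x\<bar>) - 1)"
      using tent_eq by auto
    ultimately show ?case by (simp only:)
  qed (auto simp: id_def)
  then show ?thesis by (rule continuous_on_subset) simp
qed

text \<open>Points with equal itinerary form one lap of f^n, the turning point counting as right of
  itself. Coding the signs as a finite set of times makes the number of laps meeting Y the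
  cardinality of an image.\<close>

definition itin :: "nat \<Rightarrow> real \<Rightarrow> nat set" where
  "itin n y = {i. i < n \<and> (f ^^ i) y \<ge> 0}"

lemma itin_0 [simp]: "itin 0 y = {}" by (simp add: itin_def)

lemma itin_subset: "itin n y \<subseteq> {..<n}" by (auto simp: itin_def)

lemma finite_itin_image [simp]: "finite (itin n ` Y)"
  by (rule finite_subset[of _ "Pow {..<n}"]) (use itin_subset in auto)

lemma itin_add: "itin (n + m) y = itin n y \<union> (+) n ` itin m ((f ^^ n) y)"
proof -
  have "i \<in> itin (n + m) y \<longleftrightarrow> i \<in> itin n y \<union> (+) n ` itin m ((f ^^ n) y)" for i
  proof (cases "i < n")
    case False
    then obtain j where "i = n + j" by (metis le_add_diff_inverse not_less)
    then show ?thesis by (auto simp: itin_def funpow_add add.commute)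
  qed (auto simp: itin_def)
  then show ?thesis by blast
qed

text \<open>Affinity and convexity have to be proved together: the sign condition at time n cuts a
  lap by a half line because f^n is affine there.\<close>

lemma itin_affine:
  "\<exists>\<alpha> \<beta>. \<bar>\<beta>\<bar> = lam ^ n \<and> (\<forall>y. itin n y = A \<longrightarrow> (f ^^ n) y = \<alpha> + \<beta> * y) \<and> convex {y. itin n y = A}"
proof (induction n arbitrary: A)
  case 0
  then show ?case by (intro exI[of _ 0] exI[of _ 1]) auto
next
  case (Suc n)
  obtain \<alpha> \<beta> where ab: "\<bar>\<beta>\<bar> = lam ^ n" "\<And>y. itin n y = A - {n} \<Longrightarrow> (f ^^ n) y = \<alpha> + \<beta> * y"
    "convex {y. itin n y = A - {n}}" using Suc[of "A - {n}"] by blast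
  have split: "itin (Suc n) y = A \<Longrightarrow> itin n y = A - {n} \<and> ((f ^^ n) y \<ge> 0 \<longleftrightarrow> n \<in> A)" for y
    by (auto simp: itin_def)
  \<comment> \<open>The sign of the slope of the branch used at time n.\<close>
  define \<sigma> :: real where "\<sigma> = (if n \<in> A then -1 else 1)"
  have "(f ^^ Suc n) y = (lam + \<sigma> * lam * \<alpha> - 1) + (\<sigma> * lam * \<beta>) * y" if "itin (Suc n) y = A" for y
  proof -
    have "f z = lam + \<sigma> * lam * z - 1" if "z \<ge> 0 \<longleftrightarrow> n \<in> A" for z
      unfolding tent_eq \<sigma>_def using that by (cases "n \<in> A") (simp_all add: right_diff_distrib distrib_left)
    moreover have "(f ^^ n) y \<ge> 0 \<longleftrightarrow> n \<in> A" "(f ^^ n) y = \<alpha> + \<beta> * y"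
      using split[OF that] ab(2)[of y] by blast+
    ultimately have "(f ^^ Suc n) y = lam + \<sigma> * lam * (\<alpha> + \<beta> * y) - 1" by simp
    then show ?thesis by (simp add: algebra_simps)
  qed
  moreover have "\<bar>\<sigma> * lam * \<beta>\<bar> = lam ^ Suc n" using ab(1) lam by (simp add: abs_mult \<sigma>_def)
  moreover have "convex {y. itin (Suc n) y = A}"
  proof (cases "A \<subseteq> {..<Suc n}")
    case True
    have "itin (Suc n) y = A \<longleftrightarrow> itin n y = A - {n} \<and> ((f ^^ n) y \<ge> 0 \<longleftrightarrow> n \<in> A)" for y
      using True by (auto simp: itin_def less_Suc_eq)
    then have "itin (Suc n) y = A \<longleftrightarrow> itin n y = A - {n} \<and> (\<alpha> + \<beta> * y \<ge> 0 \<longleftrightarrow> n \<in> A)" for y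
      using ab(2)[of y] by metis
    then have "{y. itin (Suc n) y = A} = {y. itin n y = A - {n}} \<inter> {y. \<alpha> + \<beta> * y \<ge> 0 \<longleftrightarrow> n \<in> A}" by auto
    moreover have "convex {y. \<alpha> + \<beta> * y \<ge> 0 \<longleftrightarrow> n \<in> A}"
    proof (cases "n \<in> A")
      case True
      then have "{y. \<alpha> + \<beta> * y \<ge> 0 \<longleftrightarrow> n \<in> A} = {y. inner \<beta> y \<ge> - \<alpha>}" by auto
      then show ?thesis by (simp only: convex_halfspace_ge)
    next
      case False
      then have "{y. \<alpha> + \<beta> * y \<ge> 0 \<longleftrightarrow> n \<in> A} = {y. inner \<beta> y < - \<alpha>}" by auto
      then show ?thesis by (simp only: convex_halfspace_lt)
    qed
    ultimately show ?thesis using ab(3) by (simp add: convex_Int)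
  next
    case False
    then have "{y. itin (Suc n) y = A} = {}" using itin_subset by blast
    then show ?thesis by simp
  qed
  ultimately show ?case by blast
qed

lemma itin_expand:
  assumes "itin n x = itin n y"
  shows "\<bar>(f ^^ n) x - (f ^^ n) y\<bar> = lam ^ n * \<bar>x - y\<bar>"
proof -
  obtain \<alpha> \<beta> where ab: "\<bar>\<beta>\<bar> = lam ^ n" "\<And>z. itin n z = itin n y \<Longrightarrow> (f ^^ n) z = \<alpha> + \<beta> * z"
    using itin_affine[of n "itin n y"] by blast
  have "(f ^^ n) x - (f ^^ n) y = \<beta> * (x - y)" using ab(2)[of x] ab(2)[of y] assms by (simp add: algebra_simps)
  then show ?thesis using ab(1) by (simp add: abs_mult)
qed

lemma itin_inj:
  assumes "itin n x = itin n y" "(f ^^ n) x = (f ^^ n) y"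
  shows "x = y"
  using itin_expand[OF assms(1)] assms(2) lam by simp

lemma finite_fibre: "finite {y. (f ^^ n) y = z}"
proof (rule finite_imageD)
  show "finite (itin n ` {y. (f ^^ n) y = z})" by simp
  show "inj_on (itin n) {y. (f ^^ n) y = z}" by (rule inj_onI) (auto intro: itin_inj)
qed

lemma itin_change:
  assumes "x \<le> y" "itin n x \<noteq> itin n y"
  shows "\<exists>z i. i < n \<and> (f ^^ i) z = 0 \<and> x \<le> z \<and> z \<le> y"
proof -
  obtain i where i: "i < n" "((f ^^ i) x \<ge> 0) \<noteq> ((f ^^ i) y \<ge> 0)"
    using assms(2) by (auto simp: itin_def)
  have c: "continuous_on {x..y} (f ^^ i)" by (rule continuous_iter)
  have "\<exists>z. x \<le> z \<and> z \<le> y \<and> (f ^^ i) z = 0"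
  proof (cases "(f ^^ i) x \<ge> 0")
    case True
    then show ?thesis using IVT2'[of "f ^^ i" y 0 x] i c assms(1) by auto
  next
    case False
    then show ?thesis using IVT'[of "f ^^ i" x 0 y] i c assms(1) by auto
  qed
  then show ?thesis using i by blast
qed

lemma finite_gap:
  fixes Z :: "real set"
  assumes "finite Z"
  shows "\<exists>\<epsilon>>0. \<forall>z\<in>Z. \<forall>z'\<in>Z. \<bar>z - z'\<bar> \<le> \<epsilon> \<longrightarrow> z = z'"
proof -
  define G where "G = insert 1 ((\<lambda>(z, z'). \<bar>z - z'\<bar>) ` {(z, z'). z \<in> Z \<and> z' \<in> Z \<and> z \<noteq> z'})"
  have "finite {(z, z'). z \<in> Z \<and> z' \<in> Z \<and> z \<noteq> z'}"
    by (rule finite_subset[of _ "Z \<times> Z"]) (use assms in auto)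
  then have G: "finite G" "G \<noteq> {}" by (auto simp: G_def)
  have "\<And>g. g \<in> G \<Longrightarrow> g > 0" by (auto simp: G_def)
  then have "Min G > 0" using G by simp
  moreover have "\<bar>z - z'\<bar> > Min G / 2" if "z \<in> Z" "z' \<in> Z" "z \<noteq> z'" for z z'
  proof -
    have "\<bar>z - z'\<bar> \<in> G" using that by (auto simp: G_def)
    then have "Min G \<le> \<bar>z - z'\<bar>" using G by (intro Min_le)
    then show ?thesis using \<open>Min G > 0\<close> by linarith
  qed
  ultimately show ?thesis by (intro exI[of _ "Min G / 2"]) (force simp: not_le)
qed

text \<open>Take \<epsilon> below the gaps of the finite set of points that hit 0 before time n. The
  hull of a set of diameter at most \<epsilon> then contains at most one such point z. The itinerary
  is constant on the part below z, at z, and on the part above z: hence 3.\<close>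

lemma itin_local:
  "\<exists>\<epsilon>>0. \<forall>Y. (\<forall>x\<in>Y. \<forall>y\<in>Y. \<bar>x - y\<bar> \<le> \<epsilon>) \<longrightarrow> card (itin n ` Y) \<le> 3"
proof -
  define Z where "Z = {z. \<exists>i<n. (f ^^ i) z = 0}"
  have "Z = (\<Union>i<n. {z. (f ^^ i) z = 0})" by (auto simp: Z_def)
  then have "finite Z" using finite_fibre by simp
  from finite_gap[OF this] obtain \<epsilon> where e: "\<epsilon> > 0" "\<forall>z\<in>Z. \<forall>z'\<in>Z. \<bar>z - z'\<bar> \<le> \<epsilon> \<longrightarrow> z = z'"
    by blast
  have "card (itin n ` Y) \<le> 3" if Y: "\<forall>x\<in>Y. \<forall>y\<in>Y. \<bar>x - y\<bar> \<le> \<epsilon>" for Y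
  proof -
    \<comment> \<open>The turning points lying between two points of Y.\<close>
    define H where "H = {z\<in>Z. \<exists>x\<in>Y. \<exists>y\<in>Y. x \<le> z \<and> z \<le> y}"
    have H: "z = z'" if "z \<in> H" "z' \<in> H" for z z'
    proof -
      obtain x y x' y' where *: "x \<in> Y" "y \<in> Y" "x' \<in> Y" "y' \<in> Y" "x \<le> z" "z \<le> y" "x' \<le> z'" "z' \<le> y'"
        using \<open>z \<in> H\<close> \<open>z' \<in> H\<close> by (auto simp: H_def)
      have "\<bar>y - x'\<bar> \<le> \<epsilon>" "\<bar>y' - x\<bar> \<le> \<epsilon>" using Y * by auto
      then have "\<bar>z - z'\<bar> \<le> \<epsilon>" using * by linarith
      then show ?thesis using e(2) \<open>z \<in> H\<close> \<open>z' \<in> H\<close> by (auto simp: H_def)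
    qed
    have const: "card (itin n ` Y') \<le> 1" if Y': "Y' \<subseteq> Y" and no: "\<And>z x y. z \<in> H \<Longrightarrow> x \<in> Y' \<Longrightarrow> y \<in> Y' \<Longrightarrow> x \<le> z \<Longrightarrow> z \<le> y \<Longrightarrow> x = y" for Y'
    proof -
      have "itin n x = itin n y" if "x \<le> y" "x \<in> Y'" "y \<in> Y'" for x y
      proof (rule ccontr)
        assume ne: "itin n x \<noteq> itin n y"
        then obtain z where "z \<in> Z" "x \<le> z" "z \<le> y" using itin_change[OF \<open>x \<le> y\<close> ne] unfolding Z_def by blast
        then have "z \<in> H" using that Y' by (auto simp: H_def)
        then show False using no[of z x y] \<open>x \<le> z\<close> \<open>z \<le> y\<close> that ne by auto
      qed
      then have "itin n x = itin n y" if "x \<in> Y'" "y \<in> Y'" for x y using that by (metis linear)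
      then have "\<forall>a\<in>itin n ` Y'. \<forall>b\<in>itin n ` Y'. a = b" by blast
      then show ?thesis unfolding One_nat_def card_le_Suc0_iff_eq[OF finite_itin_image] .
    qed
    show ?thesis
    proof (cases "H = {}")
      case True
      then show ?thesis using const[of Y] by simp
    next
      case False
      then obtain z0 where z0: "z0 \<in> H" by blast
      let ?Y1 = "{y\<in>Y. y < z0}" and ?Y2 = "{y\<in>Y. y = z0}" and ?Y3 = "{y\<in>Y. y > z0}"
      have "Y = ?Y1 \<union> (?Y2 \<union> ?Y3)" by auto
      then have "itin n ` Y = itin n ` ?Y1 \<union> (itin n ` ?Y2 \<union> itin n ` ?Y3)" by blast
      then have "card (itin n ` Y) \<le> card (itin n ` ?Y1) + (card (itin n ` ?Y2) + card (itin n ` ?Y3))"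
        using card_Un_le[of "itin n ` ?Y1" "itin n ` ?Y2 \<union> itin n ` ?Y3"] card_Un_le[of "itin n ` ?Y2" "itin n ` ?Y3"]
        by (simp only:)
      moreover have "card (itin n ` ?Y1) \<le> 1" "card (itin n ` ?Y2) \<le> 1" "card (itin n ` ?Y3) \<le> 1"
        by (rule const; use H[OF z0] in force)+
      ultimately show ?thesis by linarith
    qed
  qed
  then show ?thesis using e(1) by blast
qed

text \<open>Once one of the at most three itineraries of the first block is fixed, the image under
  f^N satisfies the hypothesis for k - 1 blocks. Closeness matters only at multiples of N.\<close>

lemma card_itin_mult:
  assumes loc: "\<And>Y. (\<And>x y. x \<in> Y \<Longrightarrow> y \<in> Y \<Longrightarrow> \<bar>x - y\<bar> \<le> \<epsilon>) \<Longrightarrow> card (itin N ` Y) \<le> 3"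
    and Y: "\<And>j x y. j < k \<Longrightarrow> x \<in> Y \<Longrightarrow> y \<in> Y \<Longrightarrow> \<bar>(f ^^ (j * N)) x - (f ^^ (j * N)) y\<bar> \<le> \<epsilon>"
  shows "card (itin (k * N) ` Y) \<le> 3 ^ k"
  using Y
proof (induction k arbitrary: Y)
  case 0
  have "itin 0 ` Y \<subseteq> {{}}" by auto
  then have "card (itin 0 ` Y) \<le> card {{} :: nat set}" by (intro card_mono) auto
  then show ?case by simp
next
  case (Suc k)
  have shift: "(f ^^ (Suc j * N)) x = (f ^^ (j * N)) ((f ^^ N) x)" for j x
    by (subst mult_Suc, subst add.commute) (simp add: funpow_add)
  define F where "F A = (\<lambda>B. A \<union> (+) N ` B) ` (itin (k * N) ` ((f ^^ N) ` {y\<in>Y. itin N y = A}))" for A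
  have F: "card (F A) \<le> 3 ^ k" for A
  proof -
    have "card (F A) \<le> card (itin (k * N) ` ((f ^^ N) ` {y\<in>Y. itin N y = A}))"
      unfolding F_def by (rule card_image_le) simp
    also have "\<dots> \<le> 3 ^ k"
    proof (rule Suc.IH)
      fix j x y assume "j < k" "x \<in> (f ^^ N) ` {y\<in>Y. itin N y = A}" "y \<in> (f ^^ N) ` {y\<in>Y. itin N y = A}"
      then obtain x' y' where "x' \<in> Y" "x = (f ^^ N) x'" "y' \<in> Y" "y = (f ^^ N) y'" by auto
      then show "\<bar>(f ^^ (j * N)) x - (f ^^ (j * N)) y\<bar> \<le> \<epsilon>"
        using Suc.prems[of "Suc j" x' y'] \<open>j < k\<close> shift by simp
    qed
    finally show ?thesis .
  qed
  have "itin (Suc k * N) ` Y \<subseteq> (\<Union>A\<in>itin N ` Y. F A)"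
  proof (rule image_subsetI)
    fix y assume y: "y \<in> Y"
    have "itin (Suc k * N) y = itin N y \<union> (+) N ` itin (k * N) ((f ^^ N) y)"
      using itin_add[of N "k * N" y] by simp
    then have "itin (Suc k * N) y \<in> F (itin N y)" unfolding F_def using y by blast
    then show "itin (Suc k * N) y \<in> (\<Union>A\<in>itin N ` Y. F A)" using y by blast
  qed
  then have "card (itin (Suc k * N) ` Y) \<le> card (\<Union>A\<in>itin N ` Y. F A)"
    by (intro card_mono finite_UN_I finite_itin_image) (simp add: F_def)
  also have "\<dots> \<le> (\<Sum>A\<in>itin N ` Y. card (F A))" by (rule card_UN_le) simp
  also have "\<dots> \<le> card (itin N ` Y) * 3 ^ k" using sum_bounded_above[of "itin N ` Y" "\<lambda>A. card (F A)" "3 ^ k"] F by simp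
  also have "\<dots> \<le> 3 * 3 ^ k" using loc[of Y] Suc.prems[of 0] by (intro mult_right_mono) auto
  finally show ?case by simp
qed

lemma card_floor_image:
  fixes E :: "real set"
  assumes E: "E \<subseteq> {-1..1}" and \<delta>: "\<delta> > 0"
  shows "finite ((\<lambda>x. nat \<lfloor>(x + 1) / \<delta>\<rfloor>) ` E)" "real (card ((\<lambda>x. nat \<lfloor>(x + 1) / \<delta>\<rfloor>) ` E)) \<le> 2 / \<delta> + 1"
proof -
  have sub: "(\<lambda>x. nat \<lfloor>(x + 1) / \<delta>\<rfloor>) ` E \<subseteq> {..nat \<lfloor>2 / \<delta>\<rfloor>}"
    using E \<delta> by (auto intro!: nat_mono floor_mono divide_right_mono)
  then show "finite ((\<lambda>x. nat \<lfloor>(x + 1) / \<delta>\<rfloor>) ` E)" by (rule finite_subset) simp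
  have "card ((\<lambda>x. nat \<lfloor>(x + 1) / \<delta>\<rfloor>) ` E) \<le> card {..nat \<lfloor>2 / \<delta>\<rfloor>}" by (rule card_mono[OF _ sub]) simp
  then have "real (card ((\<lambda>x. nat \<lfloor>(x + 1) / \<delta>\<rfloor>) ` E)) \<le> real (nat \<lfloor>2 / \<delta>\<rfloor>) + 1" by simp
  also have "real (nat \<lfloor>2 / \<delta>\<rfloor>) \<le> 2 / \<delta>" using \<delta> by simp
  finally show "real (card ((\<lambda>x. nat \<lfloor>(x + 1) / \<delta>\<rfloor>) ` E)) \<le> 2 / \<delta> + 1" by simp
qed

lemma floor_eq_dist:
  fixes x y :: real
  assumes "x \<in> {-1..1}" "y \<in> {-1..1}" "\<delta> > 0" "nat \<lfloor>(x + 1) / \<delta>\<rfloor> = nat \<lfloor>(y + 1) / \<delta>\<rfloor>"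
  shows "\<bar>x - y\<bar> \<le> \<delta>"
proof -
  have "\<lfloor>(x + 1) / \<delta>\<rfloor> \<ge> 0" "\<lfloor>(y + 1) / \<delta>\<rfloor> \<ge> 0" using assms by auto
  then have "\<lfloor>(x + 1) / \<delta>\<rfloor> = \<lfloor>(y + 1) / \<delta>\<rfloor>" using assms(4) by linarith
  then have "\<bar>(x + 1) / \<delta> - (y + 1) / \<delta>\<bar> \<le> 1" by linarith
  then have "\<bar>x - y\<bar> / \<delta> \<le> 1" using assms(3) by (simp add: abs_divide flip: diff_divide_distrib)
  then show ?thesis using assms(3) by (simp add: divide_le_eq)
qed

lemma card_itin_upper:
  assumes loc: "\<And>Y. (\<And>x y. x \<in> Y \<Longrightarrow> y \<in> Y \<Longrightarrow> \<bar>x - y\<bar> \<le> \<epsilon>) \<Longrightarrow> card (itin N ` Y) \<le> 3"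
    and e: "\<epsilon> > 0"
  shows "real (card (itin (k * N) ` {-1..1})) \<le> (2 / \<epsilon> + 1) * 3 ^ k * lam ^ (k * N)"
proof -
  \<comment> \<open>By the Lipschitz bound a piece of length \<delta> stays \<epsilon>-small
    throughout the k N iterates, so it meets at most \<open>3 ^ k\<close> laps; about 2 / \<delta>
    pieces cover the interval.\<close>
  define \<delta> where "\<delta> = \<epsilon> / lam ^ (k * N)"
  have \<delta>: "\<delta> > 0" using e by (simp add: \<delta>_def)
  define h where "h x = nat \<lfloor>(x + 1) / \<delta>\<rfloor>" for x
  define P where "P j = {x\<in>{-1..1}. h x = j}" for j
  have P: "card (itin (k * N) ` P j) \<le> 3 ^ k" for j
  proof (rule card_itin_mult[OF loc])
    fix i x y assume i: "i < k" and xy: "x \<in> P j" "y \<in> P j"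
    have "\<bar>x - y\<bar> \<le> \<delta>" using xy by (intro floor_eq_dist \<delta>) (auto simp: P_def h_def)
    have "\<bar>(f ^^ (i * N)) x - (f ^^ (i * N)) y\<bar> \<le> lam ^ (i * N) * \<bar>x - y\<bar>" by (rule iter_lipschitz)
    also have "\<dots> \<le> lam ^ (k * N) * \<delta>"
      using i lam \<open>\<bar>x - y\<bar> \<le> \<delta>\<close> by (intro mult_mono power_increasing) auto
    also have "\<dots> = \<epsilon>" using lam by (simp add: \<delta>_def)
    finally show "\<bar>(f ^^ (i * N)) x - (f ^^ (i * N)) y\<bar> \<le> \<epsilon>" .
  qed
  have fin: "finite (h ` {-1..1})" and cardh: "real (card (h ` {-1..1})) \<le> 2 / \<delta> + 1"
    using card_floor_image[of "{-1..1}" \<delta>] \<delta> by (auto simp: h_def)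
  have "itin (k * N) ` {-1..1} \<subseteq> (\<Union>j\<in>h ` {-1..1}. itin (k * N) ` P j)" by (auto simp: P_def)
  then have "card (itin (k * N) ` {-1..1}) \<le> card (\<Union>j\<in>h ` {-1..1}. itin (k * N) ` P j)"
    by (intro card_mono finite_UN_I fin finite_itin_image)
  also have "\<dots> \<le> (\<Sum>j\<in>h ` {-1..1}. card (itin (k * N) ` P j))" by (rule card_UN_le[OF fin])
  also have "\<dots> \<le> card (h ` {-1..1}) * 3 ^ k"
    using sum_bounded_above[of "h ` {-1..1}" "\<lambda>j. card (itin (k * N) ` P j)" "3 ^ k"] P by simp
  finally have "real (card (itin (k * N) ` {-1..1})) \<le> real (card (h ` {-1..1}) * 3 ^ k)" by (rule of_nat_mono)
  also have "\<dots> = real (card (h ` {-1..1})) * 3 ^ k" by simp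
  also have "\<dots> \<le> (2 / \<delta> + 1) * 3 ^ k" using cardh by (intro mult_right_mono) auto
  also have "\<dots> \<le> ((2 / \<epsilon> + 1) * lam ^ (k * N)) * 3 ^ k"
    using lam_power_ge_1[of "k * N"] by (intro mult_right_mono) (auto simp: \<delta>_def algebra_simps)
  finally show ?thesis by (simp add: mult_ac)
qed

text \<open>Place points at spacing 4 / lam^n. Two of them with the same itinerary would have images
  at distance at least 4, while the interval has length 2.\<close>

lemma card_itin_lower: "lam ^ n / 2 \<le> real (card (itin n ` {-1..1}))"
proof -
  define m where "m = nat \<lfloor>lam ^ n / 2\<rfloor>"
  have m: "real m \<le> lam ^ n / 2" "lam ^ n / 2 \<le> real m + 1" 
  proof -
    have "\<lfloor>lam ^ n / 2\<rfloor> \<ge> 0" using less_imp_le[OF lam_power_pos[of n]] by simp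
    then show "real m \<le> lam ^ n / 2" "lam ^ n / 2 \<le> real m + 1" unfolding m_def by linarith+
  qed
  define x where "x j = -1 + 4 * real j / lam ^ n" for j :: nat
  have xI: "x j \<in> {-1..1}" if "j \<le> m" for j
  proof -
    have "real j \<le> lam ^ n / 2" using that m by linarith
    then have "4 * real j \<le> 2 * lam ^ n" by simp
    then show ?thesis using lam_power_pos[of n] by (simp add: x_def divide_le_eq)
  qed
  have inj: "inj_on (itin n \<circ> x) {..m}"
  proof (rule inj_onI, rule ccontr)
    fix i j assume ij: "i \<in> {..m}" "j \<in> {..m}" "(itin n \<circ> x) i = (itin n \<circ> x) j" "i \<noteq> j"
    have "\<bar>(f ^^ n) (x i) - (f ^^ n) (x j)\<bar> = lam ^ n * \<bar>x i - x j\<bar>" using ij by (intro itin_expand) simp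
    also have "x i - x j = 4 / lam ^ n * (real i - real j)" by (simp add: x_def right_diff_distrib diff_divide_distrib)
    also have "lam ^ n * \<bar>4 / lam ^ n * (real i - real j)\<bar> = 4 * \<bar>real i - real j\<bar>"
      unfolding abs_mult using lam by (simp add: power_abs)
    finally have "\<bar>(f ^^ n) (x i) - (f ^^ n) (x j)\<bar> = 4 * \<bar>real i - real j\<bar>" .
    moreover have "\<bar>real i - real j\<bar> \<ge> 1" using ij(4) by (cases "i < j") auto
    moreover have "e \<ge> 4" if "e = 4 * d" "d \<ge> 1" for e d :: real using that by simp
    ultimately have "\<bar>(f ^^ n) (x i) - (f ^^ n) (x j)\<bar> \<ge> 4" by blast
    moreover have "(f ^^ n) (x i) \<in> {-1..1}" "(f ^^ n) (x j) \<in> {-1..1}" using ij by (intro iter_mem xI; simp)+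
    ultimately have "(4 :: real) \<le> 2"
      by (intro order_trans[OF _ abs_diff_le_2])
    then show False by simp
  qed
  have "card {..m} = card ((itin n \<circ> x) ` {..m})" using card_image[OF inj] by simp
  also have "\<dots> \<le> card (itin n ` {-1..1})"
    by (intro card_mono) (use xI in auto)
  finally have "real (Suc m) \<le> real (card (itin n ` {-1..1}))" by simp
  then show ?thesis using m by linarith
qed

text \<open>Points closer than \<epsilon> / lam^n stay \<epsilon>-close for n steps, so each piece
  of that length holds at most one point of E. Finiteness of E is part of the conclusion.\<close>

lemma card_separated_le:
  assumes E: "E \<subseteq> {-1..1}" and sep: "dyn_separated f n \<epsilon> E" and e: "\<epsilon> > 0"
  shows "finite E" "real (card E) \<le> (2 / \<epsilon> + 1) * lam ^ n"
proof -
  define \<delta> where "\<delta> = \<epsilon> / lam ^ n"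
  have \<delta>: "\<delta> > 0" using e by (simp add: \<delta>_def)
  have inj: "inj_on (\<lambda>x. nat \<lfloor>(x + 1) / \<delta>\<rfloor>) E"
  proof (rule inj_onI, rule ccontr)
    fix x y assume xy: "x \<in> E" "y \<in> E" "nat \<lfloor>(x + 1) / \<delta>\<rfloor> = nat \<lfloor>(y + 1) / \<delta>\<rfloor>" "x \<noteq> y"
    obtain i where i: "i < n" "dist ((f ^^ i) x) ((f ^^ i) y) > \<epsilon>" using sep xy by (auto simp: dyn_separated_def)
    have "\<bar>x - y\<bar> \<le> \<delta>" using xy E by (intro floor_eq_dist \<delta>) auto
    have "dist ((f ^^ i) x) ((f ^^ i) y) \<le> lam ^ i * \<bar>x - y\<bar>" using iter_lipschitz by (simp add: dist_real_def)
    also have "\<dots> \<le> lam ^ n * \<delta>"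
      using i lam \<open>\<bar>x - y\<bar> \<le> \<delta>\<close> by (intro mult_mono power_increasing) auto
    also have "\<dots> = \<epsilon>" using lam by (simp add: \<delta>_def)
    finally show False using i by simp
  qed
  show "finite E" using card_floor_image(1)[OF E \<delta>] inj by (rule finite_imageD)
  have "real (card E) \<le> 2 / \<delta> + 1" using card_floor_image(2)[OF E \<delta>] card_image[OF inj] by simp
  also have "\<dots> \<le> (2 / \<epsilon> + 1) * lam ^ n"
    using lam_power_ge_1[of n] by (auto simp: \<delta>_def algebra_simps)
  finally show "real (card E) \<le> (2 / \<epsilon> + 1) * lam ^ n" .
qed

text \<open>Cardinalities of separated sets are bounded, so a largest one exists; a point far from
  all of its members could be added.\<close>

lemma maximal_separated:
  assumes e: "\<epsilon> > 0"
  obtains E where "E \<subseteq> {-1..1}" "finite E" "E \<noteq> {}" "dyn_separated f n \<epsilon> E"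
    "\<And>x. x \<in> {-1..1} \<Longrightarrow> \<exists>y\<in>E. \<forall>i<n. dist ((f ^^ i) x) ((f ^^ i) y) \<le> \<epsilon>"
proof -
  define Q where "Q E \<longleftrightarrow> E \<subseteq> {-1..1} \<and> E \<noteq> {} \<and> dyn_separated f n \<epsilon> E" for E
  have Q0: "Q {0}" by (auto simp: Q_def dyn_separated_def)
  have bound: "card E \<le> nat \<lceil>(2 / \<epsilon> + 1) * lam ^ n\<rceil>" if "Q E" for E
    using card_separated_le(2)[of E n \<epsilon>] that e by (simp add: Q_def le_nat_iff) linarith
  then have "\<forall>E. Q E \<longrightarrow> card E < Suc (nat \<lceil>(2 / \<epsilon> + 1) * lam ^ n\<rceil>)"
    by (metis less_Suc_eq_le)
  from ex_has_greatest_nat[of Q "{0}" card, OF Q0 this]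
  obtain E where E: "Q E" "\<And>E'. Q E' \<Longrightarrow> card E' \<le> card E" by blast
  have fin: "finite E" using E(1) card_separated_le(1) e by (auto simp: Q_def)
  have "\<exists>y\<in>E. \<forall>i<n. dist ((f ^^ i) x) ((f ^^ i) y) \<le> \<epsilon>" if x: "x \<in> {-1..1}" for x
  proof (rule ccontr)
    assume no: "\<not> (\<exists>y\<in>E. \<forall>i<n. dist ((f ^^ i) x) ((f ^^ i) y) \<le> \<epsilon>)"
    then have far: "\<exists>i<n. dist ((f ^^ i) x) ((f ^^ i) y) > \<epsilon>" if "y \<in> E" for y using that by (meson not_le)
    then have "x \<notin> E" using e by force
    have "Q (insert x E)"
      using E(1) x far unfolding Q_def dyn_separated_def by (auto simp: dist_commute)
    then have "card (insert x E) \<le> card E" by (rule E(2))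
    then show False using \<open>x \<notin> E\<close> fin by simp
  qed
  then show ?thesis using that E(1) fin by (auto simp: Q_def)
qed

section \<open>Growth rates of separated sets and the entropy\<close>

definition sep_rate :: "nat \<Rightarrow> real \<Rightarrow> ereal" where
  "sep_rate n \<epsilon> = (SUP E\<in>{E. E \<subseteq> {-1..1} \<and> finite E \<and> E \<noteq> {} \<and> dyn_separated f n \<epsilon> E}. ereal (ln (real (card E)) / real n))"

lemma sep_rate_upper:
  assumes e: "\<epsilon> > 0"
  shows "limsup (\<lambda>n. sep_rate n \<epsilon>) \<le> ereal (ln lam)"
proof -
  have le: "sep_rate n \<epsilon> \<le> ereal (ln lam + ln (2 / \<epsilon> + 1) / real n)" if n: "n \<ge> 1" for n
    unfolding sep_rate_def
  proof (rule SUP_least, clarify)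
    fix E assume E: "E \<subseteq> {-1..1}" "finite E" "E \<noteq> {}" "dyn_separated f n \<epsilon> E"
    have c: "card E > 0" using E by (simp add: card_gt_0_iff)
    have "ln (real (card E)) \<le> ln ((2 / \<epsilon> + 1) * lam ^ n)"
      using c card_separated_le(2)[OF E(1,4) e] by (intro ln_mono) auto
    also have "\<dots> = ln (2 / \<epsilon> + 1) + real n * ln lam"
    proof -
      have "2 / \<epsilon> + 1 > 0" using e by (simp add: add_pos_pos)
      then show ?thesis using lam by (simp add: ln_mult ln_realpow)
    qed
    finally show "ereal (ln (real (card E)) / real n) \<le> ereal (ln lam + ln (2 / \<epsilon> + 1) / real n)"
      using n by (simp add: field_simps)
  qed
  have "(\<lambda>n. ln lam + ln (2 / \<epsilon> + 1) / real n) \<longlonglongrightarrow> ln lam + 0"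
    by (intro tendsto_add tendsto_const lim_const_over_n)
  then have "(\<lambda>n. ereal (ln lam + ln (2 / \<epsilon> + 1) / real n)) \<longlonglongrightarrow> ereal (ln lam)" by simp
  then have "limsup (\<lambda>n. ereal (ln lam + ln (2 / \<epsilon> + 1) / real n)) = ereal (ln lam)"
    by (intro lim_imp_Limsup) auto
  moreover have "limsup (\<lambda>n. sep_rate n \<epsilon>) \<le> limsup (\<lambda>n. ereal (ln lam + ln (2 / \<epsilon> + 1) / real n))"
    by (rule Limsup_mono) (use le in \<open>auto simp: eventually_sequentially\<close>)
  ultimately show ?thesis by simp
qed

text \<open>A Bowen ball of radius \<epsilon>/2 is \<epsilon>-small along the orbit, so it meets at
  most 3 laps per block, whereas there are at least lam^n / 2 laps. Hence a spanning set has at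
  least lam^n / (2 * 3^(n/N)) points. The times n that are multiples of N suffice for a limit
  superior.\<close>

lemma sep_rate_lower:
  assumes N: "N \<ge> 1"
  shows "\<exists>\<epsilon>>0. ereal (ln lam - ln 3 / real N) \<le> limsup (\<lambda>n. sep_rate n \<epsilon>)"
proof -
  obtain \<epsilon> where e: "\<epsilon> > 0" and loc: "\<And>Y. (\<And>x y. x \<in> Y \<Longrightarrow> y \<in> Y \<Longrightarrow> \<bar>x - y\<bar> \<le> \<epsilon>) \<Longrightarrow> card (itin N ` Y) \<le> 3"
    using itin_local[of N] by metis
  have low: "ereal (ln lam - ln 3 / real N - (ln 2 / real N) / real (Suc k)) \<le> sep_rate (Suc k * N) (\<epsilon> / 2)" for k
  proof -
    define n where "n = Suc k * N"
    have n: "n \<ge> 1" using N by (simp add: n_def)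
    obtain E where E: "E \<subseteq> {-1..1}" "finite E" "E \<noteq> {}" "dyn_separated f n (\<epsilon> / 2) E"
      and near: "\<And>x. x \<in> {-1..1} \<Longrightarrow> \<exists>y\<in>E. \<forall>i<n. dist ((f ^^ i) x) ((f ^^ i) y) \<le> \<epsilon> / 2"
      using maximal_separated[of "\<epsilon> / 2" n] e by (metis half_gt_zero)
    define B where "B y = {x\<in>{-1..1}. \<forall>i<n. dist ((f ^^ i) x) ((f ^^ i) y) \<le> \<epsilon> / 2}" for y
    have B: "card (itin n ` B y) \<le> 3 ^ Suc k" for y
      unfolding n_def
    proof (rule card_itin_mult[OF loc])
      fix j x x' assume j: "j < Suc k" and x: "x \<in> B y" "x' \<in> B y"
      have "j * N < n" unfolding n_def by (rule mult_less_mono1) (use j N in auto)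
      then have "dist ((f ^^ (j * N)) x) ((f ^^ (j * N)) y) \<le> \<epsilon> / 2" "dist ((f ^^ (j * N)) x') ((f ^^ (j * N)) y) \<le> \<epsilon> / 2"
        using x by (auto simp: B_def)
      then show "\<bar>(f ^^ (j * N)) x - (f ^^ (j * N)) x'\<bar> \<le> \<epsilon>" unfolding dist_real_def by linarith
    qed
    have "itin n ` {-1..1} \<subseteq> (\<Union>y\<in>E. itin n ` B y)" using near by (fastforce simp: B_def)
    then have "card (itin n ` {-1..1}) \<le> card (\<Union>y\<in>E. itin n ` B y)"
      by (intro card_mono) (use E in auto)
    also have "\<dots> \<le> (\<Sum>y\<in>E. card (itin n ` B y))" by (rule card_UN_le) fact
    also have "\<dots> \<le> card E * 3 ^ Suc k"
      using sum_bounded_above[of E "\<lambda>y. card (itin n ` B y)" "3 ^ Suc k"] B by simp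
    finally have "real (card (itin n ` {-1..1})) \<le> real (card E * 3 ^ Suc k)" by (rule of_nat_mono)
    also have "\<dots> = real (card E) * 3 ^ Suc k" by simp
    finally have "real (card (itin n ` {-1..1})) \<le> real (card E) * 3 ^ Suc k" .
    then have "lam ^ n / 2 \<le> real (card E) * 3 ^ Suc k" using card_itin_lower[of n] by linarith
    then have "lam ^ n \<le> real (card E) * (3 ^ Suc k * 2)" by simp
    then have "ln (lam ^ n) \<le> ln (real (card E) * (3 ^ Suc k * 2))" by (intro ln_mono) auto
    moreover have c: "card E > 0" using E by (simp add: card_gt_0_iff)
    ultimately have "real n * ln lam \<le> ln (real (card E)) + real (Suc k) * ln 3 + ln 2"
      using lam by (simp add: ln_mult ln_realpow del: power_Suc of_nat_Suc)
    then have "(real n * ln lam - real (Suc k) * ln 3 - ln 2) / real n \<le> ln (real (card E)) / real n"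
      using n by (intro divide_right_mono) auto
    also have "(real n * ln lam - real (Suc k) * ln 3 - ln 2) / real n = ln lam - ln 3 / real N - (ln 2 / real N) / real (Suc k)"
    proof -
      have "real n = real (Suc k) * real N" by (simp only: n_def of_nat_mult)
      moreover have "real (Suc k) > 0" "real N > 0" using N by simp_all
      ultimately show ?thesis by (simp add: field_simps del: of_nat_Suc)
    qed
    finally have "ereal (ln lam - ln 3 / real N - (ln 2 / real N) / real (Suc k)) \<le> ereal (ln (real (card E)) / real n)" by simp
    also have "\<dots> \<le> sep_rate n (\<epsilon> / 2)" unfolding sep_rate_def by (rule SUP_upper) (use E in auto)
    finally show ?thesis by (simp add: n_def)
  qed
  have "(\<lambda>k. ln lam - ln 3 / real N - (ln 2 / real N) / real (Suc k)) \<longlonglongrightarrow> ln lam - ln 3 / real N - 0"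
    by (intro tendsto_diff tendsto_const LIMSEQ_Suc[OF lim_const_over_n])
  then have "(\<lambda>k. ereal (ln lam - ln 3 / real N - (ln 2 / real N) / real (Suc k))) \<longlonglongrightarrow> ereal (ln lam - ln 3 / real N)" by simp
  then have "ereal (ln lam - ln 3 / real N) = limsup (\<lambda>k. ereal (ln lam - ln 3 / real N - (ln 2 / real N) / real (Suc k)))"
    by (intro lim_imp_Limsup[symmetric]) auto
  also have "\<dots> \<le> limsup ((\<lambda>n. sep_rate n (\<epsilon> / 2)) \<circ> (\<lambda>k. Suc k * N))"
    by (rule Limsup_mono) (use low in \<open>simp add: o_def\<close>)
  also have "\<dots> \<le> limsup (\<lambda>n. sep_rate n (\<epsilon> / 2))"
    by (rule limsup_subseq_mono) (use N in \<open>simp add: strict_mono_Suc_iff\<close>)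
  finally show ?thesis using e by (intro exI[of _ "\<epsilon> / 2"]) simp
qed

theorem tent_entropy: "topological_entropy {-1..1} f = ereal (ln lam)"
proof -
  have eq: "topological_entropy {-1..1} f = (SUP \<epsilon>\<in>{0<..}. limsup (\<lambda>n. sep_rate n \<epsilon>))"
    by (simp add: topological_entropy_def sep_rate_def)
  show ?thesis unfolding eq
  proof (rule antisym)
    show "(SUP \<epsilon>\<in>{0<..}. limsup (\<lambda>n. sep_rate n \<epsilon>)) \<le> ereal (ln lam)"
      by (rule SUP_least) (auto intro: sep_rate_upper)
    show "ereal (ln lam) \<le> (SUP \<epsilon>\<in>{0<..}. limsup (\<lambda>n. sep_rate n \<epsilon>))"
    \<comment> \<open>The scale \<epsilon> depends on N, which the supremum over \<epsilon> absorbs;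
      the loss ln 3 / N vanishes as N grows.\<close>
    proof (rule LIMSEQ_le_const2)
      have "(\<lambda>N. ln lam - ln 3 / real N) \<longlonglongrightarrow> ln lam - 0"
        by (intro tendsto_diff tendsto_const lim_const_over_n)
      then show "(\<lambda>N. ereal (ln lam - ln 3 / real N)) \<longlonglongrightarrow> ereal (ln lam)" by simp
      have "ereal (ln lam - ln 3 / real N) \<le> (SUP \<epsilon>\<in>{0<..}. limsup (\<lambda>n. sep_rate n \<epsilon>))" if "N \<ge> 1" for N
        using sep_rate_lower[OF that] by (auto intro: SUP_upper2)
      then show "\<exists>M. \<forall>N\<ge>M. ereal (ln lam - ln 3 / real N) \<le> (SUP \<epsilon>\<in>{0<..}. limsup (\<lambda>n. sep_rate n \<epsilon>))"
        by blast
    qed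
  qed
qed

end

section \<open>The transfer operator on Lebesgue spaces\<close>

lemma Lp_norm_nn_integral:
  assumes p: "p \<ge> 1" and u: "u \<in> Lp_space M p"
  shows "(\<integral>\<^sup>+x. ennreal (cmod (u x) powr p) \<partial>M) = ennreal (Lp_norm M p u powr p)"
  by (simp add: Lp_norm_powr[OF p] nn_integral_eq_integral[OF Lp_spaceD(2)[OF u]])

lemma Lp_space_nn_integralI:
  assumes p: "p \<ge> 1" and u: "u \<in> borel_measurable M" and C: "C \<ge> 0"
    and le: "(\<integral>\<^sup>+x. ennreal (cmod (u x) powr p) \<partial>M) \<le> ennreal (C powr p)"
  shows "u \<in> Lp_space M p \<and> Lp_norm M p u \<le> C"
proof -
  have "integrable M (\<lambda>x. cmod (u x) powr p)"
  proof (rule integrableI_bounded)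
    show "(\<lambda>x. cmod (u x) powr p) \<in> borel_measurable M" using u by measurable
    show "(\<integral>\<^sup>+x. ennreal (norm (cmod (u x) powr p)) \<partial>M) < \<infinity>"
      using le by (simp add: le_less_trans[OF _ ennreal_less_top])
  qed
  then have L: "u \<in> Lp_space M p" using u by (simp add: Lp_space_def)
  have "ennreal (Lp_norm M p u powr p) \<le> ennreal (C powr p)"
    using le Lp_norm_nn_integral[OF p L] by simp
  then have "Lp_norm M p u powr p \<le> C powr p" by (simp add: ennreal_le_iff)
  then show ?thesis using L C Lp_norm_leI[OF p C, of M u] by (simp add: Lp_norm_powr[OF p])
qed

lemma affine_measurable_lebesgue:
  assumes "c \<noteq> 0"
  shows "(\<lambda>x::real. a + c * x) \<in> lebesgue \<rightarrow>\<^sub>M lebesgue"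
  using lebesgue_affine_measurable[where c = "\<lambda>x::real. c" and t = a] assms by simp

lemma measurable_ident_lebesgue [measurable]: "(\<lambda>x::real. x) \<in> borel_measurable lebesgue"
  using id_borel_measurable_lebesgue by (simp add: id_def)

text \<open>Extension by zero, which makes affine substitutions on the whole line
  applicable.\<close>

definition restr :: "(real \<Rightarrow> 'b::zero) \<Rightarrow> real \<Rightarrow> 'b" where
  "restr u x = (if x \<in> {-1..1} then u x else 0)"

lemma restr_measurable:
  fixes u :: "real \<Rightarrow> 'b::{topological_space, zero}"
  assumes "u \<in> borel_measurable LI"
  shows "restr u \<in> borel_measurable lebesgue"
  using assms unfolding restr_def[abs_def] by (subst (asm) measurable_restrict_space_iff[where c = 0]) auto

lemma restr_affine_measurable:
  fixes u :: "real \<Rightarrow> 'b::{topological_space, zero}"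
  assumes "u \<in> borel_measurable LI" "c \<noteq> 0"
  shows "(\<lambda>x. restr u (a + c * x)) \<in> borel_measurable lebesgue"
  by (rule measurable_compose[OF affine_measurable_lebesgue[OF assms(2)] restr_measurable[OF assms(1)]])

lemma AE_LI_finite:
  assumes "finite Z"
  shows "AE x in LI. x \<notin> Z"
proof (rule AE_I')
  show "Z \<inter> {-1..1} \<in> null_sets LI"
  proof -
    have "Z \<inter> {-1..1} \<in> null_sets lebesgue"
      using assms by (intro negligible_iff_null_sets[THEN iffD1] negligible_finite) auto
    then show ?thesis by (subst null_sets_restrict_space) auto
  qed
qed auto

lemma sum_plus_minus: "w > (0::real) \<Longrightarrow> sum h {w, - w} = h w + h (- w)"
  by (subst sum.insert) auto

context tent_map
begin

abbreviation \<Phi> :: "(real \<Rightarrow> complex) \<Rightarrow> real \<Rightarrow> complex" where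
  "\<Phi> \<equiv> transfer_operator {-1..1} f"

lemma tent_has_derivative:
  assumes "x \<noteq> 0"
  shows "(f has_real_derivative - lam * sgn x) (at x)"
proof -
  have eq: "f y = lam * (1 - sgn x * y) - 1" if "dist y x < \<bar>x\<bar>" for y
    using that assms unfolding tent_eq by (cases "x > 0") (auto simp: dist_real_def)
  have "((\<lambda>y. lam * (1 - sgn x * y) - 1) has_real_derivative - lam * sgn x) (at x)"
    by (auto intro!: derivative_eq_intros)
  then show ?thesis
    using assms eq by (rule_tac has_field_derivative_transform_within[where d = "\<bar>x\<bar>"]) auto
qed

lemma abs_deriv_tent:
  assumes "x \<noteq> 0"
  shows "\<bar>deriv f x\<bar> = lam"
  using DERIV_imp_deriv[OF tent_has_derivative[OF assms]] assms lam by (simp add: abs_mult)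

lemma fibre_eq:
  assumes x: "x \<in> {-1..1}"
  shows "{y\<in>{-1..1}. f y = x} = (if x < lam - 1 then {(lam - 1 - x) / lam, - ((lam - 1 - x) / lam)}
    else if x = lam - 1 then {0} else {})"
proof -
  have "f y = x \<longleftrightarrow> \<bar>y\<bar> = (lam - 1 - x) / lam" for y
    using lam by (auto simp: tent_eq field_simps)
  moreover have "(lam - 1 - x) / lam \<le> 1" using x lam by (simp add: divide_le_eq)
  moreover have "(lam - 1 - x) / lam > 0 \<longleftrightarrow> x < lam - 1" "(lam - 1 - x) / lam = 0 \<longleftrightarrow> x = lam - 1"
    using lam by (auto simp: zero_less_divide_iff)
  ultimately show ?thesis by (auto simp: abs_if split: if_splits)
qed

lemma fibre_finite [simp]: "finite {y\<in>{-1..1}. (f ^^ n) y = x}"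
  by (rule finite_subset[OF _ finite_fibre[of n x]]) auto

lemma sum_fibre_Suc:
  fixes h :: "real \<Rightarrow> 'b::comm_monoid_add"
  shows "(\<Sum>z\<in>{z\<in>{-1..1}. (f ^^ Suc n) z = x}. h z) = (\<Sum>y\<in>{y\<in>{-1..1}. f y = x}. \<Sum>z\<in>{z\<in>{-1..1}. (f ^^ n) z = y}. h z)"
proof -
  have "{z\<in>{-1..1}. (f ^^ Suc n) z = x} = (\<Union>y\<in>{y\<in>{-1..1}. f y = x}. {z\<in>{-1..1}. (f ^^ n) z = y})"
    using iter_mem by fastforce
  moreover have "finite {y\<in>{-1..1}. f y = x}" using fibre_finite[of 1 x] by simp
  moreover have "\<forall>y\<in>{y\<in>{-1..1}. f y = x}. finite {z\<in>{-1..1}. (f ^^ n) z = y}"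
    using fibre_finite by blast
  ultimately show ?thesis by (simp only:) (rule sum.UNION_disjoint, assumption+, blast)
qed

lemma transfer_add: "\<Phi> (\<lambda>x. u x + v x) = (\<lambda>x. \<Phi> u x + \<Phi> v x)"
  by (simp add: transfer_operator_def fun_eq_iff distrib_left sum.distrib)

lemma transfer_cmult: "\<Phi> (\<lambda>x. a * u x) = (\<lambda>x. a * \<Phi> u x)"
  by (simp add: transfer_operator_def fun_eq_iff sum_distrib_left mult.left_commute)

lemma transfer_iter_add: "(\<Phi> ^^ n) (\<lambda>x. u x + v x) = (\<lambda>x. (\<Phi> ^^ n) u x + (\<Phi> ^^ n) v x)"
  by (induction n) (auto simp: transfer_add)

lemma transfer_iter_cmult: "(\<Phi> ^^ n) (\<lambda>x. a * u x) = (\<lambda>x. a * (\<Phi> ^^ n) u x)"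
  by (induction n) (auto simp: transfer_cmult)

lemma transfer_iter_zero: "(\<Phi> ^^ n) (\<lambda>x. 0) = (\<lambda>x. 0)"
  using transfer_iter_cmult[of n 0 "\<lambda>x. 0"] by simp

lemma transfer_iter_sum:
  "finite S \<Longrightarrow> (\<Phi> ^^ n) (\<lambda>x. \<Sum>i\<in>S. u i x) = (\<lambda>x. \<Sum>i\<in>S. (\<Phi> ^^ n) (u i) x)"
  by (induction S rule: finite_induct) (auto simp: transfer_iter_zero transfer_iter_add)

text \<open>At the turning point the slope is not lam in absolute value, so images of that point are
  excluded. Z consists of its first n images and does not depend on u.\<close>

lemma transfer_iter_eq:
  "\<exists>Z. finite Z \<and> (\<forall>u. \<forall>x\<in>{-1..1} - Z. (\<Phi> ^^ n) u x = (\<Sum>y\<in>{y\<in>{-1..1}. (f ^^ n) y = x}. u y) / of_real (lam ^ n))"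
proof (induction n)
  case 0
  have "{y\<in>{-1..1}. y = x} = {x}" if "x \<in> {-1..1}" for x :: real using that by auto
  then show ?case by (intro exI[of _ "{}"]) simp
next
  case (Suc n)
  then obtain Z where Z: "finite Z"
    "\<And>u x. x \<in> {-1..1} - Z \<Longrightarrow> (\<Phi> ^^ n) u x = (\<Sum>y\<in>{y\<in>{-1..1}. (f ^^ n) y = x}. u y) / of_real (lam ^ n)" by blast
  have "(\<Phi> ^^ Suc n) u x = (\<Sum>y\<in>{y\<in>{-1..1}. (f ^^ Suc n) y = x}. u y) / of_real (lam ^ Suc n)"
    if x: "x \<in> {-1..1} - f ` insert 0 Z" for u x
  proof -
    have "(\<Phi> ^^ Suc n) u x = (\<Sum>y\<in>{y\<in>{-1..1}. f y = x}. of_real (1 / \<bar>deriv f y\<bar>) * (\<Phi> ^^ n) u y)"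
      by (simp add: transfer_operator_def)
    also have "\<dots> = (\<Sum>y\<in>{y\<in>{-1..1}. f y = x}. (\<Sum>z\<in>{z\<in>{-1..1}. (f ^^ n) z = y}. u z) / of_real (lam ^ Suc n))"
    proof (rule sum.cong[OF refl])
      fix y assume y: "y \<in> {y\<in>{-1..1}. f y = x}"
      then have "y \<noteq> 0" "y \<in> {-1..1} - Z" using x by auto
      then show "of_real (1 / \<bar>deriv f y\<bar>) * (\<Phi> ^^ n) u y = (\<Sum>z\<in>{z\<in>{-1..1}. (f ^^ n) z = y}. u z) / of_real (lam ^ Suc n)"
        using Z(2)[of y u] abs_deriv_tent[of y] by simp
    qed
    also have "\<dots> = (\<Sum>z\<in>{z\<in>{-1..1}. (f ^^ Suc n) z = x}. u z) / of_real (lam ^ Suc n)"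
      unfolding sum_fibre_Suc by (rule sum_divide_distrib[symmetric])
    finally show ?thesis .
  qed
  then show ?case using Z(1) by (intro exI[of _ "f ` insert 0 Z"]) auto
qed

lemma transfer_measurable:
  assumes u: "u \<in> borel_measurable LI"
  shows "\<Phi> u \<in> borel_measurable LI"
proof -
  let ?a = "(lam - 1) / lam" and ?c = "- 1 / lam"
  have m: "(\<lambda>x. restr u (?a + ?c * x)) \<in> borel_measurable lebesgue" "(\<lambda>x. restr u (- ?a + - ?c * x)) \<in> borel_measurable lebesgue"
    using lam by (intro restr_affine_measurable u; simp)+
  \<comment> \<open>The two inverse branches written out. At the critical value lam - 1 the fibre is
    {0}, and \<open>deriv f 0\<close> is kept as it is.\<close>
  define g where "g x = (if x < lam - 1 then (restr u (?a + ?c * x) + restr u (- ?a + - ?c * x)) / of_real lam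
      else if x = lam - 1 then of_real (1 / \<bar>deriv f 0\<bar>) * u 0 else 0)" for x
  have "\<Phi> u x = g x" if x: "x \<in> {-1..1}" for x
  proof -
    let ?w = "(lam - 1 - x) / lam"
    have w: "?a + ?c * x = ?w" "- ?a + - ?c * x = - ?w" by (simp_all add: diff_divide_distrib)
    show ?thesis
    proof (cases "x < lam - 1")
      case True
      then have "?w > 0" using lam by simp
      moreover have "?w \<le> 1" using x lam by (simp add: divide_le_eq)
      ultimately have "restr u ?w = u ?w" "restr u (- ?w) = u (- ?w)" "?w \<noteq> - ?w" "?w \<noteq> 0" by (auto simp: restr_def)
      then show ?thesis
        unfolding transfer_operator_def fibre_eq[OF x] g_def w using True abs_deriv_tent[of ?w] abs_deriv_tent[of "- ?w"]
        by (simp add: add_divide_distrib)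
    next
      case False
      then show ?thesis unfolding transfer_operator_def fibre_eq[OF x] g_def by simp
    qed
  qed
  moreover have "g \<in> borel_measurable lebesgue"
    unfolding g_def[abs_def] using m by measurable
  then have "g \<in> borel_measurable LI" by (rule measurable_restrict_space1)
  ultimately show ?thesis by (subst measurable_cong[where g = g]) auto
qed

lemma transfer_iter_measurable:
  "u \<in> borel_measurable LI \<Longrightarrow> (\<Phi> ^^ n) u \<in> borel_measurable LI"
  by (induction n) (auto intro: transfer_measurable)

text \<open>Change of variables on the two branches, each expanding by lam. Nonnegative extended
  functions are used so that no integrability has to be known beforehand.\<close>

lemma nn_integral_fibre_1:
  fixes h :: "real \<Rightarrow> ennreal"
  assumes h: "h \<in> borel_measurable LI"
  shows "(\<lambda>x. \<Sum>y\<in>{y\<in>{-1..1}. f y = x}. h y) \<in> borel_measurable LI"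
    "(\<integral>\<^sup>+x. (\<Sum>y\<in>{y\<in>{-1..1}. f y = x}. h y) \<partial>LI) = ennreal lam * (\<integral>\<^sup>+x. h x \<partial>LI)"
proof -
  let ?a = "(lam - 1) / lam" and ?c = "- 1 / lam"
  have c: "?c \<noteq> 0" "- ?c \<noteq> 0" using lam by auto
  \<comment> \<open>Splitting h at 0 lets each inverse branch see only its own half, so that both
    can be integrated over the whole line.\<close>
  define g1 where "g1 y = (if y > 0 then restr h y else 0)" for y
  define g2 where "g2 y = (if y < 0 then restr h y else 0)" for y
  have mh: "restr h \<in> borel_measurable lebesgue" by (rule restr_measurable[OF h])
  have mg: "g1 \<in> borel_measurable lebesgue" "g2 \<in> borel_measurable lebesgue"
    unfolding g1_def[abs_def] g2_def[abs_def] using mh by measurable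
  have mga: "(\<lambda>x. g1 (?a + ?c * x)) \<in> borel_measurable lebesgue" "(\<lambda>x. g2 (- ?a + - ?c * x)) \<in> borel_measurable lebesgue"
    by (rule measurable_compose[OF affine_measurable_lebesgue[OF c(1)] mg(1)])
      (rule measurable_compose[OF affine_measurable_lebesgue[OF c(2)] mg(2)])
  define G where "G x = g1 (?a + ?c * x) + g2 (- ?a + - ?c * x)" for x
  have mG: "G \<in> borel_measurable lebesgue" unfolding G_def[abs_def] using mga by measurable
  have G: "(\<Sum>y\<in>{y\<in>{-1..1}. f y = x}. h y) = (if x = lam - 1 then h 0 else G x)" if x: "x \<in> {-1..1}" for x
  proof -
    let ?w = "(lam - 1 - x) / lam"
    have w: "?a + ?c * x = ?w" "- ?a + - ?c * x = - ?w" by (simp_all add: diff_divide_distrib)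
    have w1: "?w \<le> 1" using x lam by (simp add: divide_le_eq)
    consider "x < lam - 1" "?w > 0" | "x = lam - 1" | "x > lam - 1" "?w < 0" using lam by (auto simp: divide_less_0_iff) (metis linorder_less_linear)
    then show ?thesis
      unfolding fibre_eq[OF x] G_def w using w1 by cases (auto simp: g1_def g2_def restr_def sum_plus_minus)
  qed
  have "(\<lambda>x. if x = lam - 1 then h 0 else G x) \<in> borel_measurable lebesgue" using mG by measurable
  then have "(\<lambda>x. if x = lam - 1 then h 0 else G x) \<in> borel_measurable LI" by (rule measurable_restrict_space1)
  then show "(\<lambda>x. \<Sum>y\<in>{y\<in>{-1..1}. f y = x}. h y) \<in> borel_measurable LI"
    by (subst measurable_cong[where g = "\<lambda>x. if x = lam - 1 then h 0 else G x"]) (use G in auto)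
  have G0: "G x = 0" if "x \<notin> {-1..1}" for x
  proof -
    let ?w = "(lam - 1 - x) / lam"
    have w: "?a + ?c * x = ?w" "- ?a + - ?c * x = - ?w" by (simp_all add: diff_divide_distrib)
    have "x < -1 \<or> x > 1" using that by auto
    then have "?w > 1 \<or> ?w < 0" using lam by (auto simp: divide_less_0_iff less_divide_eq)
    then show ?thesis unfolding G_def w by (auto simp: g1_def g2_def restr_def)
  qed
  have scale: "X = ennreal lam * Y" if "Y = ennreal \<bar>d\<bar> * X" "\<bar>d\<bar> = 1 / lam" for X Y d
  proof -
    have "ennreal lam * Y = ennreal (lam * (1 / lam)) * X"
      using that lam by (simp add: ennreal_mult mult.assoc del: nonzero_mult_div_cancel_left times_divide_eq_right)
    then show ?thesis using lam by simp
  qed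
  have "(\<integral>\<^sup>+x. (\<Sum>y\<in>{y\<in>{-1..1}. f y = x}. h y) \<partial>LI) = (\<integral>\<^sup>+x. G x \<partial>LI)"
  proof (rule nn_integral_cong_AE)
    have "AE x in LI. x \<notin> {lam - 1}" by (rule AE_LI_finite) simp
    then show "AE x in LI. (\<Sum>y\<in>{y\<in>{-1..1}. f y = x}. h y) = G x"
      using AE_space[of LI] by eventually_elim (use G in auto)
  qed
  also have "\<dots> = (\<integral>\<^sup>+x. G x \<partial>lebesgue)"
    using G0 by (subst nn_integral_restrict_space) (auto intro!: nn_integral_cong simp: indicator_def)
  also have "\<dots> = (\<integral>\<^sup>+x. g1 (?a + ?c * x) \<partial>lebesgue) + (\<integral>\<^sup>+x. g2 (- ?a + - ?c * x) \<partial>lebesgue)"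
    unfolding G_def by (rule nn_integral_add[OF mga])
  also have "(\<integral>\<^sup>+x. g1 (?a + ?c * x) \<partial>lebesgue) = ennreal lam * (\<integral>\<^sup>+x. g1 x \<partial>lebesgue)"
    by (rule scale[OF nn_integral_real_affine_lebesgue[OF mg(1) c(1), where t = ?a]]) (use lam in simp)
  also have "(\<integral>\<^sup>+x. g2 (- ?a + - ?c * x) \<partial>lebesgue) = ennreal lam * (\<integral>\<^sup>+x. g2 x \<partial>lebesgue)"
    by (rule scale[OF nn_integral_real_affine_lebesgue[OF mg(2) c(2), where t = "- ?a"]]) (use lam in simp)
  also have "ennreal lam * (\<integral>\<^sup>+x. g1 x \<partial>lebesgue) + ennreal lam * (\<integral>\<^sup>+x. g2 x \<partial>lebesgue) = ennreal lam * (\<integral>\<^sup>+x. g1 x + g2 x \<partial>lebesgue)"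
    by (simp add: nn_integral_add[OF mg] distrib_left)
  also have "(\<integral>\<^sup>+x. g1 x + g2 x \<partial>lebesgue) = (\<integral>\<^sup>+x. restr h x \<partial>lebesgue)"
  proof (rule nn_integral_cong_AE)
    have "AE x in lebesgue. x \<notin> {0 :: real}" by (rule AE_not_in) (simp add: negligible_iff_null_sets[symmetric])
    then show "AE x in lebesgue. g1 x + g2 x = restr h x"
      by eventually_elim (auto simp: g1_def g2_def)
  qed
  also have "\<dots> = (\<integral>\<^sup>+x. h x \<partial>LI)"
    by (subst nn_integral_restrict_space) (auto intro!: nn_integral_cong simp: indicator_def restr_def)
  finally show "(\<integral>\<^sup>+x. (\<Sum>y\<in>{y\<in>{-1..1}. f y = x}. h y) \<partial>LI) = ennreal lam * (\<integral>\<^sup>+x. h x \<partial>LI)" .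
qed

lemma nn_integral_fibre:
  fixes h :: "real \<Rightarrow> ennreal"
  assumes h: "h \<in> borel_measurable LI"
  shows "(\<lambda>x. \<Sum>y\<in>{y\<in>{-1..1}. (f ^^ n) y = x}. h y) \<in> borel_measurable LI \<and>
    (\<integral>\<^sup>+x. (\<Sum>y\<in>{y\<in>{-1..1}. (f ^^ n) y = x}. h y) \<partial>LI) = ennreal (lam ^ n) * (\<integral>\<^sup>+x. h x \<partial>LI)"
proof (induction n)
  case 0
  have eq: "(\<Sum>y\<in>{y\<in>{-1..1}. (f ^^ 0) y = x}. h y) = h x" if "x \<in> space LI" for x
  proof -
    have "{y\<in>{-1..1}. (f ^^ 0) y = x} = {x}" using that by auto
    then show ?thesis by simp
  qed
  show ?case
    using h by (simp only: measurable_cong[OF eq] nn_integral_cong[OF eq]) simp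
next
  case (Suc n)
  show ?case unfolding sum_fibre_Suc
    using Suc nn_integral_fibre_1[of "\<lambda>x. \<Sum>y\<in>{y\<in>{-1..1}. (f ^^ n) y = x}. h y"] lam
    by (simp add: ennreal_mult mult.assoc)
qed

lemma card_fibre_le: "card {y\<in>{-1..1}. (f ^^ n) y = x} \<le> card (itin n ` {-1..1})"
proof (rule card_inj_on_le[where f = "itin n"])
  show "inj_on (itin n) {y\<in>{-1..1}. (f ^^ n) y = x}" by (rule inj_onI) (auto intro: itin_inj)
qed auto

text \<open>Jensen for a fibre sum of at most \<beta> lam^n terms, then integration over the fibres:
  the powers of lam cancel and \<beta>^(p-1) remains, which is at most \<beta>^p.\<close>

lemma transfer_iter_Lp:
  assumes p: "p \<ge> 1" and u: "u \<in> Lp_space LI p" and \<beta>: "\<beta> \<ge> 1"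
    and B: "real (card (itin n ` {-1..1})) \<le> \<beta> * lam ^ n"
  shows "(\<Phi> ^^ n) u \<in> Lp_space LI p \<and> Lp_norm LI p ((\<Phi> ^^ n) u) \<le> \<beta> * Lp_norm LI p u"
proof (rule Lp_space_nn_integralI[OF p transfer_iter_measurable[OF Lp_spaceD(1)[OF u]]])
  let ?L = "lam ^ n"
  define h where "h x = ennreal (cmod (u x) powr p)" for x
  have mh: "h \<in> borel_measurable LI" unfolding h_def using Lp_spaceD(1)[OF u] by measurable
  obtain Z where Z: "finite Z"
    "\<And>u x. x \<in> {-1..1} - Z \<Longrightarrow> (\<Phi> ^^ n) u x = (\<Sum>y\<in>{y\<in>{-1..1}. (f ^^ n) y = x}. u y) / of_real ?L"
    using transfer_iter_eq[of n] by blast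
  define c where "c = (\<beta> * ?L) powr (p - 1) / ?L powr p"
  have c0: "c \<ge> 0" by (simp add: c_def)
  have cL: "c * ?L \<le> \<beta> powr p"
  proof -
    have "c * ?L = \<beta> powr (p - 1) * ((?L powr (p - 1) * ?L) / ?L powr p)"
      using \<beta> less_imp_le[OF lam_power_pos[of n]] by (simp add: c_def powr_mult)
    also have "?L powr (p - 1) * ?L = ?L powr p"
      using lam_power_pos[of n] by (metis powr_mult_base mult.commute add.commute diff_add_cancel less_imp_le)
    also have "\<beta> powr (p - 1) * (?L powr p / ?L powr p) \<le> \<beta> powr p"
      using \<beta> lam_power_pos[of n] by (simp add: powr_mono)
    finally show ?thesis .
  qed
  have pt: "ennreal (cmod ((\<Phi> ^^ n) u x) powr p) \<le> ennreal c * (\<Sum>y\<in>{y\<in>{-1..1}. (f ^^ n) y = x}. h y)"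
    if x: "x \<in> {-1..1} - Z" for x
  proof -
    let ?F = "{y\<in>{-1..1}. (f ^^ n) y = x}"
    have "cmod ((\<Phi> ^^ n) u x) = cmod (\<Sum>y\<in>?F. u y) / ?L"
      using Z(2)[OF x, of u] lam(3) by (simp add: norm_divide norm_power)
    also have "\<dots> \<le> (\<Sum>y\<in>?F. cmod (u y)) / ?L"
      using less_imp_le[OF lam_power_pos[of n]] by (intro divide_right_mono norm_sum) auto
    finally have "cmod ((\<Phi> ^^ n) u x) powr p \<le> ((\<Sum>y\<in>?F. cmod (u y)) / ?L) powr p"
      using p by (intro powr_mono2) auto
    also have "\<dots> = (\<Sum>y\<in>?F. cmod (u y)) powr p / ?L powr p"
      using less_imp_le[OF lam_power_pos[of n]] by (simp add: powr_divide sum_nonneg)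
    also have "\<dots> \<le> (real (card ?F) powr (p - 1) * (\<Sum>y\<in>?F. cmod (u y) powr p)) / ?L powr p"
      using p by (intro divide_right_mono powr_sum_le fibre_finite) auto
    also have "\<dots> \<le> ((\<beta> * ?L) powr (p - 1) * (\<Sum>y\<in>?F. cmod (u y) powr p)) / ?L powr p"
    proof (intro divide_right_mono mult_right_mono powr_mono2)
      show "real (card ?F) \<le> \<beta> * ?L" using card_fibre_le[of n x] B by (meson of_nat_le_iff order_trans)
    qed (use p in \<open>auto intro: sum_nonneg\<close>)
    also have "\<dots> = c * (\<Sum>y\<in>?F. cmod (u y) powr p)" by (simp add: c_def)
    finally have "ennreal (cmod ((\<Phi> ^^ n) u x) powr p) \<le> ennreal (c * (\<Sum>y\<in>?F. cmod (u y) powr p))"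
      by (rule ennreal_leI)
    then show ?thesis using c0 by (simp add: ennreal_mult h_def sum_nonneg)
  qed
  have "(\<integral>\<^sup>+x. ennreal (cmod ((\<Phi> ^^ n) u x) powr p) \<partial>LI) \<le> (\<integral>\<^sup>+x. ennreal c * (\<Sum>y\<in>{y\<in>{-1..1}. (f ^^ n) y = x}. h y) \<partial>LI)"
  proof (rule nn_integral_mono_AE)
    show "AE x in LI. ennreal (cmod ((\<Phi> ^^ n) u x) powr p) \<le> ennreal c * (\<Sum>y\<in>{y\<in>{-1..1}. (f ^^ n) y = x}. h y)"
      using AE_LI_finite[OF Z(1)] AE_space[of LI] by eventually_elim (use pt in auto)
  qed
  also have "\<dots> = ennreal c * (ennreal ?L * (\<integral>\<^sup>+x. h x \<partial>LI))"
    using nn_integral_fibre[OF mh, of n] by (simp add: nn_integral_cmult)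
  also have "(\<integral>\<^sup>+x. h x \<partial>LI) = ennreal (Lp_norm LI p u powr p)"
    unfolding h_def by (rule Lp_norm_nn_integral[OF p u])
  also have "ennreal c * (ennreal ?L * ennreal (Lp_norm LI p u powr p)) = ennreal (c * ?L * Lp_norm LI p u powr p)"
    using c0 less_imp_le[OF lam_power_pos[of n]] by (simp add: ennreal_mult mult.assoc)
  also have "\<dots> \<le> ennreal ((\<beta> * Lp_norm LI p u) powr p)"
    using cL \<beta> by (intro ennreal_leI) (simp add: powr_mult mult_right_mono)
  finally show "(\<integral>\<^sup>+x. ennreal (cmod ((\<Phi> ^^ n) u x) powr p) \<partial>LI) \<le> ennreal ((\<beta> * Lp_norm LI p u) powr p)" .
qed (use \<beta> in simp)

end

section \<open>The transfer operator on Besov spaces\<close>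

context tent_map
begin

definition core_cells :: "nat \<Rightarrow> real set \<Rightarrow> nat set" where
  "core_cells i J = {j. \<forall>x\<in>{-1..1}. didx i x = j \<longrightarrow> x \<in> J}"

text \<open>The cell index is monotone, so every cell strictly between the first and the last one
  met by J lies inside J. At most two cells of measure 2 / 2^i remain.\<close>

lemma boundary_cells_small:
  assumes J: "is_interval J" "J \<subseteq> {-1..1}" and Jm: "J \<in> sets lebesgue"
  shows "{x\<in>J. didx i x \<notin> core_cells i J} \<in> sets LI \<and> measure LI {x\<in>J. didx i x \<notin> core_cells i J} \<le> 4 / 2 ^ i"
proof -
  define Bad where "Bad = {x\<in>J. didx i x \<notin> core_cells i J}"
  have JLI: "J \<in> sets LI" using J Jm by (simp add: sets_restrict_space_iff)
  have "Bad = J \<inter> (didx i -` (- core_cells i J) \<inter> space LI)" using J by (auto simp: Bad_def)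
  then have Bs: "Bad \<in> sets LI"
    using JLI measurable_sets[OF didx_measurable_LI, of "- core_cells i J" i] by auto
  have "measure LI Bad \<le> 4 / 2 ^ i"
  proof (cases "J = {}")
    case True
    then show ?thesis by (simp add: Bad_def)
  next
    case False
    have fin: "finite (didx i ` J)" by (rule finite_subset[of _ "{..<2 ^ i}"]) auto
    define a where "a = Min (didx i ` J)"
    define b where "b = Max (didx i ` J)"
    have "a \<in> didx i ` J" "b \<in> didx i ` J" unfolding a_def b_def using Min_in[OF fin] Max_in[OF fin] False by simp_all
    then obtain xa xb where xa: "xa \<in> J" "didx i xa = a" and xb: "xb \<in> J" "didx i xb = b" by (metis imageE)
    let ?C = "\<lambda>j. {x\<in>{-1..1}. didx i x = j}"
    have sub: "Bad \<subseteq> ?C a \<union> ?C b"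
    proof
      fix x assume x: "x \<in> Bad"
      then have xJ: "x \<in> J" and nc: "didx i x \<notin> core_cells i J" by (auto simp: Bad_def)
      have ab: "a \<le> didx i x" "didx i x \<le> b" using xJ fin by (auto simp: a_def b_def)
      have "\<not> (a < didx i x \<and> didx i x < b)"
      proof
        assume lt: "a < didx i x \<and> didx i x < b"
        have "didx i x \<in> core_cells i J" unfolding core_cells_def
        proof (intro CollectI ballI impI)
          fix y assume y: "y \<in> {-1..1}" "didx i y = didx i x"
          have "xa \<le> y"
          proof (rule ccontr)
            assume "\<not> xa \<le> y"
            then have "didx i y \<le> didx i xa" by (intro didx_mono) simp
            then show False using lt xa(2) y(2) by simp
          qed
          moreover have "y \<le> xb"
          proof (rule ccontr)
            assume "\<not> y \<le> xb"
            then have "didx i xb \<le> didx i y" by (intro didx_mono) simp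
            then show False using lt xb(2) y(2) by simp
          qed
          ultimately show "y \<in> J" using J(1) xa(1) xb(1) unfolding is_interval_1 by blast
        qed
        then show False using nc by simp
      qed
      then show "x \<in> ?C a \<union> ?C b" using ab xJ J(2) by auto
    qed
    have "measure LI Bad \<le> measure LI (?C a \<union> ?C b)"
      by (intro finite_measure.finite_measure_mono[OF finite_measure_LI] sub sets.Un cell_sets)
    also have "\<dots> \<le> measure LI (?C a) + measure LI (?C b)"
      by (rule measure_Un_le[OF cell_sets cell_sets])
    also have "\<dots> = 4 / 2 ^ i"
      using measure_cell[of a i] measure_cell[of b i] xa(2) xb(2) didx_less[of i xa] didx_less[of i xb] by simp
    finally show ?thesis .
  qed
  then show ?thesis using Bs by (simp add: Bad_def)
qed

lemma is_interval_lap_image: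
  assumes "convex C"
  shows "is_interval ((f ^^ n) ` {y\<in>C. itin n y = A})"
proof -
  have "convex {y. itin n y = A}" using itin_affine[of n A] by blast
  then have "convex (C \<inter> {y. itin n y = A})" by (rule convex_Int[OF assms])
  moreover have "C \<inter> {y. itin n y = A} = {y\<in>C. itin n y = A}" by auto
  ultimately have "connected {y\<in>C. itin n y = A}" by (simp add: convex_connected)
  then have "connected ((f ^^ n) ` {y\<in>C. itin n y = A})"
    by (rule connected_continuous_image[OF continuous_iter])
  then show ?thesis by (simp add: is_interval_connected_1)
qed

lemma convex_cell: "convex {x\<in>{-1..1}. didx k x = j}"
proof -
  have "is_interval {x\<in>{-1..1}. didx k x = j}"
    unfolding is_interval_1
  proof clarify
    fix a b x assume *: "a \<in> {-1..1}" "b \<in> {-1..1}" "a \<le> x" "x \<le> b" "j = didx k a" "didx k b = didx k a"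
    then show "x \<in> {-1..1} \<and> didx k x = didx k a"
      using didx_mono[of a x k] didx_mono[of x b k] by auto
  qed
  then show ?thesis by (simp add: is_interval_convex_1)
qed

text \<open>The image of a step function is a sum of multiples of indicators of the intervals
  \<open>f\<^sup>n(lap \<inter> cell)\<close>. Replacing each interval by the union of the cells of the target grid that it
  contains changes it only on the two cells holding its endpoints.\<close>

lemma transfer_step_approx:
  assumes p: "p \<ge> 1" and \<beta>: "\<beta> \<ge> 1"
    and B: "real (card (itin n ` {-1..1})) \<le> \<beta> * lam ^ n"
    and three: "\<And>j. j < 2 ^ k \<Longrightarrow> card (itin n ` {y\<in>{-1..1}. didx k y = j}) \<le> 3"
    and g: "dstep (Suc k) g"
  shows "\<exists>v. dstep (Suc i) v \<and>
    Lp_norm LI p (\<lambda>x. (\<Phi> ^^ n) g x - v x) \<le> 12 * \<beta> * (2 ^ k / (2 ^ Suc i * lam ^ n)) powr (1 / p) * Lp_norm LI p g"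
proof -
  let ?L = "lam ^ n"
  have L0: "?L > 0" "?L \<ge> 0" using less_imp_le[OF lam_power_pos[of n]] by auto
  obtain a where a: "\<And>x. x \<in> {-1..1} \<Longrightarrow> g x = a (didx k x)" using g by auto
  have gL: "g \<in> Lp_space LI p" by (rule dstep_Lp[OF p g])
  \<comment> \<open>Pairs of a cell and the itinerary of a lap meeting it; \<open>D s\<close> is
    their intersection and \<open>J s\<close> its image under f^n.\<close>
  define S where "S = Sigma {..<2 ^ k} (\<lambda>j. itin n ` {y\<in>{-1..1}. didx k y = j})"
  have finS: "finite S" by (auto simp: S_def)
  define D where "D s = {y\<in>{x\<in>{-1..1}. didx k x = fst s}. itin n y = snd s}" for s
  define J where "J s = (f ^^ n) ` D s" for s
  have JI: "J s \<subseteq> {-1..1}" for s unfolding J_def D_def using iter_mem by blast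
  have Jint: "is_interval (J s)" for s unfolding J_def D_def by (rule is_interval_lap_image[OF convex_cell])
  have Jm: "J s \<in> sets lebesgue" for s
  proof -
    have "J s \<in> lmeasurable"
      using Jint[of s] JI[of s] by (intro measurable_convex bounded_subset[OF bounded_closed_interval]) (auto simp: is_interval_convex_1)
    then show ?thesis by (rule fmeasurableD)
  qed
  obtain Z where Z0: "finite Z \<and>
    (\<forall>u. \<forall>x\<in>{-1..1} - Z. (\<Phi> ^^ n) u x = (\<Sum>y\<in>{y\<in>{-1..1}. (f ^^ n) y = x}. u y) / of_real ?L)"
    using transfer_iter_eq[of n] by (rule exE)
  note Z = conjunct1[OF Z0] conjunct2[OF Z0, rule_format]
  have uniq: "s = s'" if "y \<in> D s" "y' \<in> D s'" "(f ^^ n) y = (f ^^ n) y'" "snd s = snd s'" for s s' y y'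
  proof -
    have y: "didx k y = fst s" "itin n y = snd s" "didx k y' = fst s'" "itin n y' = snd s'"
      using that(1,2) by (simp_all add: D_def)
    have "y = y'" by (rule itin_inj[OF _ that(3)]) (simp add: y that(4))
    then have "fst s = fst s'" using y by simp
    then show ?thesis using that(4) by (rule prod_eqI)
  qed
  \<comment> \<open>f^n is injective on every piece, so the preimages of x correspond to the pieces
    whose image contains x.\<close>
  have sum_eq: "(\<Sum>y\<in>{y\<in>{-1..1}. (f ^^ n) y = x}. g y) = (\<Sum>s\<in>{s\<in>S. x \<in> J s}. a (fst s))" for x
  proof (rule sum.reindex_bij_witness[where j = "\<lambda>y. (didx k y, itin n y)" and i = "\<lambda>s. THE y. y \<in> D s \<and> (f ^^ n) y = x"])
    fix y assume y: "y \<in> {y\<in>{-1..1}. (f ^^ n) y = x}"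
    then have yD: "y \<in> D (didx k y, itin n y)" by (simp add: D_def)
    then show "(THE z. z \<in> D (didx k y, itin n y) \<and> (f ^^ n) z = x) = y"
      using y by (intro the_equality) (auto simp: D_def intro: itin_inj[of n])
    show "(didx k y, itin n y) \<in> {s\<in>S. x \<in> J s}"
      using y yD by (auto simp: S_def J_def)
    show "a (fst (didx k y, itin n y)) = g y" using y a by simp
  next
    fix s assume s: "s \<in> {s\<in>S. x \<in> J s}"
    then obtain y where y: "y \<in> D s" "(f ^^ n) y = x" by (auto simp: J_def)
    have "(THE y. y \<in> D s \<and> (f ^^ n) y = x) = y"
      using y by (intro the_equality) (auto simp: D_def intro: itin_inj[of n])
    then show "(THE y. y \<in> D s \<and> (f ^^ n) y = x) \<in> {y\<in>{-1..1}. (f ^^ n) y = x}"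
      "(didx k (THE y. y \<in> D s \<and> (f ^^ n) y = x), itin n (THE y. y \<in> D s \<and> (f ^^ n) y = x)) = s"
      using y by (auto simp: D_def)
  qed
  define v where "v x = (\<Sum>s\<in>{s\<in>S. didx i x \<in> core_cells i (J s)}. a (fst s)) / of_real ?L" for x
  have vd: "dstep (Suc i) v"
    by (auto simp: v_def intro!: exI[of _ "\<lambda>j. (\<Sum>s\<in>{s\<in>S. j \<in> core_cells i (J s)}. a (fst s)) / of_real ?L"])
  define Bad where "Bad s = {x\<in>J s. didx i x \<notin> core_cells i (J s)}" for s
  have Bad: "Bad s \<in> sets LI" "measure LI (Bad s) \<le> 4 / 2 ^ i" for s
    using boundary_cells_small[OF Jint[of s] JI[of s] Jm[of s], of i] by (auto simp: Bad_def)
  \<comment> \<open>Pieces whose images share a point have different itineraries: a common itinerary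
    would force the same preimage and hence the same cell.\<close>
  have cardB: "card {s\<in>S. x \<in> J s} \<le> card (itin n ` {-1..1})" for x
  proof (rule card_inj_on_le[where f = snd])
    show "inj_on snd {s\<in>S. x \<in> J s}"
    proof (rule inj_onI)
      fix s s' assume *: "s \<in> {s\<in>S. x \<in> J s}" "s' \<in> {s\<in>S. x \<in> J s}" "snd s = snd s'"
      then obtain y y' where "y \<in> D s" "(f ^^ n) y = x" "y' \<in> D s'" "(f ^^ n) y' = x" by (auto simp: J_def)
      then show "s = s'" using uniq[where s = s and s' = s' and y = y and y' = y'] * by simp
    qed
    show "snd ` {s\<in>S. x \<in> J s} \<subseteq> itin n ` {-1..1}" by (auto simp: S_def)
  qed simp
  define c where "c = (\<beta> * ?L) powr (p - 1) / ?L powr p"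
  have c0: "c \<ge> 0" by (simp add: c_def)
  have pt: "cmod ((\<Phi> ^^ n) g x - v x) powr p \<le> c * (\<Sum>s\<in>S. cmod (a (fst s)) powr p * indicator (Bad s) x)"
    if x: "x \<in> {-1..1} - Z" for x
  proof -
    let ?SB = "{s\<in>S. x \<in> Bad s}"
    have xI: "x \<in> {-1..1}" using x by simp
    \<comment> \<open>Pieces whose image contains the whole cell of x cancel against v; those for
      which x is in a boundary cell remain.\<close>
    have "{s\<in>S. x \<in> J s} = {s\<in>S. didx i x \<in> core_cells i (J s)} \<union> ?SB"
      using xI by (auto simp: Bad_def core_cells_def)
    then have "(\<Sum>s\<in>{s\<in>S. x \<in> J s}. a (fst s)) = (\<Sum>s\<in>{s\<in>S. didx i x \<in> core_cells i (J s)}. a (fst s)) + (\<Sum>s\<in>?SB. a (fst s))"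
      using finS by (simp only:) (rule sum.union_disjoint, auto simp: Bad_def)
    then have "(\<Phi> ^^ n) g x - v x = (\<Sum>s\<in>?SB. a (fst s)) / of_real ?L"
      unfolding Z(2)[OF x] sum_eq v_def by (simp add: add_divide_distrib)
    then have "cmod ((\<Phi> ^^ n) g x - v x) = cmod (\<Sum>s\<in>?SB. a (fst s)) / ?L"
      using lam(3) by (simp add: norm_divide norm_power)
    also have "\<dots> \<le> (\<Sum>s\<in>?SB. cmod (a (fst s))) / ?L"
      using L0 by (intro divide_right_mono norm_sum) auto
    finally have "cmod ((\<Phi> ^^ n) g x - v x) powr p \<le> ((\<Sum>s\<in>?SB. cmod (a (fst s))) / ?L) powr p"
      using p by (intro powr_mono2) auto
    also have "\<dots> = (\<Sum>s\<in>?SB. cmod (a (fst s))) powr p / ?L powr p"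
      using L0 by (simp add: powr_divide sum_nonneg)
    also have "\<dots> \<le> (real (card ?SB) powr (p - 1) * (\<Sum>s\<in>?SB. cmod (a (fst s)) powr p)) / ?L powr p"
      using p finS by (intro divide_right_mono powr_sum_le) auto
    also have "\<dots> \<le> ((\<beta> * ?L) powr (p - 1) * (\<Sum>s\<in>?SB. cmod (a (fst s)) powr p)) / ?L powr p"
    proof (intro divide_right_mono mult_right_mono powr_mono2)
      have "card ?SB \<le> card {s\<in>S. x \<in> J s}" using finS by (intro card_mono) (auto simp: Bad_def)
      also have "\<dots> \<le> card (itin n ` {-1..1})" by (rule cardB)
      finally show "real (card ?SB) \<le> \<beta> * ?L" using B by linarith
    qed (use p in \<open>auto intro: sum_nonneg\<close>)
    also have "\<dots> = c * (\<Sum>s\<in>?SB. cmod (a (fst s)) powr p)" by (simp add: c_def)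
    also have "(\<Sum>s\<in>?SB. cmod (a (fst s)) powr p) = (\<Sum>s\<in>S. cmod (a (fst s)) powr p * indicator (Bad s) x)"
      using finS by (simp add: indicator_def if_distrib sum.If_cases Int_def cong: if_cong)
    finally show ?thesis .
  qed
  have uL: "(\<lambda>x. (\<Phi> ^^ n) g x - v x) \<in> Lp_space LI p"
    using transfer_iter_Lp[OF p gL \<beta> B] by (intro Lp_space_diff p dstep_Lp[OF p vd]) auto
  have int: "integrable LI (indicator (Bad s) :: real \<Rightarrow> real)" for s
    using finite_measure.emeasure_finite[OF finite_measure_LI] Bad(1)[of s]
    by (intro integrable_real_indicator) (auto simp: less_top)
  have "(\<integral>x. cmod ((\<Phi> ^^ n) g x - v x) powr p \<partial>LI) \<le> (\<integral>x. c * (\<Sum>s\<in>S. cmod (a (fst s)) powr p * indicator (Bad s) x) \<partial>LI)"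
  proof (rule integral_mono_AE)
    show "AE x in LI. cmod ((\<Phi> ^^ n) g x - v x) powr p \<le> c * (\<Sum>s\<in>S. cmod (a (fst s)) powr p * indicator (Bad s) x)"
      using AE_LI_finite[OF Z(1)] AE_space[of LI] by eventually_elim (use pt in auto)
    show "integrable LI (\<lambda>x. c * (\<Sum>s\<in>S. cmod (a (fst s)) powr p * indicator (Bad s) x))"
      by (intro integrable_mult_right Bochner_Integration.integrable_sum int)
  qed (rule Lp_spaceD(2)[OF uL])
  also have "\<dots> = c * (\<Sum>s\<in>S. cmod (a (fst s)) powr p * measure LI (Bad s))"
  proof -
    have "(\<integral>x. (\<Sum>s\<in>S. cmod (a (fst s)) powr p * indicator (Bad s) x) \<partial>LI)
       = (\<Sum>s\<in>S. \<integral>x. cmod (a (fst s)) powr p * indicator (Bad s) x \<partial>LI)"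
      by (intro Bochner_Integration.integral_sum integrable_mult_right int)
    also have "\<dots> = (\<Sum>s\<in>S. cmod (a (fst s)) powr p * measure LI (Bad s))"
    proof (intro sum.cong refl)
      fix s
      have "Bad s \<inter> {-1..1} = Bad s" using JI[of s] by (auto simp: Bad_def)
      then show "(\<integral>x. cmod (a (fst s)) powr p * indicator (Bad s) x \<partial>LI) = cmod (a (fst s)) powr p * measure LI (Bad s)"
        by simp
    qed
    finally show ?thesis by simp
  qed
  also have "\<dots> \<le> c * (\<Sum>s\<in>S. cmod (a (fst s)) powr p * (4 / 2 ^ i))"
    by (intro mult_left_mono sum_mono c0 Bad(2)) auto
  also have "(\<Sum>s\<in>S. cmod (a (fst s)) powr p * (4 / 2 ^ i)) = (\<Sum>s\<in>S. cmod (a (fst s)) powr p) * (4 / 2 ^ i)"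
    by (rule sum_distrib_right[symmetric])
  finally have I0: "(\<integral>x. cmod ((\<Phi> ^^ n) g x - v x) powr p \<partial>LI) \<le> c * ((\<Sum>s\<in>S. cmod (a (fst s)) powr p) * (4 / 2 ^ i))" .
  have "(\<Sum>s\<in>S. cmod (a (fst s)) powr p) = (\<Sum>j<2 ^ k. real (card (itin n ` {y\<in>{-1..1}. didx k y = j})) * cmod (a j) powr p)"
  proof -
    have "(\<Sum>s\<in>S. cmod (a (fst s)) powr p) = (\<Sum>(j, A)\<in>S. cmod (a j) powr p)" by (simp add: case_prod_beta)
    also have "\<dots> = (\<Sum>j<2 ^ k. \<Sum>A\<in>itin n ` {y\<in>{-1..1}. didx k y = j}. cmod (a j) powr p)"
      unfolding S_def by (rule sum.Sigma[symmetric]) simp_all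
    finally show ?thesis by simp
  qed
  also have "\<dots> \<le> (\<Sum>j<2 ^ k. 3 * cmod (a j) powr p)"
    using three by (intro sum_mono mult_right_mono) auto
  also have "\<dots> = 3 * (2 ^ k / 2) * (2 / 2 ^ k * (\<Sum>j<2 ^ k. cmod (a j) powr p))"
    by (simp add: sum_distrib_left)
  also have "2 / 2 ^ k * (\<Sum>j<2 ^ k. cmod (a j) powr p) = Lp_norm LI p g powr p"
    using step_Lp(2)[OF p, of a k] Lp_norm_LI_cong[of g "\<lambda>x. a (didx k x)" p] a by simp
  finally have "c * ((\<Sum>s\<in>S. cmod (a (fst s)) powr p) * (4 / 2 ^ i)) \<le> c * (3 * (2 ^ k / 2) * Lp_norm LI p g powr p * (4 / 2 ^ i))"
    by (intro mult_left_mono[OF _ c0] mult_right_mono) auto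
  with I0 have I1: "(\<integral>x. cmod ((\<Phi> ^^ n) g x - v x) powr p \<partial>LI) \<le> c * (3 * (2 ^ k / 2) * Lp_norm LI p g powr p * (4 / 2 ^ i))"
    by (rule order_trans)
  let ?r = "2 ^ k / (2 ^ Suc i * ?L)"
  have cL: "c = \<beta> powr (p - 1) / ?L"
  proof -
    have "?L powr p = ?L powr (p - 1) * ?L"
      using powr_mult_base[OF L0(2), of "p - 1"] by (simp add: mult.commute)
    then show ?thesis using \<beta> L0 by (simp add: c_def powr_mult)
  qed
  \<comment> \<open>The factor 12 is made of 3 pieces per source cell and the 4 from the boundary
    measure 4 / 2^i.\<close>
  have "c * (3 * (2 ^ k / 2) * Lp_norm LI p g powr p * (4 / 2 ^ i)) = 12 * \<beta> powr (p - 1) * ?r * Lp_norm LI p g powr p"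
    using L0 by (simp add: cL)
  also have "\<dots> \<le> (12 * \<beta>) powr p * ?r * Lp_norm LI p g powr p"
  proof (intro mult_right_mono)
    have "12 powr 1 * \<beta> powr (p - 1) \<le> 12 powr p * \<beta> powr p"
      using p \<beta> by (intro mult_mono powr_mono) auto
    then show "12 * \<beta> powr (p - 1) \<le> (12 * \<beta>) powr p" using \<beta> by (simp add: powr_mult)
  qed (use L0 in auto)
  also have "\<dots> = (12 * \<beta> * ?r powr (1 / p) * Lp_norm LI p g) powr p"
    using p \<beta> L0 by (simp add: powr_mult powr_powr)
  finally have "Lp_norm LI p (\<lambda>x. (\<Phi> ^^ n) g x - v x) \<le> 12 * \<beta> * ?r powr (1 / p) * Lp_norm LI p g"
    using I1 \<beta> by (intro Lp_norm_leI[OF p]) auto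
  then show ?thesis using vd by blast
qed

end

section \<open>Contraction on fine scales\<close>

locale tent_besov = tent_map t + besov_params s p q for t s p :: real and q :: ereal
begin

text \<open>The slower of two decay rates. Source levels below the matching level i + m decay at
  rate 2^(-(1/p - s)) by step approximation, levels above it at rate 2^(-s) by the plain L^p bound.
  That it is below 1 is where s < 1/p enters.\<close>

definition dec :: real where
  "dec = max (2 powr (- s)) (2 powr (- (1 / p - s)))"

lemma dec: "0 < dec" "dec < 1"
  using s by (auto simp: dec_def less_max_iff_disj powr_less_one)

lemma dec_ge: "2 powr (- s * real d) \<le> dec ^ d" "2 powr (- (1 / p - s) * real d) \<le> dec ^ d"
proof -
  have "2 powr (- s * real d) = (2 powr (- s)) ^ d" by (simp add: powr_powr flip: powr_realpow)
  also have "\<dots> \<le> dec ^ d" by (rule power_mono) (auto simp: dec_def)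
  finally show "2 powr (- s * real d) \<le> dec ^ d" .
  have "2 powr (- (1 / p - s) * real d) = (2 powr (- (1 / p - s))) ^ d" by (subst powr_powr[symmetric]) (simp add: powr_realpow)
  also have "\<dots> \<le> dec ^ d" by (rule power_mono) (auto simp: dec_def)
  finally show "2 powr (- (1 / p - s) * real d) \<le> dec ^ d" .
qed

text \<open>To bound the error of the image at level i, split the argument into jumps of levels k0
  up to K, approximated by \<open>transfer_step_approx\<close>, and a rest beyond K, bounded in L^p.
  Since f^n expands by at least 2^m, source level i + m matches target level i, and the matching
  weights differ by 2^(-ms): this is the contraction factor. The bound does not depend on
  k0.\<close>

lemma transfer_iter_remainder:
  assumes \<beta>: "\<beta> \<ge> 1" and B: "real (card (itin n ` {-1..1})) \<le> \<beta> * lam ^ n"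
    and m: "2 ^ m \<le> lam ^ n" "m \<le> k0"
    and three: "\<And>k j. k \<ge> k0 \<Longrightarrow> j < 2 ^ k \<Longrightarrow> card (itin n ` {y\<in>{-1..1}. didx k y = j}) \<le> 3"
    and u: "u \<in> BV"
  shows "(\<Phi> ^^ n) (\<lambda>x. u x - cexp k0 u x) \<in> BV \<and>
    BN ((\<Phi> ^^ n) (\<lambda>x. u x - cexp k0 u x)) \<le> 50 * \<beta> * 2 powr (- real m * s) * (2 / (1 - dec)) * BN u"
proof -
  define w where "w = (\<Phi> ^^ n) (\<lambda>x. u x - cexp k0 u x)"
  have uL: "u \<in> Lp_space LI p" by (rule BVD(1)[OF u])
  have wL: "w \<in> Lp_space LI p" unfolding w_def
    using transfer_iter_Lp[OF p Lp_space_diff[OF p uL cexp_Lp[OF p]] \<beta> B] by blast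
  define h where "h k = (\<lambda>x. cexp (Suc k) u x - cexp k u x)" for k
  have hd: "dstep (Suc k) (h k)" for k unfolding h_def by (intro dstep_diff dstep_Suc dstep_cexp)
  have hL: "h k \<in> Lp_space LI p" for k by (rule dstep_Lp[OF p hd])
  let ?c = "50 * \<beta> * 2 powr (- real m * s)"
  have "lq_fin q (bseq w) \<and> lq_norm q (bseq w) \<le> ?c * (2 / (1 - dec)) * lq_norm q (bseq u)"
  proof (rule lq_schur_geometric[where m = "int m", OF q dec _ bseq_nonneg BVD(2)[OF u]])
    fix i :: nat and e :: real assume e: "e > 0"
    \<comment> \<open>At i = 0 the only step function is zero, so nothing can be approximated and
      the range of jumps is left empty; \<open>m(2)\<close> still ensures i + m <= K.\<close>
    define K where "K = (if i = 0 then k0 else max (i + m) k0)"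
    have K: "k0 \<le> K" "i + m \<le> K" using m(2) by (auto simp: K_def)
    have KI: "K = i + m" "i \<noteq> 0" if "k0 < K" using that by (auto simp: K_def split: if_splits)
    let ?r = "\<lambda>k. (2 ^ k / (2 ^ i * lam ^ n)) powr (1 / p)"
    have "\<forall>k\<in>{k0..<K}. \<exists>v. dstep i v \<and> Lp_norm LI p (\<lambda>x. (\<Phi> ^^ n) (h k) x - v x) \<le> 12 * \<beta> * ?r k * Lp_norm LI p (h k)"
    proof
      fix k assume k: "k \<in> {k0..<K}"
      then have "i \<noteq> 0" using KI(2) by simp
      then obtain i' where "i = Suc i'" by (metis not0_implies_Suc)
      then show "\<exists>v. dstep i v \<and> Lp_norm LI p (\<lambda>x. (\<Phi> ^^ n) (h k) x - v x) \<le> 12 * \<beta> * ?r k * Lp_norm LI p (h k)"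
        by (simp only:) (rule transfer_step_approx[OF p \<beta> B three hd], use k in auto)
    qed
    from bchoice[OF this] obtain v where v': "\<forall>k\<in>{k0..<K}. dstep i (v k) \<and>
      Lp_norm LI p (\<lambda>x. (\<Phi> ^^ n) (h k) x - v k x) \<le> 12 * \<beta> * ?r k * Lp_norm LI p (h k)"
      by (rule exE)
    note v = conjunct1[OF v'[THEN bspec]] conjunct2[OF v'[THEN bspec]]
    define rest where "rest = (\<lambda>x. u x - cexp K u x)"
    have restL: "rest \<in> Lp_space LI p" unfolding rest_def by (intro Lp_space_diff p uL cexp_Lp)
    have "(\<Sum>k\<in>{k0..<K}. h k x) = cexp K u x - cexp k0 u x" for x
      unfolding h_def by (rule sum_Suc_diff'[OF K(1)])
    then have "(\<lambda>x. u x - cexp k0 u x) = (\<lambda>x. (\<Sum>k\<in>{k0..<K}. h k x) + rest x)"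
      by (simp add: rest_def)
    then have weq: "w = (\<lambda>x. (\<Sum>k\<in>{k0..<K}. (\<Phi> ^^ n) (h k) x) + (\<Phi> ^^ n) rest x)"
      unfolding w_def by (simp add: transfer_iter_add transfer_iter_sum)
    have dL: "(\<lambda>x. (\<Phi> ^^ n) (h k) x - v k x) \<in> Lp_space LI p" if "k \<in> {k0..<K}" for k
      by (rule Lp_space_diff[OF p conjunct1[OF transfer_iter_Lp[OF p hL \<beta> B]] dstep_Lp[OF p v(1)[OF that]]])
    have RL: "(\<Phi> ^^ n) rest \<in> Lp_space LI p" "Lp_norm LI p ((\<Phi> ^^ n) rest) \<le> \<beta> * aerr p K u"
      using transfer_iter_Lp[OF p restL \<beta> B] by (auto simp: rest_def aerr_def)
    have "aerr p i w \<le> 2 * Lp_norm LI p (\<lambda>x. w x - (\<Sum>k\<in>{k0..<K}. v k x))"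
      by (intro aerr_le p wL dstep_sum v(1))
    also have "(\<lambda>x. w x - (\<Sum>k\<in>{k0..<K}. v k x)) = (\<lambda>x. (\<Sum>k\<in>{k0..<K}. (\<Phi> ^^ n) (h k) x - v k x) + (\<Phi> ^^ n) rest x)"
      unfolding weq by (simp add: sum_subtractf algebra_simps)
    also have "Lp_norm LI p \<dots> \<le> Lp_norm LI p (\<lambda>x. \<Sum>k\<in>{k0..<K}. (\<Phi> ^^ n) (h k) x - v k x) + Lp_norm LI p ((\<Phi> ^^ n) rest)"
      by (intro Lp_norm_triangle p Lp_space_sum dL RL)
    also have "\<dots> \<le> (\<Sum>k\<in>{k0..<K}. 12 * \<beta> * ?r k * (aerr p k u + aerr p (Suc k) u)) + \<beta> * aerr p K u"
    proof (intro add_mono RL order_trans[OF Lp_norm_sum[OF p dL]] sum_mono)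
      fix k assume k: "k \<in> {k0..<K}"
      have "Lp_norm LI p (h k) \<le> aerr p k u + aerr p (Suc k) u" unfolding h_def by (rule cexp_jump_le[OF p uL])
      then have "12 * \<beta> * ?r k * Lp_norm LI p (h k) \<le> 12 * \<beta> * ?r k * (aerr p k u + aerr p (Suc k) u)"
        using \<beta> by (intro mult_left_mono) auto
      then show "Lp_norm LI p (\<lambda>x. (\<Phi> ^^ n) (h k) x - v k x) \<le> 12 * \<beta> * ?r k * (aerr p k u + aerr p (Suc k) u)"
        using v(2)[OF k] by linarith
    qed
    finally have "bseq w i \<le> 2 powr (real i * s) * (2 * ((\<Sum>k\<in>{k0..<K}. 12 * \<beta> * ?r k * (aerr p k u + aerr p (Suc k) u)) + \<beta> * aerr p K u))"
      unfolding bseq_def by (intro mult_left_mono) auto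
    also have "\<dots> = 24 * \<beta> * (\<Sum>k\<in>{k0..<K}. 2 powr (real i * s) * ?r k * aerr p k u)
        + 24 * \<beta> * (\<Sum>k\<in>{k0..<K}. 2 powr (real i * s) * ?r k * aerr p (Suc k) u) + 2 * \<beta> * (2 powr (real i * s) * aerr p K u)"
      by (simp add: sum_distrib_left sum.distrib algebra_simps)
    finally have b1: "bseq w i \<le> 24 * \<beta> * (\<Sum>k\<in>{k0..<K}. 2 powr (real i * s) * ?r k * aerr p k u)
        + 24 * \<beta> * (\<Sum>k\<in>{k0..<K}. 2 powr (real i * s) * ?r k * aerr p (Suc k) u) + 2 * \<beta> * (2 powr (real i * s) * aerr p K u)" .
    define W where "W k = 2 powr (- real m * s) * dec ^ nat \<bar>int k - (int i + int m)\<bar> * bseq u k" for k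
    have W0: "W k \<ge> 0" for k using dec by (simp add: W_def)
    have aerr_bseq: "aerr p k u = 2 powr (- real k * s) * bseq u k" for k
      by (simp add: bseq_def flip: powr_add mult.assoc)
    have r_le: "?r k \<le> 2 powr (- real (K - k) / p)" if "k \<in> {k0..<K}" for k
    proof -
      have K': "K = i + m" using KI that by auto
      have "2 ^ k / (2 ^ i * lam ^ n) \<le> 2 ^ k / (2 ^ i * 2 ^ m)"
        using m(1) by (intro divide_left_mono mult_left_mono) auto
      also have "\<dots> = 2 powr (- real (K - k))"
        using that K' by (simp add: powr_diff powr_add powr_realpow)
      finally have "?r k \<le> (2 powr (- real (K - k))) powr (1 / p)"
        using p less_imp_le[OF lam_power_pos[of n]] by (intro powr_mono2) auto
      then show ?thesis by (simp add: powr_powr)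
    qed
    have t1: "2 powr (real i * s) * ?r k * aerr p k u \<le> W k" if k: "k \<in> {k0..<K}" for k
    proof -
      have K': "K = i + m" "k < i + m" using KI k by auto
      then have d: "real (K - k) = real i + real m - real k" by (simp add: of_nat_diff)
      have "2 powr (real i * s) * ?r k * aerr p k u \<le> 2 powr (real i * s) * 2 powr (- real (K - k) / p) * aerr p k u"
        by (intro mult_right_mono mult_left_mono r_le k) auto
      also have "\<dots> = 2 powr (- real m * s) * 2 powr (- (1 / p - s) * real (K - k)) * bseq u k"
        unfolding aerr_bseq d
        by (simp add: algebra_simps diff_divide_distrib add_divide_distrib flip: powr_add mult.assoc)
      also have "\<dots> \<le> 2 powr (- real m * s) * dec ^ (K - k) * bseq u k"
        by (intro mult_right_mono mult_left_mono dec_ge) auto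
      also have "K - k = nat \<bar>int k - (int i + int m)\<bar>" using K' by simp
      finally show ?thesis by (simp add: W_def)
    qed
    \<comment> \<open>The second half of a jump sits at level k + 1, one step closer to i + m: a
      factor 2^(-s) is gained and dropped, and one power of \<open>dec\<close> is given
      away.\<close>
    have t2: "2 powr (real i * s) * ?r k * aerr p (Suc k) u \<le> W (Suc k)" if k: "k \<in> {k0..<K}" for k
    proof -
      have K': "K = i + m" "k < i + m" using KI k by auto
      then have d: "real (K - k) = real i + real m - real k" by (simp add: of_nat_diff)
      have "2 powr (real i * s) * ?r k * aerr p (Suc k) u \<le> 2 powr (real i * s) * 2 powr (- real (K - k) / p) * aerr p (Suc k) u"
        by (intro mult_right_mono mult_left_mono r_le k) auto
      also have "\<dots> = 2 powr (- s) * (2 powr (- real m * s) * 2 powr (- (1 / p - s) * real (K - k)) * bseq u (Suc k))"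
        unfolding aerr_bseq d
        by (simp add: algebra_simps diff_divide_distrib add_divide_distrib flip: powr_add mult.assoc)
      also have "\<dots> \<le> 1 * (2 powr (- real m * s) * dec ^ (K - k) * bseq u (Suc k))"
      proof (rule mult_mono)
        show "2 powr (- s) \<le> (1 :: real)" using s by (intro less_imp_le[OF powr_less_one]) auto
      next
        show "2 powr (- real m * s) * 2 powr (- (1 / p - s) * real (K - k)) * bseq u (Suc k)
            \<le> 2 powr (- real m * s) * dec ^ (K - k) * bseq u (Suc k)"
          by (intro mult_right_mono mult_left_mono dec_ge) auto
      qed auto
      also have "\<dots> \<le> 2 powr (- real m * s) * dec ^ (K - Suc k) * bseq u (Suc k)"
        using dec by (simp, intro mult_right_mono mult_left_mono power_decreasing) auto
      also have "K - Suc k = nat \<bar>int (Suc k) - (int i + int m)\<bar>" using K' by simp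
      finally show ?thesis by (simp add: W_def)
    qed
    have t3: "2 powr (real i * s) * aerr p K u \<le> W K"
    proof -
      have d: "real (K - (i + m)) = real K - (real i + real m)" using K by (simp add: of_nat_diff)
      have "2 powr (real i * s) * aerr p K u = 2 powr (- real m * s) * 2 powr (- s * real (K - (i + m))) * bseq u K"
        unfolding aerr_bseq d by (simp add: algebra_simps flip: powr_add mult.assoc)
      also have "\<dots> \<le> 2 powr (- real m * s) * dec ^ (K - (i + m)) * bseq u K"
        by (intro mult_right_mono mult_left_mono dec_ge) auto
      also have "K - (i + m) = nat \<bar>int K - (int i + int m)\<bar>" using K by simp
      finally show ?thesis by (simp add: W_def)
    qed
    have s1: "(\<Sum>k\<in>{k0..<K}. 2 powr (real i * s) * ?r k * aerr p k u) \<le> (\<Sum>k<Suc K. W k)"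
      by (intro order_trans[OF sum_mono[OF t1] sum_mono2]) (auto simp: W0)
    have s2: "(\<Sum>k\<in>{k0..<K}. 2 powr (real i * s) * ?r k * aerr p (Suc k) u) \<le> (\<Sum>k<Suc K. W k)"
    proof -
      have "(\<Sum>k\<in>{k0..<K}. 2 powr (real i * s) * ?r k * aerr p (Suc k) u) \<le> (\<Sum>k\<in>{k0..<K}. W (Suc k))"
        by (rule sum_mono[OF t2])
      also have "\<dots> = (\<Sum>k\<in>{Suc k0..<Suc K}. W k)" by (rule sum.shift_bounds_Suc_ivl[symmetric])
      also have "\<dots> \<le> (\<Sum>k<Suc K. W k)" by (rule sum_mono2) (auto simp: W0)
      finally show ?thesis .
    qed
    have s3: "2 powr (real i * s) * aerr p K u \<le> (\<Sum>k<Suc K. W k)"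
      using t3 member_le_sum[of K "{..<Suc K}" W] W0 by fastforce
    have "bseq w i \<le> 24 * \<beta> * (\<Sum>k<Suc K. W k) + 24 * \<beta> * (\<Sum>k<Suc K. W k) + 2 * \<beta> * (\<Sum>k<Suc K. W k)"
      using \<beta> by (intro order_trans[OF b1] add_mono mult_left_mono s1 s2 s3) auto
    \<comment> \<open>24 is the 12 of the step approximation times the 2 of \<open>aerr_le\<close>,
      once for each half of the jumps; the rest term adds 2.\<close>
    also have "\<dots> = 50 * \<beta> * (\<Sum>k<Suc K. W k)"
    proof -
      have "24 * \<beta> * S + 24 * \<beta> * S + 2 * \<beta> * S = 50 * \<beta> * S" for S :: real by simp
      then show ?thesis .
    qed
    also have "\<dots> = (\<Sum>k<Suc K. ?c * dec ^ nat \<bar>int k - (int i + int m)\<bar> * bseq u k)"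
      unfolding sum_distrib_left by (intro sum.cong refl) (simp add: W_def)
    finally show "\<exists>n. bseq w i \<le> (\<Sum>k<n. ?c * dec ^ nat \<bar>int k - (int i + int m)\<bar> * bseq u k) + e"
      using e by (intro exI[of _ "Suc K"]) linarith
  qed (use \<beta> in auto)
  then show ?thesis using wL unfolding w_def[symmetric] by (simp add: BV_def BN_def)
qed

end

lemma lq_fin_finite_support:
  assumes q: "1 \<le> q" and x: "\<And>k. k \<ge> n \<Longrightarrow> x k = 0"
  shows "lq_fin q x"
  using q
proof (cases rule: ereal_ge_1_cases)
  case 1
  have "range x \<subseteq> x ` {..<n} \<union> {0}"
  proof (rule image_subsetI)
    fix k
    show "x k \<in> x ` {..<n} \<union> {0}" by (cases "k < n") (auto simp: x)
  qed
  then have "finite (range x)" by (rule finite_subset) simp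
  then show ?thesis using 1 by (simp add: lq_fin_def bdd_above_finite)
next
  case (2 r)
  have "summable (\<lambda>k. x k powr r)"
    by (rule summable_finite[of "{..<n}"]) (use x in auto)
  then show ?thesis using 2 by (simp add: lq_fin_def)
qed

lemma dyadic_floor:
  fixes x :: real
  assumes "x \<ge> 1"
  shows "\<exists>m. 2 ^ m \<le> x \<and> x \<le> 2 ^ Suc m"
proof -
  define m where "m = nat \<lfloor>log 2 x\<rfloor>"
  have "log 2 x \<ge> 0" using assms by simp
  then have "real m \<le> log 2 x" "log 2 x \<le> real m + 1" unfolding m_def by linarith+
  then have "2 powr real m \<le> 2 powr log 2 x" "2 powr log 2 x \<le> 2 powr (real m + 1)" by simp_all
  then have "2 ^ m \<le> x" "x \<le> 2 ^ Suc m" using assms by (simp_all add: powr_add powr_realpow mult.commute)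
  then show ?thesis by blast
qed

text \<open>Continuity of the coefficient functionals of the finite rank part. Indices beyond the
  grid give empty cells and the value 0.\<close>

lemma davg_bound:
  assumes p: "p \<ge> 1" and u: "u \<in> Lp_space LI p"
  shows "cmod (davg k j u) \<le> (2 ^ k / 2) powr (1 / p) * Lp_norm LI p u"
proof (cases "j < 2 ^ k")
  case True
  have "2 / 2 ^ k * cmod (davg k j u) powr p \<le> (\<integral>x. (if didx k x = j then cmod (u x) powr p else 0) \<partial>LI)"
    by (rule davg_jensen[OF p u True])
  also have "\<dots> \<le> (\<integral>x. cmod (u x) powr p \<partial>LI)"
    by (intro integral_mono integrable_on_cell Lp_spaceD(2)[OF u]) auto
  finally have "cmod (davg k j u) powr p \<le> 2 ^ k / 2 * Lp_norm LI p u powr p"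
    by (simp add: Lp_norm_powr[OF p] field_simps)
  then have le: "(cmod (davg k j u) powr p) powr (1 / p) \<le> (2 ^ k / 2 * Lp_norm LI p u powr p) powr (1 / p)"
    using p by (intro powr_mono2) auto
  note le
  also have "(2 ^ k / 2 * Lp_norm LI p u powr p) powr (1 / p) = (2 ^ k / 2) powr (1 / p) * Lp_norm LI p u"
    using p by (subst powr_mult) (simp_all add: powr_powr)
  finally show ?thesis using p by (simp add: powr_powr)
next
  case False
  then have "didx k x \<noteq> j" for x using didx_less[of k x] by linarith
  then show ?thesis by (simp add: davg_def)
qed

context tent_map
begin

lemma itin_small_cells:
  "\<exists>k0. \<forall>k\<ge>k0. \<forall>j<2 ^ k. card (itin n ` {y\<in>{-1..1}. didx k y = j}) \<le> 3"
proof -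
  obtain \<epsilon> where e: "\<epsilon> > 0" and loc: "\<forall>Y. (\<forall>x\<in>Y. \<forall>y\<in>Y. \<bar>x - y\<bar> \<le> \<epsilon>) \<longrightarrow> card (itin n ` Y) \<le> 3"
    using itin_local[of n] by blast
  obtain k0 where k0: "2 / \<epsilon> < 2 ^ k0" using real_arch_pow[of 2 "2 / \<epsilon>"] by auto
  have "card (itin n ` {y\<in>{-1..1}. didx k y = j}) \<le> 3" if k: "k \<ge> k0" and j: "j < 2 ^ k" for k j
  proof (rule loc[rule_format])
    fix x y assume "x \<in> {y\<in>{-1..1}. didx k y = j}" "y \<in> {y\<in>{-1..1}. didx k y = j}"
    then have "x \<in> dyadic_cell k j" "y \<in> dyadic_cell k j" using j by (auto simp: dyadic_cell_eq)
    moreover have "dyadic_cell k j \<subseteq> {-1 + 2 * real j / 2 ^ k .. -1 + 2 * real (Suc j) / 2 ^ k}"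
    proof -
      have "(-1 + 2 * real j / 2 ^ k) \<le> 1 \<and> 1 \<le> -1 + 2 * real (Suc j) / 2 ^ k" if "Suc j = 2 ^ k"
      proof -
        have r: "real j + 1 = 2 ^ k" using that by (metis of_nat_Suc of_nat_numeral of_nat_power add.commute)
        then have "real (Suc j) = 2 ^ k" "real j \<le> 2 ^ k" by linarith+
        then show ?thesis by (simp add: divide_le_eq del: of_nat_Suc)
      qed
      then show ?thesis by (auto simp: dyadic_cell_def simp del: of_nat_Suc split: if_splits)
    qed
    ultimately have "-1 + 2 * real j / 2 ^ k \<le> x" "x \<le> -1 + 2 * real (Suc j) / 2 ^ k"
      "-1 + 2 * real j / 2 ^ k \<le> y" "y \<le> -1 + 2 * real (Suc j) / 2 ^ k" by auto
    moreover have "2 * real (Suc j) / 2 ^ k = 2 * real j / 2 ^ k + 2 / 2 ^ k" by (simp add: field_simps)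
    ultimately have "\<bar>x - y\<bar> \<le> 2 / 2 ^ k" by linarith
    also have "\<dots> \<le> 2 / 2 ^ k0" using k by (intro divide_left_mono power_increasing) auto
    also have "\<dots> \<le> \<epsilon>" using k0 e by (simp add: field_simps)
    finally show "\<bar>x - y\<bar> \<le> \<epsilon>" .
  qed
  then show ?thesis by blast
qed

end

section \<open>Boundedness and the Fredholm property on the Besov space\<close>

context tent_besov
begin

lemma dstep_BV:
  assumes "dstep i g"
  shows "g \<in> BV"
proof -
  have "bseq g k = 0" if "k \<ge> i" for k
  proof -
    have "aerr p k g = Lp_norm LI p (\<lambda>x. 0)"
      unfolding aerr_def using cexp_dstep[OF dstep_mono[OF that assms]] by (intro Lp_norm_LI_cong) simp
    then show ?thesis by (simp add: bseq_def)
  qed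
  then show ?thesis using dstep_Lp[OF p assms] lq_fin_finite_support[OF q, of i "bseq g"] by (simp add: BV_def)
qed

text \<open>The remainder estimate with n = 1 and k0 = m = 0: \<open>cexp 0\<close> is zero, so it
  bounds the whole operator. There are at most two one-step itineraries, whence \<beta> = 2.\<close>

lemma transfer_BV:
  "\<exists>C\<ge>0. \<forall>u\<in>BV. \<Phi> u \<in> BV \<and> BN (\<Phi> u) \<le> C * BN u"
proof -
  have two: "card (itin 1 ` Y) \<le> 2" for Y
  proof -
    have "itin 1 ` Y \<subseteq> Pow {0}" using itin_subset[of 1] by force
    then have "card (itin 1 ` Y) \<le> card (Pow {0 :: nat})" by (rule card_mono[rotated]) simp
    then show ?thesis by (simp add: card_Pow)
  qed
  have "real (card (itin 1 ` {-1..1})) \<le> 2 * lam ^ 1" using two[of "{-1..1}"] lam by simp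
  moreover have "card (itin 1 ` Y) \<le> 3" for Y using two[of Y] by linarith
  ultimately have "\<Phi> u \<in> BV \<and> BN (\<Phi> u) \<le> (50 * 2 * 2 powr (- real 0 * s) * (2 / (1 - dec))) * BN u" if "u \<in> BV" for u
    using transfer_iter_remainder[of 2 1 0 0 u] lam that by simp
  then show ?thesis using dec by (intro exI[of _ "50 * 2 * 2 powr (- real 0 * s) * (2 / (1 - dec))"]) auto
qed

lemma transfer_diff: "\<Phi> (\<lambda>x. u x - v x) = (\<lambda>x. \<Phi> u x - \<Phi> v x)"
  using transfer_add[of u "\<lambda>x. -1 * v x"] transfer_cmult[of "-1" v] by simp

lemma transfer_bounded:
  "bounded_linear_operator_on LI BV (besov_norm LI dyadic_grid s p q) \<Phi>"
proof -
  obtain C where C: "C \<ge> 0" "\<And>u. u \<in> BV \<Longrightarrow> \<Phi> u \<in> BV" "\<And>u. u \<in> BV \<Longrightarrow> BN (\<Phi> u) \<le> C * BN u"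
    using transfer_BV by metis
  let ?nrm = "besov_norm LI dyadic_grid s p q"
  define c1 where "c1 = 1 / \<rho> * (2 / (1 - \<rho>))"
  define c2 where "c2 = 2 * 2 powr s * (2 / (1 - \<rho>))"
  have c1: "c1 \<ge> 0" using \<rho> by (simp add: c1_def)
  have "AE x in LI. \<Phi> u x = \<Phi> v x" if uv: "u \<in> BV" "v \<in> BV" "AE x in LI. u x = v x" for u v
  proof -
    have d: "(\<lambda>x. u x - v x) \<in> BV" by (rule V_diff[OF uv(1,2)])
    \<comment> \<open>Invariance under almost everywhere equality follows from boundedness: a null
      function is mapped to a function of norm 0.\<close>
    have "BN (\<lambda>x. u x - v x) = 0" using uv(3) by (subst N_eq_0_iff[OF d]) simp
    then have "BN (\<Phi> (\<lambda>x. u x - v x)) = 0" using C(3)[OF d] N_nonneg[OF C(2)[OF d]] by simp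
    then have "AE x in LI. \<Phi> (\<lambda>x. u x - v x) x = 0" using N_eq_0_iff[OF C(2)[OF d]] by simp
    then show ?thesis unfolding transfer_diff by simp
  qed
  moreover have "?nrm (\<Phi> v) \<le> (c1 * C * c2) * ?nrm v" if v: "v \<in> BV" for v
  proof -
    have "?nrm (\<Phi> v) \<le> c1 * BN (\<Phi> v)" unfolding c1_def by (rule besov_norm_le[OF C(2)[OF v]])
    also have "\<dots> \<le> c1 * (C * (c2 * ?nrm v))"
      using C(3)[OF v] mult_left_mono[OF BN_le_besov_norm[OF v] C(1)] c1
      by (intro mult_left_mono) (auto simp: c2_def)
    finally show ?thesis by (simp add: mult.assoc)
  qed
  ultimately show ?thesis
    unfolding bounded_linear_operator_on_def using C(2) by (auto simp: transfer_add transfer_cmult)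
qed

lemma transfer_fredholm:
  assumes z: "lam powr (- s) < cmod z"
  shows "fredholm_on LI BV (besov_norm LI dyadic_grid s p q) (\<lambda>v x. z * v x - \<Phi> v x)"
proof -
  obtain C0 where C0: "\<And>u. u \<in> BV \<Longrightarrow> \<Phi> u \<in> BV" "\<And>u. u \<in> BV \<Longrightarrow> BN (\<Phi> u) \<le> C0 * BN u"
    using transfer_BV by metis
  \<comment> \<open>The relative margin of |z| over lam^(-s). N is chosen so that the gain
    \<theta>^N of a block exceeds its loss 3, and afterwards k so that the surplus beats
    \<open>C\<close>.\<close>
  define \<theta> where "\<theta> = cmod z * lam powr s"
  have lams: "lam powr (- s) * lam powr s = 1" using lam by (simp flip: powr_add)
  have \<theta>: "\<theta> > 1"
    using mult_strict_right_mono[OF z, of "lam powr s"] lam lams by (simp add: \<theta>_def)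
  have z\<theta>: "cmod z = \<theta> * lam powr (- s)" using lams by (simp add: \<theta>_def mult.assoc mult.commute)
  obtain N where N: "3 < \<theta> ^ N" using real_arch_pow[OF \<theta>] by blast
  obtain \<epsilon> where e: "\<epsilon> > 0" and loc: "\<And>Y. (\<And>x y. x \<in> Y \<Longrightarrow> y \<in> Y \<Longrightarrow> \<bar>x - y\<bar> \<le> \<epsilon>) \<Longrightarrow> card (itin N ` Y) \<le> 3"
    using itin_local[of N] by metis
  \<comment> \<open>Everything in the contraction constant that does not grow with k; the factor 2^s
    pays for rounding lam^n down to a power of 2. Thus \<open>C\<close> is available before k is
    chosen.\<close>
  define C where "C = 50 * (2 / \<epsilon> + 1) * 2 powr s * (2 / (1 - dec))"
  obtain k where k: "C < (\<theta> ^ N / 3) ^ k" using real_arch_pow[of "\<theta> ^ N / 3" C] N by auto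
  define n where "n = k * N"
  define \<beta> where "\<beta> = (2 / \<epsilon> + 1) * 3 ^ k"
  have \<beta>: "\<beta> \<ge> 1"
  proof -
    have "1 * 1 \<le> (2 / \<epsilon> + 1) * 3 ^ k" using e by (intro mult_mono one_le_power) auto
    then show ?thesis by (simp add: \<beta>_def)
  qed
  have B: "real (card (itin n ` {-1..1})) \<le> \<beta> * lam ^ n"
    unfolding n_def \<beta>_def by (rule card_itin_upper[OF loc e])
  obtain m where m: "2 ^ m \<le> lam ^ n" "lam ^ n \<le> 2 ^ Suc m" using dyadic_floor[OF lam_power_ge_1] by blast
  obtain k1 where k1: "\<forall>k\<ge>k1. \<forall>j<2 ^ k. card (itin n ` {y\<in>{-1..1}. didx k y = j}) \<le> 3"
    using itin_small_cells[of n] by blast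
  \<comment> \<open>Fine enough for cells to meet at most three laps of f^n, and at least m; its
    size affects only the rank of the part split off.\<close>
  define k' where "k' = max k1 m"
  define \<rho>' where "\<rho>' = 50 * \<beta> * 2 powr (- real m * s) * (2 / (1 - dec))"
  have rem: "(\<Phi> ^^ n) (\<lambda>x. u x - cexp (Suc k') u x) \<in> BV \<and> BN ((\<Phi> ^^ n) (\<lambda>x. u x - cexp (Suc k') u x)) \<le> \<rho>' * BN u"
    if "u \<in> BV" for u
    unfolding \<rho>'_def by (rule transfer_iter_remainder[OF \<beta> B m(1) _ _ that]) (use k1 in \<open>auto simp: k'_def\<close>)
  have \<rho>'0: "\<rho>' \<ge> 0" using \<beta> dec by (simp add: \<rho>'_def)
  have \<rho>'z: "\<rho>' < cmod z ^ n"
  proof -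
    have Ls: "(lam ^ n) powr (- s) = (lam powr (- s)) ^ n"
      using lam by (simp add: powr_powr mult.commute flip: powr_realpow)
    have "2 powr (- real m * s) = 2 powr s * (2 ^ Suc m) powr (- s)"
    proof -
      have "(2 ^ Suc m :: real) powr (- s) = 2 powr (- real (Suc m) * s)"
        by (simp add: powr_powr flip: powr_realpow del: power_Suc of_nat_Suc)
      then show ?thesis by (simp add: algebra_simps flip: powr_add)
    qed
    also have "\<dots> \<le> 2 powr s * (lam ^ n) powr (- s)"
      using m(2) s by (intro mult_left_mono powr_mono2') auto
    finally have "\<rho>' \<le> 50 * \<beta> * (2 powr s * (lam ^ n) powr (- s)) * (2 / (1 - dec))"
      unfolding \<rho>'_def using \<beta> dec by (intro mult_right_mono mult_left_mono) auto
    also have "\<dots> = C * 3 ^ k * (lam powr (- s)) ^ n" by (simp add: C_def \<beta>_def Ls)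
    also have "\<dots> < (\<theta> ^ N / 3) ^ k * 3 ^ k * (lam powr (- s)) ^ n"
      using k lam by (intro mult_strict_right_mono) auto
    also have "\<dots> = cmod z ^ n"
      by (simp add: z\<theta> n_def power_mult_distrib power_divide mult.commute[of k] power_mult)
    finally show ?thesis .
  qed
  \<comment> \<open>Indicators of the cells of level k'. With the averages as coefficients they
    reproduce \<open>cexp (Suc k')\<close>, which is the finite rank operator of the Fredholm
    criterion.\<close>
  define \<phi> where "\<phi> j x = (if didx k' x = j then 1 else 0 :: complex)" for j :: nat and x
  have sum\<phi>: "(\<Sum>j<2 ^ k'. davg k' j v * \<phi> j x) = cexp (Suc k') v x" for v x
  proof -
    have "(\<Sum>j<2 ^ k'. davg k' j v * \<phi> j x) = (\<Sum>j<2 ^ k'. if didx k' x = j then davg k' j v else 0)"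
      by (intro sum.cong) (auto simp: \<phi>_def)
    then show ?thesis by simp
  qed
  have K: "cmod (davg k' j v) \<le> (2 ^ k' / 2) powr (1 / p) * BN v" if v: "v \<in> BV" for j v
    by (rule order_trans[OF davg_bound[OF p BVD(1)[OF v]] mult_left_mono[OF Lp_norm_le_BN[OF v]]]) simp
  show ?thesis
  proof (rule fredholm_on_if_iterate_contracts[where D = "{..<2 ^ k'}" and \<phi> = \<phi> and e = "davg k'" and n = n
        and \<rho> = \<rho>' and K = "(2 ^ k' / 2) powr (1 / p)" and C = C0 and c = "2 * 2 powr s * (2 / (1 - \<rho>))"])
    show "\<phi> j \<in> BV" for j
      by (rule dstep_BV[of "Suc k'"]) (auto simp: \<phi>_def intro!: exI[of _ "\<lambda>i. if i = j then 1 else 0"])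
    show "davg k' j (\<lambda>x. u x + v x) = davg k' j u + davg k' j v" if "u \<in> BV" "v \<in> BV" for j u v
      by (intro davg_add Lp_space_LI_integrable[OF p] BVD that)
    show "BN ((\<Phi> ^^ n) (\<lambda>x. v x - (\<Sum>j<2 ^ k'. davg k' j v * \<phi> j x))) \<le> \<rho>' * BN v" if "v \<in> BV" for v
      unfolding sum\<phi> using rem[OF that] by simp
    show "BN v \<le> 2 * 2 powr s * (2 / (1 - \<rho>)) * besov_norm LI dyadic_grid s p q v" if "v \<in> BV" for v
      by (rule BN_le_besov_norm[OF that])
  qed (use C0 K \<rho>'0 \<rho>'z \<rho> in \<open>auto simp: transfer_add transfer_cmult davg_cmult\<close>)
qed

lemma transfer_essential_radius:
  "essential_spectral_radius LI BV (besov_norm LI dyadic_grid s p q) \<Phi> \<le> ennreal (lam powr (- s))"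
  unfolding essential_spectral_radius_def essential_spectrum_def
proof (rule SUP_least, clarify)
  fix z assume "\<not> fredholm_on LI BV (besov_norm LI dyadic_grid s p q) (\<lambda>v x. z * v x - \<Phi> v x)"
  then have "cmod z \<le> lam powr (- s)" using transfer_fredholm[of z] by linarith
  then show "ennreal (cmod z) \<le> ennreal (lam powr (- s))" by (rule ennreal_leI)
qed

end

theorem corollary8p1:
  fixes t :: real
  assumes "1 / 2 < t" and "t \<le> 1"
  shows "tent t ` {-1..1} \<subseteq> {-1..1} \<and>
    (\<exists>h::real. topological_entropy {-1..1} (tent t) = ereal h \<and> exp h = 2 * t) \<and>
    (\<forall>x\<in>{-1..1} - {0}. tent t differentiable (at x) \<and> \<bar>deriv (tent t) x\<bar> = 2 * t) \<and>
    (\<forall>(s::real) (p::real) (q::ereal).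
       0 < s \<and> s < 1 / p \<and> 1 \<le> p \<and> 1 \<le> q \<longrightarrow>
       (let M = lebesgue_on {-1..1};
            B = besov_space M dyadic_grid s p q;
            nrm = besov_norm M dyadic_grid s p q;
            \<Phi> = transfer_operator {-1..1} (tent t)
        in bounded_linear_operator_on M B nrm \<Phi> \<and>
           essential_spectral_radius M B nrm \<Phi> \<le> ennreal ((2 * t) powr (- s)) \<and>
           (2 * t) powr (- s) < 1))"
proof -
  interpret tent_map t by unfold_locales fact+
  have "tent t ` {-1..1} \<subseteq> {-1..1}" using tent_mem by blast
  moreover have "exp (ln lam) = 2 * t" using lam by (simp add: lam_def)
  moreover have "tent t differentiable (at x) \<and> \<bar>deriv (tent t) x\<bar> = 2 * t" if "x \<noteq> 0" for x
    using tent_has_derivative[OF that] abs_deriv_tent[OF that]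
    by (auto simp: lam_def real_differentiable_def)
  moreover have "bounded_linear_operator_on LI (besov_space LI dyadic_grid s p q) (besov_norm LI dyadic_grid s p q) \<Phi> \<and>
      essential_spectral_radius LI (besov_space LI dyadic_grid s p q) (besov_norm LI dyadic_grid s p q) \<Phi> \<le> ennreal ((2 * t) powr (- s)) \<and>
      (2 * t) powr (- s) < 1" if "0 < s \<and> s < 1 / p \<and> 1 \<le> p \<and> 1 \<le> q" for s p and q :: ereal
  proof -
    interpret tent_besov t s p q by unfold_locales (use that in auto)
    have "(2 * t) powr (- s) < 1" using s assms by (intro powr_less_one) auto
    then show ?thesis
      using transfer_bounded transfer_essential_radius by (simp add: besov_space_eq_BV lam_def)
  qed
  ultimately show ?thesis using tent_entropy unfolding Let_def by blast
qed

end
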